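(* Let $\Lambda$ be a rank-$2$ graph and let $\mathcal{V}=\{V_\lambda:\lambda\in\Lambda\}$ be a $\Lambda$-contraction on a Hilbert space $\mathsf{H}$. Then there exist a Hilbert space $\mathsf{K}\supset\mathsf{H}$ and a $\Lambda$-contraction $\mathcal{W}=\{W_\lambda:\lambda\in\Lambda\}$ on $\mathsf{K}$ consisting of partial isometries forming a Toeplitz $\Lambda$-family such that for each $\lambda\in\Lambda$ $$W_\lambda^*|_{\mathsf{H}}=V_\lambda^*.$$ One may assume that $\mathsf{K}=\overline{\mathrm{Lin}}\{W_\lambda\mathsf{H}:\lambda\in\Lambda\}$. Under this assumption, $\sum_{a\in\Lambda^0}W_a=I_{\mathsf{K}}$ if $\sum_{a\in\Lambda^0}V_a=I_{\mathsf{H}}$.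
   Context: A rank-$r$ graph $\Lambda$ is a small category with object set $\Lambda^0$ (objects are identified with their identity morphisms), range and source maps $r,s:\Lambda\to\Lambda^0$, and a shape functor $d:\Lambda\to\mathbb{N}_0^r$ with the factorisation property: for $m,n\in\mathbb{N}_0^r$ every $\lambda\in\Lambda$ with $d(\lambda)=m+n$ is a unique product $\lambda=\mu\nu$ with $d(\mu)=m$, $d(\nu)=n$, $s(\mu)=r(\nu)$. Write $\Lambda^n=\{\lambda:d(\lambda)=n\}$. A $\Lambda$-contraction on a Hilbert space $\mathsf{H}$ is a family $\{V_\lambda:\lambda\in\Lambda\}\subset B(\mathsf{H})$ such that: (i) $V_\lambda V_\mu=0$ if $s(\lambda)\ne r(\mu)$; (ii) $V_\lambda V_\mu=V_{\lambda\mu}$ if $s(\lambda)=r(\mu)$; (iii) $\sum_{\lambda\in\Lambda^n}V_\lambda V_\lambda^*\le I$ for all $n\in\mathbb{N}_0^r$; (iv) each $V_a$ ($a\in\Lambda^0$) is an orthogonal projection. Infinite sums are understood in the strong operator topology. A Toeplitz $\Lambda$-family in $B(\mathsf{K})$ is a family of partial isometries $\{x_\lambda:\lambda\in\Lambda\}$ such that: (i) $\{x_a:a\in\Lambda^0\}$ are mutually orthogonal projections; (ii) $x_\lambda x_\mu=x_{\lambda\mu}$ if $s(\lambda)=r(\mu)$; (iii) $x_\lambda^*x_\lambda=x_{s(\lambda)}$ for $\lambda\in\Lambda$; (iv) if $n\in\mathbb{N}_0^r\setminus\{0\}$, $a\in\Lambda^0$ and $F\subset\{\lambda\in\Lambda^n:r(\lambda)=a\}$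 is finite, then $x_a\ge\sum_{\lambda\in F}x_\lambda x_\lambda^*$.
   Formalization: K = closed Lin{W_λ H} is asserted only when the V_a sum to I_H, since it fails otherwise (e.g. all V_λ = 0 on H ≠ 0); in general K is taken as the closed linear span of H together with all W_λ H. *)

theory Defs
  imports "HOL-Analysis.Analysis"
begin

section \<open>Complex inner product spaces\<close>

text \<open>
  A complex inner product space is presented as a real inner product space (whose norm and topology
  it inherits) together with a multiplication by complex scalars and a sesquilinear form whose real
  part is the given real inner product. The form is linear in its first argument.
\<close>

class scaleC =
  fixes scaleC :: "complex \<Rightarrow> 'a \<Rightarrow> 'a" (infixr \<open>*\<^sub>C\<close> 75)

class complex_inner = real_inner + scaleC +
  fixes cinner :: "'a \<Rightarrow> 'a \<Rightarrow> complex"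
  assumes scaleC_add_right: "a *\<^sub>C (x + y) = a *\<^sub>C x + a *\<^sub>C y"
    and scaleC_add_left: "(a + b) *\<^sub>C x = a *\<^sub>C x + b *\<^sub>C x"
    and scaleC_scaleC: "a *\<^sub>C (b *\<^sub>C x) = (a * b) *\<^sub>C x"
    and scaleC_of_real: "complex_of_real r *\<^sub>C x = r *\<^sub>R x"
    and cinner_commute: "cinner x y = cnj (cinner y x)"
    and cinner_add_left: "cinner (x + y) z = cinner x z + cinner y z"
    and cinner_scaleC_left: "cinner (a *\<^sub>C x) y = a * cinner x y"
    and Re_cinner: "Re (cinner x y) = inner x y"

lemma scaleC_one: "1 *\<^sub>C x = (x :: 'a::complex_inner)"
  using scaleC_of_real[of 1 x] by simp

global_interpretation complex_vector: vector_space "scaleC :: complex \<Rightarrow> 'a \<Rightarrow> 'a::complex_inner"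
  defines csubspace = complex_vector.subspace
    and cspan = complex_vector.span
  by unfold_locales (simp_all add: scaleC_add_right scaleC_add_left scaleC_scaleC scaleC_one)

instantiation complex :: complex_inner
begin

definition scaleC_complex :: "complex \<Rightarrow> complex \<Rightarrow> complex" where
  "scaleC_complex = (*)"

definition cinner_complex :: "complex \<Rightarrow> complex \<Rightarrow> complex" where
  "cinner_complex x y = x * cnj y"

instance
  by standard
    (simp_all add: scaleC_complex_def cinner_complex_def algebra_simps scaleR_conv_of_real inner_complex_def)

end


section \<open>Hilbert spaces and their bounded operators\<close>

text \<open>
  A Hilbert space is a complete complex subspace \<open>H\<close> of some complex inner product type (possibly
  the whole type). An operator on \<open>H\<close> is a function on the ambient type of which only the
  restriction to \<open>H\<close> matters, so every notion below is relative to \<open>H\<close>.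
\<close>

definition hilbert_space :: "'a::complex_inner set \<Rightarrow> bool" where
  "hilbert_space H \<longleftrightarrow> csubspace H \<and> complete H"

definition bounded_operator :: "'a::complex_inner set \<Rightarrow> ('a \<Rightarrow> 'a) \<Rightarrow> bool" where
  "bounded_operator H A \<longleftrightarrow>
     (\<forall>x\<in>H. A x \<in> H) \<and>
     (\<forall>x\<in>H. \<forall>y\<in>H. A (x + y) = A x + A y) \<and>
     (\<forall>c. \<forall>x\<in>H. A (c *\<^sub>C x) = c *\<^sub>C A x) \<and>
     (\<exists>B. \<forall>x\<in>H. norm (A x) \<le> B * norm x)"

text \<open>
  For a bounded operator on a Hilbert space the vector described below exists and is unique, by the
  Riesz representation theorem.
\<close>

definition adjoint_op :: "'a::complex_inner set \<Rightarrow> ('a \<Rightarrow> 'a) \<Rightarrow> ('a \<Rightarrow> 'a)" where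
  "adjoint_op H A y = (THE z. z \<in> H \<and> (\<forall>x\<in>H. cinner (A x) y = cinner x z))"

definition op_le :: "'a::complex_inner set \<Rightarrow> ('a \<Rightarrow> 'a) \<Rightarrow> ('a \<Rightarrow> 'a) \<Rightarrow> bool" where
  "op_le H A B \<longleftrightarrow> (\<forall>x\<in>H. cinner (B x - A x) x \<in> \<real>\<^sub>\<ge>\<^sub>0)"

definition orthogonal_projection :: "'a::complex_inner set \<Rightarrow> ('a \<Rightarrow> 'a) \<Rightarrow> bool" where
  "orthogonal_projection H P \<longleftrightarrow>
     bounded_operator H P \<and> (\<forall>x\<in>H. P (P x) = P x) \<and> (\<forall>x\<in>H. adjoint_op H P x = P x)"

definition partial_isometry :: "'a::complex_inner set \<Rightarrow> ('a \<Rightarrow> 'a) \<Rightarrow> bool" where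
  "partial_isometry H A \<longleftrightarrow>
     bounded_operator H A \<and>
     (\<forall>x\<in>H. (\<forall>y\<in>H. A y = 0 \<longrightarrow> cinner x y = 0) \<longrightarrow> norm (A x) = norm x)"

text \<open>Unconditional convergence of \<open>\<Sum>i\<in>I. T i\<close> to \<open>S\<close> in the strong operator topology.\<close>

definition has_strong_sum ::
    "'a::complex_inner set \<Rightarrow> ('i \<Rightarrow> 'a \<Rightarrow> 'a) \<Rightarrow> ('a \<Rightarrow> 'a) \<Rightarrow> 'i set \<Rightarrow> bool" where
  "has_strong_sum H T S I \<longleftrightarrow> (\<forall>x\<in>H. ((\<lambda>i. T i x) has_sum S x) I)"

definition isometric_embedding ::
    "'a::complex_inner set \<Rightarrow> 'b::complex_inner set \<Rightarrow> ('a \<Rightarrow> 'b) \<Rightarrow> bool" where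
  "isometric_embedding H K J \<longleftrightarrow>
     (\<forall>x\<in>H. J x \<in> K) \<and>
     (\<forall>x\<in>H. \<forall>y\<in>H. J (x + y) = J x + J y) \<and>
     (\<forall>c. \<forall>x\<in>H. J (c *\<^sub>C x) = c *\<^sub>C J x) \<and>
     (\<forall>x\<in>H. \<forall>y\<in>H. cinner (J x) (J y) = cinner x y)"


section \<open>Higher-rank graphs\<close>

text \<open>
  Objects are identified with their identity morphisms, so \<open>vertices\<close> is a set of paths. The rank is
  the cardinality of the finite index type \<open>'r\<close>; vectors in \<open>nat ^ 'r\<close> are added componentwise.
  The product \<open>cmp G p q\<close> is meaningful only if \<open>src G p = rng G q\<close>.
\<close>

record ('l, 'r) rank_graph =
  paths :: "'l set"
  vertices :: "'l set"
  rng :: "'l \<Rightarrow> 'l"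
  src :: "'l \<Rightarrow> 'l"
  cmp :: "'l \<Rightarrow> 'l \<Rightarrow> 'l"
  shape :: "'l \<Rightarrow> nat ^ 'r"

definition small_category :: "('l, 'r::finite) rank_graph \<Rightarrow> bool" where
  "small_category G \<longleftrightarrow>
     vertices G \<subseteq> paths G \<and>
     (\<forall>p\<in>paths G. rng G p \<in> vertices G \<and> src G p \<in> vertices G) \<and>
     (\<forall>a\<in>vertices G. rng G a = a \<and> src G a = a) \<and>
     (\<forall>p\<in>paths G. \<forall>q\<in>paths G. src G p = rng G q \<longrightarrow>
        cmp G p q \<in> paths G \<and> rng G (cmp G p q) = rng G p \<and> src G (cmp G p q) = src G q) \<and>
     (\<forall>p\<in>paths G. cmp G (rng G p) p = p \<and> cmp G p (src G p) = p) \<and>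
     (\<forall>p\<in>paths G. \<forall>q\<in>paths G. \<forall>u\<in>paths G. src G p = rng G q \<longrightarrow> src G q = rng G u \<longrightarrow>
        cmp G (cmp G p q) u = cmp G p (cmp G q u))"

definition is_rank_graph :: "('l, 'r::finite) rank_graph \<Rightarrow> bool" where
  "is_rank_graph G \<longleftrightarrow>
     small_category G \<and>
     (\<forall>a\<in>vertices G. shape G a = 0) \<and>
     (\<forall>p\<in>paths G. \<forall>q\<in>paths G. src G p = rng G q \<longrightarrow>
        shape G (cmp G p q) = shape G p + shape G q) \<and>
     (\<forall>m n. \<forall>p\<in>paths G. shape G p = m + n \<longrightarrow>
        (\<exists>!(q, u). q \<in> paths G \<and> u \<in> paths G \<and> shape G q = m \<and> shape G u = n \<and>
           src G q = rng G u \<and> p = cmp G q u))"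

definition paths_of_shape :: "('l, 'r::finite) rank_graph \<Rightarrow> nat ^ 'r \<Rightarrow> 'l set" where
  "paths_of_shape G n = {p \<in> paths G. shape G p = n}"


section \<open>Operator families indexed by a higher-rank graph\<close>

definition graph_contraction ::
    "('l, 'r::finite) rank_graph \<Rightarrow> 'a::complex_inner set \<Rightarrow> ('l \<Rightarrow> 'a \<Rightarrow> 'a) \<Rightarrow> bool" where
  "graph_contraction G H V \<longleftrightarrow>
     (\<forall>p\<in>paths G. bounded_operator H (V p)) \<and>
     (\<forall>p\<in>paths G. \<forall>q\<in>paths G. src G p \<noteq> rng G q \<longrightarrow> (\<forall>x\<in>H. V p (V q x) = 0)) \<and>
     (\<forall>p\<in>paths G. \<forall>q\<in>paths G. src G p = rng G q \<longrightarrow> (\<forall>x\<in>H. V p (V q x) = V (cmp G p q) x)) \<and>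
     (\<forall>n. \<exists>S. bounded_operator H S \<and>
        has_strong_sum H (\<lambda>p x. V p (adjoint_op H (V p) x)) S (paths_of_shape G n) \<and>
        op_le H S (\<lambda>x. x)) \<and>
     (\<forall>a\<in>vertices G. orthogonal_projection H (V a))"

definition toeplitz_family ::
    "('l, 'r::finite) rank_graph \<Rightarrow> 'a::complex_inner set \<Rightarrow> ('l \<Rightarrow> 'a \<Rightarrow> 'a) \<Rightarrow> bool" where
  "toeplitz_family G K X \<longleftrightarrow>
     (\<forall>p\<in>paths G. partial_isometry K (X p)) \<and>
     (\<forall>a\<in>vertices G. orthogonal_projection K (X a)) \<and>
     (\<forall>a\<in>vertices G. \<forall>b\<in>vertices G. a \<noteq> b \<longrightarrow> (\<forall>x\<in>K. X a (X b x) = 0)) \<and>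
     (\<forall>p\<in>paths G. \<forall>q\<in>paths G. src G p = rng G q \<longrightarrow> (\<forall>x\<in>K. X p (X q x) = X (cmp G p q) x)) \<and>
     (\<forall>p\<in>paths G. \<forall>x\<in>K. adjoint_op K (X p) (X p x) = X (src G p) x) \<and>
     (\<forall>n a F. n \<noteq> 0 \<longrightarrow> a \<in> vertices G \<longrightarrow> finite F \<longrightarrow>
        F \<subseteq> {p \<in> paths_of_shape G n. rng G p = a} \<longrightarrow>
        op_le K (\<lambda>x. \<Sum>p\<in>F. X p (adjoint_op K (X p) x)) (X a))"

text \<open>
  The inclusion of \<open>H\<close> into the larger Hilbert space \<open>K\<close> is an isometric embedding \<open>J\<close>, so the
  condition that the adjoint of \<open>W p\<close> restricts on \<open>H\<close> to the adjoint of \<open>V p\<close> becomes an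
  intertwining relation.

  Since \<open>W a (J h) = J (V a h)\<close> for vertices \<open>a\<close>, every vector of \<open>H\<close> orthogonal to the ranges of
  the vertex projections is annihilated by all \<open>W p\<close>. Hence \<open>K\<close> can be the closed linear span of the
  spaces \<open>W p (J H)\<close> only if the vertex projections of \<open>V\<close> sum to the identity of \<open>H\<close>; in general
  minimality has to include \<open>J H\<close> itself among the generators.
\<close>

definition toeplitz_dilation ::
    "('l, 'r::finite) rank_graph \<Rightarrow> 'a::complex_inner set \<Rightarrow> ('l \<Rightarrow> 'a \<Rightarrow> 'a) \<Rightarrow>
     'b::complex_inner set \<Rightarrow> ('a \<Rightarrow> 'b) \<Rightarrow> ('l \<Rightarrow> 'b \<Rightarrow> 'b) \<Rightarrow> bool" where
  "toeplitz_dilation G H V K J W \<longleftrightarrow>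
     hilbert_space K \<and> isometric_embedding H K J \<and>
     graph_contraction G K W \<and> toeplitz_family G K W \<and>
     (\<forall>p\<in>paths G. \<forall>h\<in>H. adjoint_op K (W p) (J h) = J (adjoint_op H (V p) h))"


section \<open>Square-summable families\<close>

text \<open>
  An ambient type large enough to contain dilation spaces. For a Hilbert space \<open>H \<subseteq> 'a\<close>, the
  families with values in \<open>H\<close> form the Hilbert space direct sum of copies of \<open>H\<close> indexed by \<open>'i\<close>.
\<close>

typedef (overloaded) ('i, 'a) ell2 =
    "{f :: 'i \<Rightarrow> 'a::complex_inner. (\<lambda>i. (norm (f i))\<^sup>2) summable_on UNIV}"
  morphisms ell2_nth Abs_ell2
  by (rule exI[of _ "\<lambda>_. 0"]) simp

setup_lifting type_definition_ell2

lemma ell2_eqI: "(\<And>i. ell2_nth f i = ell2_nth g i) \<Longrightarrow> f = g"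
  by (metis ell2_nth_inject ext)

lemma norm_add_power2_le:
  fixes x y :: "'a::real_inner"
  shows "(norm (x + y))\<^sup>2 \<le> 2 * (norm x)\<^sup>2 + 2 * (norm y)\<^sup>2"
proof -
  have "0 \<le> inner (x - y) (x - y)"
    by (rule inner_ge_zero)
  then show ?thesis
    by (simp add: power2_norm_eq_inner inner_add_left inner_add_right inner_diff_left
        inner_diff_right inner_commute)
qed

lemma norm_scaleC:
  fixes x :: "'a::complex_inner"
  shows "norm (c *\<^sub>C x) = cmod c * norm x"
proof -
  have "cinner (c *\<^sub>C x) (c *\<^sub>C x) = c * cnj c * cinner x x"
    using cinner_commute[of x "c *\<^sub>C x"] cinner_commute[of x x]
    by (simp add: cinner_scaleC_left)
  also have "\<dots> = complex_of_real ((cmod c)\<^sup>2) * cinner x x"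
    by (simp only: complex_norm_square)
  finally have "inner (c *\<^sub>C x) (c *\<^sub>C x) = (cmod c)\<^sup>2 * inner x x"
    by (simp flip: Re_cinner)
  then show ?thesis
    by (simp add: norm_eq_sqrt_inner real_sqrt_mult)
qed

lemma norm_cinner_le:
  fixes x y :: "'a::complex_inner"
  shows "cmod (cinner x y) \<le> norm x * norm y"
proof (cases "cinner x y = 0")
  case False
  define c where "c = cnj (cinner x y) / cmod (cinner x y)"
  have c: "cmod c = 1"
    using False by (simp add: c_def norm_divide)
  have "c * cinner x y = complex_of_real (cmod (cinner x y))"
    using False by (simp add: c_def field_simps complex_norm_square[symmetric] power2_eq_square)
  then have "cmod (cinner x y) = inner (c *\<^sub>C x) y"
    by (simp add: cinner_scaleC_left flip: Re_cinner)
  also have "\<dots> \<le> norm (c *\<^sub>C x) * norm y"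
    by (rule norm_cauchy_schwarz)
  finally show ?thesis
    by (simp add: norm_scaleC c)
qed simp

lemma ell2_cinner_summable:
  fixes f g :: "'i \<Rightarrow> 'a::complex_inner"
  assumes "(\<lambda>i. (norm (f i))\<^sup>2) summable_on UNIV" "(\<lambda>i. (norm (g i))\<^sup>2) summable_on UNIV"
  shows "(\<lambda>i. cinner (f i) (g i)) summable_on UNIV"
proof -
  have sum: "(\<lambda>i. (norm (f i))\<^sup>2 + (norm (g i))\<^sup>2) summable_on UNIV"
    by (rule summable_on_add[OF assms])
  have le: "cmod (cinner (f i) (g i)) \<le> (norm (f i))\<^sup>2 + (norm (g i))\<^sup>2" for i
  proof -
    have "2 * (norm (f i) * norm (g i)) \<le> (norm (f i))\<^sup>2 + (norm (g i))\<^sup>2"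
      using sum_squares_bound[of "norm (f i)" "norm (g i)"] by simp
    moreover have "0 \<le> norm (f i) * norm (g i)"
      by simp
    ultimately show ?thesis
      using norm_cinner_le[of "f i" "g i"] by linarith
  qed
  have "(\<lambda>i. norm (cinner (f i) (g i))) summable_on UNIV"
    by (rule summable_on_comparison_test[OF sum]) (simp_all add: le)
  then show ?thesis
    by (rule abs_summable_summable)
qed

instantiation ell2 :: (type, complex_inner) complex_inner
begin

lift_definition zero_ell2 :: "('a, 'b) ell2" is "\<lambda>_. 0"
  by simp

lift_definition plus_ell2 :: "('a, 'b) ell2 \<Rightarrow> ('a, 'b) ell2 \<Rightarrow> ('a, 'b) ell2"
  is "\<lambda>f g i. f i + g i"
proof -
  fix f g :: "'a \<Rightarrow> 'b"
  assume "(\<lambda>i. (norm (f i))\<^sup>2) summable_on UNIV" "(\<lambda>i. (norm (g i))\<^sup>2) summable_on UNIV"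
  then have "(\<lambda>i. 2 * (norm (f i))\<^sup>2 + 2 * (norm (g i))\<^sup>2) summable_on UNIV"
    by (intro summable_on_add summable_on_cmult_right)
  then show "(\<lambda>i. (norm (f i + g i))\<^sup>2) summable_on UNIV"
    by (rule summable_on_comparison_test) (simp_all add: norm_add_power2_le)
qed

lift_definition uminus_ell2 :: "('a, 'b) ell2 \<Rightarrow> ('a, 'b) ell2" is "\<lambda>f i. - f i"
  by simp

definition minus_ell2 :: "('a, 'b) ell2 \<Rightarrow> ('a, 'b) ell2 \<Rightarrow> ('a, 'b) ell2" where
  "minus_ell2 f g = f + - g"

lift_definition scaleC_ell2 :: "complex \<Rightarrow> ('a, 'b) ell2 \<Rightarrow> ('a, 'b) ell2" is "\<lambda>c f i. c *\<^sub>C f i"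
  by (simp add: norm_scaleC power_mult_distrib summable_on_cmult_right)

definition scaleR_ell2 :: "real \<Rightarrow> ('a, 'b) ell2 \<Rightarrow> ('a, 'b) ell2" where
  "scaleR_ell2 r f = complex_of_real r *\<^sub>C f"

definition cinner_ell2 :: "('a, 'b) ell2 \<Rightarrow> ('a, 'b) ell2 \<Rightarrow> complex" where
  "cinner_ell2 f g = (\<Sum>\<^sub>\<infinity>i. cinner (ell2_nth f i) (ell2_nth g i))"

definition inner_ell2 :: "('a, 'b) ell2 \<Rightarrow> ('a, 'b) ell2 \<Rightarrow> real" where
  "inner_ell2 f g = Re (cinner f g)"

definition norm_ell2 :: "('a, 'b) ell2 \<Rightarrow> real" where
  "norm_ell2 f = sqrt (inner f f)"

definition dist_ell2 :: "('a, 'b) ell2 \<Rightarrow> ('a, 'b) ell2 \<Rightarrow> real" where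
  "dist_ell2 f g = norm (f - g)"

definition sgn_ell2 :: "('a, 'b) ell2 \<Rightarrow> ('a, 'b) ell2" where
  "sgn_ell2 f = inverse (norm f) *\<^sub>R f"

definition uniformity_ell2 :: "(('a, 'b) ell2 \<times> ('a, 'b) ell2) filter" where
  "uniformity_ell2 = (INF e\<in>{0<..}. principal {(x, y). dist x y < e})"

definition open_ell2 :: "('a, 'b) ell2 set \<Rightarrow> bool" where
  "open_ell2 U \<longleftrightarrow> (\<forall>x\<in>U. \<forall>\<^sub>F (x', y) in uniformity. x' = x \<longrightarrow> y \<in> U)"

instance
proof
  fix f g h :: "('a, 'b) ell2" and r s :: real and a b :: complex and U :: "('a, 'b) ell2 set"
  have summable: "(\<lambda>i. cinner (ell2_nth u i) (ell2_nth v i)) summable_on UNIV"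
    for u v :: "('a, 'b) ell2"
    using ell2_nth[of u] ell2_nth[of v] by (intro ell2_cinner_summable) auto
  show "f + g + h = f + (g + h)" "f + g = g + f" "0 + f = f" "- f + f = 0"
    by (rule ell2_eqI; transfer; simp)+
  show "f - g = f + - g"
    by (rule minus_ell2_def)
  show "r *\<^sub>R (f + g) = r *\<^sub>R f + r *\<^sub>R g" "(r + s) *\<^sub>R f = r *\<^sub>R f + s *\<^sub>R f"
    "r *\<^sub>R s *\<^sub>R f = (r * s) *\<^sub>R f" "1 *\<^sub>R f = f"
    unfolding scaleR_ell2_def
    by (rule ell2_eqI; transfer;
        simp add: scaleC_add_right scaleC_add_left scaleC_scaleC scaleC_one)+
  show "a *\<^sub>C (f + g) = a *\<^sub>C f + a *\<^sub>C g" "(a + b) *\<^sub>C f = a *\<^sub>C f + b *\<^sub>C f"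
    "a *\<^sub>C (b *\<^sub>C f) = (a * b) *\<^sub>C f"
    by (rule ell2_eqI; transfer; simp add: scaleC_add_right scaleC_add_left scaleC_scaleC)+
  show "complex_of_real r *\<^sub>C f = r *\<^sub>R f"
    by (simp add: scaleR_ell2_def)
  show cinner_comm: "cinner f g = cnj (cinner g f)" for f g :: "('a, 'b) ell2"
    unfolding cinner_ell2_def by (subst infsum_cnj[symmetric]) (simp flip: cinner_commute)
  show cinner_add: "cinner (f + g) h = cinner f h + cinner g h"
    unfolding cinner_ell2_def
    by (subst infsum_add[symmetric]) (simp_all add: summable plus_ell2.rep_eq cinner_add_left)
  show cinner_scale: "cinner (a *\<^sub>C f) g = a * cinner f g" for a
    unfolding cinner_ell2_def
    by (simp add: scaleC_ell2.rep_eq cinner_scaleC_left infsum_cmult_right')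
  show "Re (cinner f g) = inner f g"
    by (simp add: inner_ell2_def)
  show "inner f g = inner g f"
    using cinner_comm[of f g] by (simp add: inner_ell2_def)
  show "inner (f + g) h = inner f h + inner g h"
    by (simp add: inner_ell2_def cinner_add)
  show "inner (r *\<^sub>R f) g = r * inner f g"
    by (simp add: inner_ell2_def scaleR_ell2_def cinner_scale)
  have inner_self: "inner u u = (\<Sum>\<^sub>\<infinity>i. (norm (ell2_nth u i))\<^sup>2)"
    for u :: "('a, 'b) ell2"
    unfolding inner_ell2_def cinner_ell2_def
    by (subst infsum_Re[symmetric]) (simp_all add: summable Re_cinner power2_norm_eq_inner)
  show "0 \<le> inner f f"
    unfolding inner_self by (rule infsum_nonneg) simp
  show "(inner f f = 0) = (f = 0)"
  proof
    assume "inner f f = 0"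
    then have "ell2_nth f i = 0" for i
      using nonneg_infsum_le_0D[of "\<lambda>i. (norm (ell2_nth f i))\<^sup>2" UNIV i] ell2_nth[of f]
      by (simp add: inner_self)
    then show "f = 0"
      by (intro ell2_eqI) (simp add: zero_ell2.rep_eq)
  next
    assume "f = 0"
    then show "inner f f = 0"
      by (simp add: inner_self zero_ell2.rep_eq)
  qed
  show "norm f = sqrt (inner f f)"
    by (rule norm_ell2_def)
  show "dist f g = norm (f - g)"
    by (rule dist_ell2_def)
  show "sgn f = inverse (norm f) *\<^sub>R f"
    by (rule sgn_ell2_def)
  show "uniformity = (INF e\<in>{0<..}. principal {(x :: ('a, 'b) ell2, y). dist x y < e})"
    by (rule uniformity_ell2_def)
  show "open U = (\<forall>x\<in>U. \<forall>\<^sub>F (x', y) in uniformity. x' = x \<longrightarrow> y \<in> U)"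
    by (rule open_ell2_def)
qed

end

end

theory Submission
  imports Defs
begin

text \<open>
  The dilation is produced one direction of the graph at a time. A row contraction \<open>(V x)\<close> over the
  edges of the first direction has an isometric dilation of Schaeffer type, in which the defect
  \<open>1 - V\<^sup>* V\<close> is represented by honest vectors and the edges act by shifts. As in the commutant
  lifting theorem, the edges of the second direction lift to this dilation so that they remain a row
  contraction and still satisfy the commutation relations of the graph: the lift is built level by
  level, each step being the extension of a contraction from a subspace. Dilating the second
  direction in the same way, one obtains vectors \<open>w p h\<close> indexed by all paths. Their inner products
  show that \<open>w q h \<mapsto> w (p q) h\<close> is isometric, which defines the operators \<open>W p\<close> on the closed span.
\<close>

section \<open>Complex inner product spaces\<close>

text \<open>The obstacle is the order of the two dilations. After the second one, the isometries of
  the first direction live only on the middle space \<open>K\<close> and have no evident commuting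
  extension to the larger space \<open>L\<close>. So no operator of the first direction is put on
  \<open>L\<close> at that stage: vectors \<open>path_vec p k\<close> come from a normal form of
  \<open>p\<close>, with second-direction edges in front acting by isometries on \<open>L\<close>
  and the other edges acting inside \<open>K\<close>. First-direction edges still preserve inner
  products because unique factorisation matches pairs of edges bijectively when they are moved past
  each other. Lifting one direction over a dilation of the other involves exactly two directions;
  three commuting contractions need not have commuting isometric dilations. Edge sets may be
  infinite. Row operators are therefore adjoints of column operators, and linear maps are prescribed
  by relations between vectors together with a norm inequality. Operators given only on
  \<open>H\<close> are composed with the projection onto \<open>H\<close>, so that adjoint
  identities can be tested against every vector of the type.\<close>

lemma cinner_add_right: "cinner x (y + z) = cinner x y + cinner x (z::'a::complex_inner)"
  by (metis cinner_add_left cinner_commute complex_cnj_add)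

lemma cinner_scaleC_right: "cinner x (a *\<^sub>C y) = cnj a * cinner x (y::'a::complex_inner)"
  by (metis cinner_scaleC_left cinner_commute complex_cnj_mult)

lemma scaleC_zero_left [simp]: "0 *\<^sub>C x = (0::'a::complex_inner)"
  by (simp add: complex_vector.scale_zero_left)

lemma cinner_zero_left [simp]: "cinner 0 x = 0"
  using cinner_scaleC_left[of 0 0 x] by simp

lemma cinner_zero_right [simp]: "cinner x 0 = 0"
  using cinner_scaleC_right[of x 0 0] by simp

lemma scaleC_minus_one: "(- 1) *\<^sub>C x = - (x::'a::complex_inner)"
  by (metis add_eq_0_iff add.right_inverse scaleC_add_left scaleC_one scaleC_zero_left)

lemma cinner_minus_left [simp]: "cinner (- x) y = - cinner x (y::'a::complex_inner)"
  by (metis cinner_scaleC_left scaleC_minus_one mult_minus1)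

lemma cinner_minus_right [simp]: "cinner x (- y) = - cinner x (y::'a::complex_inner)"
  by (metis cinner_commute cinner_minus_left complex_cnj_minus)

lemma cinner_diff_left: "cinner (x - y) z = cinner x z - cinner y (z::'a::complex_inner)"
  using cinner_add_left[of x "- y" z] by simp

lemma cinner_diff_right: "cinner x (y - z) = cinner x y - cinner x (z::'a::complex_inner)"
  using cinner_add_right[of x y "- z"] by simp

lemma cinner_sum_left: "cinner (\<Sum>i\<in>I. f i) y = (\<Sum>i\<in>I. cinner (f i) (y::'a::complex_inner))"
  by (induction I rule: infinite_finite_induct) (auto simp: cinner_add_left)

lemma cinner_sum_right: "cinner y (\<Sum>i\<in>I. f i) = (\<Sum>i\<in>I. cinner y (f i :: 'a::complex_inner))"
  by (induction I rule: infinite_finite_induct) (auto simp: cinner_add_right)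

lemma cinner_self: "cinner x x = complex_of_real ((norm (x::'a::complex_inner))\<^sup>2)"
proof (rule complex_eqI)
  show "Re (cinner x x) = Re (complex_of_real ((norm x)\<^sup>2))"
    by (simp add: Re_cinner power2_norm_eq_inner)
  show "Im (cinner x x) = Im (complex_of_real ((norm x)\<^sup>2))"
    by (metis Im_complex_of_real Reals_cnj_iff cinner_commute complex_is_Real_iff)
qed

lemma norm_sq_cinner: "(norm x)\<^sup>2 = Re (cinner x (x::'a::complex_inner))"
  by (simp add: cinner_self)

lemma scaleR_scaleC: "r *\<^sub>R x = complex_of_real r *\<^sub>C (x::'a::complex_inner)"
  by (simp add: scaleC_of_real)

lemma bounded_bilinear_cinner:
  "bounded_bilinear (cinner :: 'a::complex_inner \<Rightarrow> 'a \<Rightarrow> complex)"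
proof
  show "\<exists>K. \<forall>(a::'a) b. norm (cinner a b) \<le> norm a * norm b * K"
    by (rule exI[of _ 1]) (simp add: norm_cinner_le)
qed (simp_all add: cinner_add_left cinner_add_right scaleR_scaleC cinner_scaleC_left
    cinner_scaleC_right scaleC_complex_def)

lemmas continuous_on_cinner [continuous_intros] =
  bounded_bilinear.continuous_on[OF bounded_bilinear_cinner]
lemmas bounded_linear_cinner_left = bounded_bilinear.bounded_linear_left[OF bounded_bilinear_cinner]

lemma cinner_eqI:
  assumes "\<And>z. cinner x z = cinner y (z::'a::complex_inner)"
  shows "x = y"
  using assms[of "x - y"] by (metis cinner_diff_left cinner_self eq_iff_diff_eq_0 norm_eq_zero
      of_real_eq_0_iff power_eq_0_iff)

lemma norm_sq_add_orthogonal: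
  assumes "cinner x (y::'a::complex_inner) = 0"
  shows "(norm (x + y))\<^sup>2 = (norm x)\<^sup>2 + (norm y)\<^sup>2"
  using assms cinner_commute[of y x]
  by (simp add: norm_sq_cinner cinner_add_left cinner_add_right del: of_real_power)

lemma norm_sq_sum_orthogonal:
  fixes f :: "'i \<Rightarrow> 'a::complex_inner"
  assumes "finite F" "\<And>i j. i \<in> F \<Longrightarrow> j \<in> F \<Longrightarrow> i \<noteq> j \<Longrightarrow> cinner (f i) (f j) = 0"
  shows "(norm (\<Sum>i\<in>F. f i))\<^sup>2 = (\<Sum>i\<in>F. (norm (f i))\<^sup>2)"
  using assms
proof (induction F)
  case (insert i F)
  have "cinner (f i) (\<Sum>i\<in>F. f i) = 0"
    unfolding cinner_sum_right using insert by (intro sum.neutral) auto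
  then show ?case
    using insert by (simp add: norm_sq_add_orthogonal)
qed simp

subsection \<open>Linear maps\<close>

definition clinear :: "('a::complex_inner \<Rightarrow> 'b::complex_inner) \<Rightarrow> bool" where
  "clinear T \<longleftrightarrow> (\<forall>x y. T (x + y) = T x + T y) \<and> (\<forall>c x. T (c *\<^sub>C x) = c *\<^sub>C T x)"

lemma clinearI:
  "(\<And>x y. T (x + y) = T x + T y) \<Longrightarrow> (\<And>c x. T (c *\<^sub>C x) = c *\<^sub>C T x) \<Longrightarrow> clinear T"
  by (simp add: clinear_def)

lemma clinear_add: "clinear T \<Longrightarrow> T (x + y) = T x + T y"
  and clinear_scaleC: "clinear T \<Longrightarrow> T (c *\<^sub>C x) = c *\<^sub>C T x"
  by (simp_all add: clinear_def)

lemma clinear_zero: "clinear T \<Longrightarrow> T 0 = 0"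
  using clinear_scaleC[of T 0 0] by simp

lemma clinear_minus: "clinear T \<Longrightarrow> T (- x) = - T x"
  by (metis clinear_scaleC scaleC_minus_one)

lemma clinear_diff: "clinear T \<Longrightarrow> T (x - y) = T x - T y"
  using clinear_add[of T x "- y"] by (simp add: clinear_minus)

lemma clinear_sum: "clinear T \<Longrightarrow> T (\<Sum>i\<in>I. f i) = (\<Sum>i\<in>I. T (f i))"
  by (induction I rule: infinite_finite_induct) (auto simp: clinear_add clinear_zero)

lemma clinear_comp: "clinear S \<Longrightarrow> clinear T \<Longrightarrow> clinear (\<lambda>x. S (T x))"
  by (simp add: clinear_def)

lemma clinear_plus: "clinear S \<Longrightarrow> clinear T \<Longrightarrow> clinear (\<lambda>x. S x + T x)"
  by (simp add: clinear_def scaleC_add_right algebra_simps)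

lemma scaleC_diff_right: "c *\<^sub>C (x - y) = c *\<^sub>C x - c *\<^sub>C (y::'a::complex_inner)"
  by (simp add: complex_vector.scale_right_diff_distrib)

lemma clinear_minus_fun: "clinear S \<Longrightarrow> clinear T \<Longrightarrow> clinear (\<lambda>x. S x - T x)"
  by (simp add: clinear_def scaleC_diff_right algebra_simps)

lemma clinear_bounded_linear:
  assumes "clinear T" "\<And>x. norm (T x) \<le> B * norm x"
  shows "bounded_linear T"
  by (rule bounded_linear_intro[where K = B])
    (use assms in \<open>auto simp: clinear_add clinear_scaleC scaleR_scaleC mult.commute\<close>)

lemma clinear_adjointI:
  assumes "\<And>x y. cinner (T x) y = cinner x (A (y::'b::complex_inner) :: 'a::complex_inner)"
  shows "clinear T"
  by (rule clinearI; rule cinner_eqI)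
    (simp_all add: assms cinner_add_left cinner_scaleC_left)

lemma bounded_linear_scaleC: "bounded_linear (\<lambda>x::'a::complex_inner. c *\<^sub>C x)"
  by (rule clinear_bounded_linear[where B = "cmod c"])
    (auto simp: clinear_def norm_scaleC scaleC_add_right scaleC_scaleC mult.commute)

section \<open>Closed complex spans\<close>

lemma csubspace_closure:
  fixes S :: "'a::complex_inner set"
  assumes "csubspace S"
  shows "csubspace (closure S)"
  unfolding complex_vector.subspace_def
proof (intro conjI ballI allI)
  show "0 \<in> closure S"
    using assms closure_subset complex_vector.subspace_0 by blast
next
  fix x y assume "x \<in> closure S" "y \<in> closure S"
  then obtain f g where "\<And>n. f n \<in> S" "f \<longlonglongrightarrow> x" "\<And>n. g n \<in> S" "g \<longlonglongrightarrow> y"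
    unfolding closure_sequential by blast
  then show "x + y \<in> closure S"
    unfolding closure_sequential
    by (intro exI[of _ "\<lambda>n. f n + g n"]) (auto intro: tendsto_add complex_vector.subspace_add[OF assms])
next
  fix c x assume "x \<in> closure S"
  then obtain f where f: "\<And>n. f n \<in> S" "f \<longlonglongrightarrow> x"
    unfolding closure_sequential by blast
  have "(\<lambda>n. c *\<^sub>C f n) \<longlonglongrightarrow> c *\<^sub>C x"
    using f(2) by (rule bounded_linear.tendsto[OF bounded_linear_scaleC])
  then show "c *\<^sub>C x \<in> closure S"
    unfolding closure_sequential
    using f(1) by (intro exI[of _ "\<lambda>n. c *\<^sub>C f n"]) (auto intro: complex_vector.subspace_scale[OF assms])
qed

lemma closure_cspan_induct:
  fixes G :: "'a::complex_inner set"
  assumes x: "x \<in> closure (cspan G)"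
    and gen: "\<And>g. g \<in> G \<Longrightarrow> P g"
    and zero: "P 0" and add: "\<And>x y. P x \<Longrightarrow> P y \<Longrightarrow> P (x + y)"
    and scale: "\<And>c x. P x \<Longrightarrow> P (c *\<^sub>C x)"
    and closed: "closed {x. P x}"
  shows "P x"
proof -
  have "cspan G \<subseteq> {x. P x}"
  proof
    fix y assume "y \<in> cspan G"
    then have "P y"
      by (induction rule: complex_vector.span_induct_alt) (auto intro: zero add scale gen)
    then show "y \<in> {x. P x}" by simp
  qed
  then have "closure (cspan G) \<subseteq> {x. P x}"
    using closed by (rule closure_minimal)
  with x show ?thesis by blast
qed

lemma clinear_eq_on_closure_cspan:
  fixes G :: "'a::complex_inner set"
  assumes "clinear S" "clinear T" "\<And>x. norm (S x) \<le> B * norm x" "\<And>x. norm (T x) \<le> C * norm x"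
    and "\<And>g. g \<in> G \<Longrightarrow> S g = T g" and "x \<in> closure (cspan G)"
  shows "S x = T x"
  using assms(6)
proof (rule closure_cspan_induct)
  show "closed {x. S x = T x}"
    using clinear_bounded_linear[OF assms(1,3)] clinear_bounded_linear[OF assms(2,4)]
    by (intro closed_Collect_eq linear_continuous_on)
qed (use assms in \<open>auto simp: clinear_add clinear_scaleC clinear_zero\<close>)

section \<open>Contractive extensions\<close>

text \<open>Take \<open>s = 1 / c\<close>, the minimum of the quadratic. With \<open>b\<close> the
  squared modulus of a form value, this is Cauchy-Schwarz when \<open>e\<close> is a squared length,
  and almost orthogonality when \<open>e\<close> is the excess over a minimal distance.\<close>

lemma quadratic_nonneg_bound:
  fixes b c e :: real
  assumes "\<And>s. 0 \<le> e - 2 * s * b + s\<^sup>2 * b * c" "0 \<le> b" "0 \<le> c"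
  shows "b \<le> e * c"
proof (cases "c = 0")
  case True
  have "b = 0"
  proof (rule ccontr)
    assume "b \<noteq> 0"
    \<comment> \<open>For \<open>c = 0\<close> the expression is linear in \<open>s\<close>, and at
      this \<open>s\<close> it equals \<open>-1\<close>.\<close>
    with assms(1)[of "(e + 1) / (2 * b)"] True show False by simp
  qed
  with True show ?thesis by simp
next
  case False
  with assms(1)[of "1 / c"] assms(3) show ?thesis
    by (simp add: field_simps power2_eq_square)
qed

text \<open>The projection theorem for a semi-definite form \<open>B\<close>, in disguise: \<open>y v\<close> is the limit of
  \<open>l\<^sub>n\<close> along a sequence \<open>(m\<^sub>n, l\<^sub>n)\<close> in \<open>R\<close> that minimises \<open>B (v - m\<^sub>n) (v - m\<^sub>n)\<close>.\<close>

lemma contractive_extension: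
  fixes B :: "'a::complex_inner \<Rightarrow> 'a \<Rightarrow> complex" and R :: "('a \<times> 'c::complex_inner) set"
  assumes B_add: "\<And>x y z. B (x + y) z = B x z + B y z"
    and B_scale: "\<And>c x z. B (c *\<^sub>C x) z = c * B x z"
    and B_commute: "\<And>x y. B x y = cnj (B y x)"
    and B_nonneg: "\<And>x. 0 \<le> Re (B x x)"
    and R_zero: "(0, 0) \<in> R"
    and R_add: "\<And>m l m' l'. (m, l) \<in> R \<Longrightarrow> (m', l') \<in> R \<Longrightarrow> (m + m', l + l') \<in> R"
    and R_scale: "\<And>c m l. (m, l) \<in> R \<Longrightarrow> (c *\<^sub>C m, c *\<^sub>C l) \<in> R"
    and R_bound: "\<And>m l. (m, l) \<in> R \<Longrightarrow> (norm l)\<^sup>2 \<le> Re (B m m)"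
    and R_L: "\<And>m l. (m, l) \<in> R \<Longrightarrow> l \<in> L"
    and L: "complete L"
  obtains y where "clinear y" "\<And>v. y v \<in> L" "\<And>m l. (m, l) \<in> R \<Longrightarrow> y m = l"
    "\<And>v. (norm (y v))\<^sup>2 \<le> Re (B v v)"
    "\<And>v. (\<And>m l. (m, l) \<in> R \<Longrightarrow> B v m = 0) \<Longrightarrow> y v = 0"
proof -
  define q where "q v = sqrt (Re (B v v))" for v
  have q_sq: "(q v)\<^sup>2 = Re (B v v)" and q_nonneg: "0 \<le> q v" for v
    using B_nonneg by (simp_all add: q_def)
  have B_add_r: "B z (x + y) = B z x + B z y" for x y z
    by (metis B_add B_commute complex_cnj_add)
  have B_scale_r: "B z (c *\<^sub>C x) = cnj c * B z x" for c x z
    by (metis B_scale B_commute complex_cnj_mult)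
  have B_diff: "B (x - y) z = B x z - B y z" for x y z
  proof -
    have "x - y = x + (-1) *\<^sub>C y" by (simp add: scaleC_minus_one)
    then show ?thesis by (simp only: B_add B_scale) simp
  qed
  have B_diff_r: "B z (x - y) = B z x - B z y" for x y z
  proof -
    have "x - y = x + (-1) *\<^sub>C y" by (simp add: scaleC_minus_one)
    then show ?thesis by (simp only: B_add_r B_scale_r) simp
  qed
  have B_zero: "B 0 z = 0" for z
    using B_scale[of 0 0 z] by simp
  \<comment> \<open>The coefficient \<open>s * B v m\<close> makes both cross terms real and equal,
    so the form becomes a real quadratic in \<open>s\<close>.\<close>
  have expand: "Re (B (v - (complex_of_real s * B v m) *\<^sub>C m) (v - (complex_of_real s * B v m) *\<^sub>C m))
      = Re (B v v) - 2 * s * (cmod (B v m))\<^sup>2 + s\<^sup>2 * (cmod (B v m))\<^sup>2 * Re (B m m)" for v m s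
  proof -
    have im: "Im (B m m) = 0"
      by (metis B_commute Reals_cnj_iff complex_is_Real_iff)
    show ?thesis
      unfolding B_diff B_diff_r B_scale B_scale_r cmod_power2
      by (subst (3) B_commute) (simp add: power2_eq_square im algebra_simps)
  qed
  have CS: "cmod (B v m) \<le> q v * q m" for v m
  proof -
    have "(cmod (B v m))\<^sup>2 \<le> Re (B v v) * Re (B m m)"
    proof (rule quadratic_nonneg_bound)
      fix s show "0 \<le> Re (B v v) - 2 * s * (cmod (B v m))\<^sup>2 + s\<^sup>2 * (cmod (B v m))\<^sup>2 * Re (B m m)"
        using B_nonneg[of "v - (complex_of_real s * B v m) *\<^sub>C m"] unfolding expand .
    qed (use B_nonneg in auto)
    then show ?thesis
      by (metis abs_le_square_iff abs_of_nonneg mult_nonneg_nonneg norm_ge_zero power_mult_distrib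
          q_nonneg q_sq)
  qed
  \<comment> \<open>\<open>val v l\<close> says that \<open>l\<close> is approximated by values of
    almost best approximations \<open>m\<close> to \<open>v\<close>: the error \<open>v - m\<close>
    is almost orthogonal to the domain of \<open>R\<close>, relative to \<open>q\<close>. Best
    approximations need not exist, nor be unique when the form is degenerate; this relation is
    linear from the start and asks for neither.\<close>
  define val where "val v l \<longleftrightarrow> (\<forall>e>0. \<exists>m l'. (m, l') \<in> R \<and> norm (l - l') \<le> e \<and>
      (\<forall>m' l''. (m', l'') \<in> R \<longrightarrow> cmod (B (v - m) m') \<le> e * q m'))" for v l
  have val_lincomb: "val (v + c *\<^sub>C v') (l + c *\<^sub>C l')" if v: "val v l" "val v' l'" for v v' l l' c
    unfolding val_def
  proof (intro allI impI)
    fix e :: real assume "0 < e"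
    define d where "d = e / (1 + cmod c)"
    have "0 < 1 + cmod c"
      by (simp add: add_pos_nonneg)
    then have "0 < d" "(1 + cmod c) * d = e"
      using \<open>0 < e\<close> by (simp_all add: d_def)
    then have d: "0 < d" "d + cmod c * d = e"
      by (simp_all add: algebra_simps)
    obtain m k where m: "(m, k) \<in> R" "norm (l - k) \<le> d"
        "\<And>m' l''. (m', l'') \<in> R \<Longrightarrow> cmod (B (v - m) m') \<le> d * q m'"
      using v(1) d(1) unfolding val_def by blast
    obtain n j where n: "(n, j) \<in> R" "norm (l' - j) \<le> d"
        "\<And>m' l''. (m', l'') \<in> R \<Longrightarrow> cmod (B (v' - n) m') \<le> d * q m'"
      using v(2) d(1) unfolding val_def by blast
    have "norm (l + c *\<^sub>C l' - (k + c *\<^sub>C j)) \<le> norm (l - k) + cmod c * norm (l' - j)"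
    proof -
      have "l + c *\<^sub>C l' - (k + c *\<^sub>C j) = (l - k) + c *\<^sub>C (l' - j)"
        by (simp add: scaleC_diff_right)
      then show ?thesis
        by (metis norm_scaleC norm_triangle_ineq)
    qed
    also have "\<dots> \<le> d + cmod c * d"
      using m(2) n(2) by (intro add_mono mult_left_mono) auto
    finally have "norm (l + c *\<^sub>C l' - (k + c *\<^sub>C j)) \<le> e"
      using d(2) by simp
    moreover have "cmod (B (v + c *\<^sub>C v' - (m + c *\<^sub>C n)) m') \<le> e * q m'" if "(m', l'') \<in> R" for m' l''
    proof -
      have "B (v + c *\<^sub>C v' - (m + c *\<^sub>C n)) m' = B (v - m) m' + c * B (v' - n) m'"
        by (simp add: B_add B_diff B_scale algebra_simps)
      then have "cmod (B (v + c *\<^sub>C v' - (m + c *\<^sub>C n)) m') \<le> cmod (B (v - m) m') + cmod c * cmod (B (v' - n) m')"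
        by (metis norm_mult norm_triangle_ineq)
      also have "\<dots> \<le> d * q m' + cmod c * (d * q m')"
        using m(3)[OF that] n(3)[OF that] by (intro add_mono mult_left_mono) auto
      also have "\<dots> = e * q m'"
        by (simp add: algebra_simps flip: d(2))
      finally show ?thesis .
    qed
    ultimately show "\<exists>m l''. (m, l'') \<in> R \<and> norm (l + c *\<^sub>C l' - l'') \<le> e \<and>
      (\<forall>m' l''. (m', l'') \<in> R \<longrightarrow> cmod (B (v + c *\<^sub>C v' - m) m') \<le> e * q m')"
      using R_add[OF m(1) R_scale[OF n(1)]] by blast
  qed
  have val_bound: "norm l \<le> q v" if v: "val v l" for v l
  proof (rule field_le_epsilon)
    fix e :: real assume "0 < e"
    then have e: "0 < e / 2" by simp
    obtain m k where m: "(m, k) \<in> R" "norm (l - k) \<le> e / 2"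
        "\<And>m' l''. (m', l'') \<in> R \<Longrightarrow> cmod (B (v - m) m') \<le> e / 2 * q m'"
      using v e unfolding val_def by blast
    \<comment> \<open>An almost best approximation is hardly longer than \<open>v\<close>: write
      \<open>B m m\<close> as \<open>B v m - B (v - m) m\<close> and cancel one factor
      \<open>q m\<close>.\<close>
    have "(q m)\<^sup>2 = Re (B v m) - Re (B (v - m) m)"
      by (simp add: q_sq B_diff)
    also have "\<dots> \<le> cmod (B v m) + cmod (B (v - m) m)"
      using abs_Re_le_cmod[of "B v m"] abs_Re_le_cmod[of "B (v - m) m"] by linarith
    also have "\<dots> \<le> (q v + e / 2) * q m"
      using CS[of v m] m(3)[OF m(1)] by (simp add: algebra_simps)
    finally have "q m \<le> q v + e / 2"
      using q_nonneg[of m] q_nonneg[of v] e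
      by (cases "q m = 0") (auto simp: power2_eq_square)
    moreover have "norm k \<le> q m"
      using R_bound[OF m(1)] q_nonneg[of m] by (metis abs_le_square_iff abs_of_nonneg norm_ge_zero q_sq)
    ultimately show "norm l \<le> q v + e"
      using m(2) norm_triangle_ineq2[of l k] by linarith
  qed
  have val_R: "val m l" if "(m, l) \<in> R" for m l
    unfolding val_def using that q_nonneg by (auto intro!: exI[of _ m] exI[of _ l] simp: B_zero)
  have val_zero: "val v 0" if "\<And>m l. (m, l) \<in> R \<Longrightarrow> B v m = 0" for v
    unfolding val_def using that R_zero q_nonneg by (auto intro!: exI[of _ 0])
  have val_unique: "l = l'" if "val v l" "val v l'" for v l l'
  proof -
    \<comment> \<open>The difference of two values is a value at the zero vector, where
      \<open>q\<close> vanishes.\<close>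
    have "val (v + (-1) *\<^sub>C v) (l + (-1) *\<^sub>C l')"
      using that by (rule val_lincomb)
    then have "norm (l - l') \<le> q 0"
      using val_bound by (fastforce simp: scaleC_minus_one)
    then show ?thesis by (simp add: q_def B_zero)
  qed
  have val_ex: "\<exists>l\<in>L. val v l" for v
  proof -
    define S where "S = (\<lambda>(m, l). Re (B (v - m) (v - m))) ` R"
    define d where "d = Inf S"
    have bdd: "bdd_below S"
      unfolding S_def using B_nonneg by (intro bdd_belowI[of _ 0]) auto
    have d_le: "d \<le> Re (B (v - m) (v - m))" if "(m, l) \<in> R" for m l
      unfolding d_def using bdd that by (intro cInf_lower) (auto simp: S_def)
    have near: "\<exists>m l. (m, l) \<in> R \<and> Re (B (v - m) (v - m)) < d + e" if e: "0 < e" for e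
    proof -
      have "S \<noteq> {}" using R_zero by (auto simp: S_def)
      then obtain s where "s \<in> S" "s < d + e"
        using cInf_lessD[of S "d + e"] e by (auto simp: d_def)
      then show ?thesis by (auto simp: S_def)
    qed
    then have "\<forall>n. \<exists>p. p \<in> R \<and> Re (B (v - fst p) (v - fst p)) < d + 1 / real (Suc n)"
      using near by (metis fst_conv zero_less_divide_1_iff of_nat_0_less_iff zero_less_Suc)
    then obtain p where p: "\<And>n. p n \<in> R"
        "\<And>n. Re (B (v - fst (p n)) (v - fst (p n))) < d + 1 / real (Suc n)"
      by metis
    define M where "M n = fst (p n)" for n
    define l where "l n = snd (p n)" for n
    have Ml: "(M n, l n) \<in> R" for n
      using p(1) by (simp add: M_def l_def)
    have M_near: "Re (B (v - M n) (v - M n)) < d + 1 / real (Suc n)" for n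
      using p(2) by (simp add: M_def)
    \<comment> \<open>A competitor \<open>M n + c m\<close> cannot beat the infimum
      \<open>d\<close>, while \<open>M n\<close> exceeds it by less than \<open>1 / (n + 1)\<close>;
      the quadratic bound turns this into almost orthogonality.\<close>
    have small: "(cmod (B (v - M n) m))\<^sup>2 \<le> 1 / real (Suc n) * Re (B m m)" if "(m, l') \<in> R" for n m l'
    proof (rule quadratic_nonneg_bound)
      fix s
      define c where "c = complex_of_real s * B (v - M n) m"
      have "(M n + c *\<^sub>C m, l n + c *\<^sub>C l') \<in> R"
        by (intro R_add Ml R_scale that)
      then have "d \<le> Re (B (v - M n - c *\<^sub>C m) (v - M n - c *\<^sub>C m))"
        using d_le by (simp add: diff_diff_eq)
      then show "0 \<le> 1 / real (Suc n) - 2 * s * (cmod (B (v - M n) m))\<^sup>2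
          + s\<^sup>2 * (cmod (B (v - M n) m))\<^sup>2 * Re (B m m)"
        using M_near[of n] unfolding c_def expand by linarith
    qed (use B_nonneg in auto)
    have dist_l: "(norm (l n - l k))\<^sup>2 \<le> 2 / real (Suc n) + 2 / real (Suc k)" for n k
    proof -
      have "(M n + (-1) *\<^sub>C M k, l n + (-1) *\<^sub>C l k) \<in> R"
        by (intro R_add Ml R_scale)
      then have "(norm (l n - l k))\<^sup>2 \<le> Re (B (M n - M k) (M n - M k))"
        using R_bound by (fastforce simp: scaleC_minus_one)
      \<comment> \<open>Parallelogram law. The midpoint of \<open>M n\<close> and \<open>M k\<close>
        is again in the domain of \<open>R\<close>, so its term is at least \<open>4 * d\<close> and
        absorbs the two copies of \<open>2 * d\<close>.\<close>
      also have "\<dots> = 2 * Re (B (v - M n) (v - M n)) + 2 * Re (B (v - M k) (v - M k))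
          - 4 * Re (B (v - (1/2) *\<^sub>C (M n + M k)) (v - (1/2) *\<^sub>C (M n + M k)))"
        by (simp add: B_diff B_diff_r B_scale B_scale_r B_add B_add_r algebra_simps)
      also have "\<dots> \<le> 2 / real (Suc n) + 2 / real (Suc k)"
      proof -
        have "2 / real (Suc j) = 2 * (1 / real (Suc j))" for j by simp
        then show ?thesis
          using M_near[of n] M_near[of k] d_le[OF R_scale[OF R_add[OF Ml[of n] Ml[of k]], of "1/2"]]
          by linarith
      qed
      finally show ?thesis .
    qed
    have "Cauchy l"
    proof (rule metric_CauchyI)
      fix e :: real assume "0 < e"
      then obtain N where N: "4 / e\<^sup>2 < real (Suc N)"
        by (metis less_Suc_eq of_nat_less_iff reals_Archimedean2 order.strict_trans)
      have "dist (l n) (l k) < e" if "N \<le> n" "N \<le> k" for n k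
      proof -
        have "2 / real (Suc n) + 2 / real (Suc k) \<le> 2 / real (Suc N) + 2 / real (Suc N)"
          using that by (intro add_mono divide_left_mono) auto
        also have "\<dots> = 4 / real (Suc N)" by simp
        also have "\<dots> < e\<^sup>2"
          using N \<open>0 < e\<close> by (simp add: field_simps)
        finally have "(norm (l n - l k))\<^sup>2 < e\<^sup>2"
          using dist_l[of n k] by linarith
        then show ?thesis
          using \<open>0 < e\<close> by (simp add: dist_norm power_less_imp_less_base)
      qed
      then show "\<exists>M. \<forall>m\<ge>M. \<forall>n\<ge>M. dist (l m) (l n) < e" by blast
    qed
    then obtain l0 where l0: "l0 \<in> L" "l \<longlonglongrightarrow> l0"
      using L R_L[OF Ml] unfolding complete_def by blast
    have "val v l0"
      unfolding val_def
    proof (intro allI impI)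
      fix e :: real assume "0 < e"
      obtain N1 where N1: "\<And>n. N1 \<le> n \<Longrightarrow> norm (l n - l0) < e"
        using LIMSEQ_D[OF l0(2) \<open>0 < e\<close>] by blast
      obtain N2 where N2: "1 / e\<^sup>2 < real N2"
        using reals_Archimedean2 by blast
      define n where "n = N1 + N2"
      have n: "1 / real (Suc n) \<le> e\<^sup>2"
      proof -
        have "1 / e\<^sup>2 \<le> real (Suc n)"
          using N2 by (simp add: n_def)
        then show ?thesis
          using \<open>0 < e\<close> by (simp add: field_simps)
      qed
      have "cmod (B (v - M n) m) \<le> e * q m" if "(m, l') \<in> R" for m l'
      proof -
        have "(cmod (B (v - M n) m))\<^sup>2 \<le> e\<^sup>2 * (q m)\<^sup>2"
          using small[OF that, of n] mult_right_mono[OF n B_nonneg[of m]] by (simp add: q_sq)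
        then show ?thesis
          using q_nonneg[of m] \<open>0 < e\<close>
          by (metis abs_le_square_iff abs_of_nonneg less_imp_le mult_nonneg_nonneg norm_ge_zero
              power_mult_distrib)
      qed
      moreover have "norm (l0 - l n) \<le> e"
        using N1[of n] by (simp add: n_def norm_minus_commute less_imp_le)
      ultimately show "\<exists>m l'. (m, l') \<in> R \<and> norm (l0 - l') \<le> e \<and>
          (\<forall>m' l''. (m', l'') \<in> R \<longrightarrow> cmod (B (v - m) m') \<le> e * q m')"
        using Ml by blast
    qed
    with l0(1) show ?thesis by blast
  qed
  then obtain y where y: "\<And>v. y v \<in> L" "\<And>v. val v (y v)"
    by metis
  show ?thesis
  proof (rule that[of y])
    \<comment> \<open>Uniqueness turns the linearity of \<open>val\<close> into that of
      \<open>y\<close>: additivity is \<open>c = 1\<close>, homogeneity the case of a zero first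
      summand.\<close>
    show "clinear y"
      using val_unique[OF y(2) val_lincomb[OF y(2) y(2), where c = 1]]
        val_unique[OF y(2) val_lincomb[OF val_R[OF R_zero] y(2)]]
      by (simp add: clinear_def scaleC_one)
    show "y v \<in> L" for v by (rule y(1))
    show "y m = l" if "(m, l) \<in> R" for m l
      using val_unique[OF y(2) val_R[OF that]] .
    show "(norm (y v))\<^sup>2 \<le> Re (B v v)" for v
      using val_bound[OF y(2), of v] power_mono[of "norm (y v)" "q v" 2] by (simp add: q_sq)
    show "y v = 0" if "\<And>m l. (m, l) \<in> R \<Longrightarrow> B v m = 0" for v
      using val_unique[OF y(2) val_zero[OF that]] .
  qed
qed

text \<open>Kept as a relation because single-valuedness is not known beforehand. It comes out of
  the norm inequality: a pair with first entry \<open>0\<close> must have second entry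
  \<open>0\<close>.\<close>

inductive_set pair_span :: "('a::complex_inner \<times> 'b::complex_inner) set \<Rightarrow> ('a \<times> 'b) set"
  for S where
  pair_span_base: "(m, l) \<in> S \<Longrightarrow> (m, l) \<in> pair_span S"
| pair_span_zero: "(0, 0) \<in> pair_span S"
| pair_span_add: "(m, l) \<in> pair_span S \<Longrightarrow> (m', l') \<in> pair_span S \<Longrightarrow> (m + m', l + l') \<in> pair_span S"
| pair_span_scale: "(m, l) \<in> pair_span S \<Longrightarrow> (c *\<^sub>C m, c *\<^sub>C l) \<in> pair_span S"

text \<open>Equal inner products of the generators pass to linear combinations, so
  \<open>contractive_extension\<close> applies with \<open>B = cinner\<close>. The result is the
  partial isometry whose initial space is the closed span of the first entries.\<close>

lemma isometric_extension:
  fixes S :: "('a::complex_inner \<times> 'b::complex_inner) set"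
  assumes iso: "\<And>m l m' l'. (m, l) \<in> S \<Longrightarrow> (m', l') \<in> S \<Longrightarrow> cinner l l' = cinner m m'"
    and S_L: "\<And>m l. (m, l) \<in> S \<Longrightarrow> l \<in> L"
    and L: "hilbert_space L"
  obtains y where "clinear y" "\<And>v. y v \<in> L" "\<And>m l. (m, l) \<in> S \<Longrightarrow> y m = l"
    "\<And>v. norm (y v) \<le> norm v"
    "\<And>v. (\<And>m l. (m, l) \<in> S \<Longrightarrow> cinner v m = 0) \<Longrightarrow> y v = 0"
proof -
  have base: "cinner l l' = cinner m m'" if "(m, l) \<in> pair_span S" "(m', l') \<in> S" for m l m' l'
    using that(1)
    by induction (auto simp: iso that(2) cinner_add_left cinner_scaleC_left)
  have *: "cinner l l' = cinner m m'" if "(m, l) \<in> pair_span S" "(m', l') \<in> pair_span S" for m l m' l'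
    using that(2)
    by induction (auto simp: base[OF that(1)] cinner_add_right cinner_scaleC_right)
  have sub: "csubspace L" and complete: "complete L"
    using L by (auto simp: hilbert_space_def)
  have in_L: "l \<in> L" if "(m, l) \<in> pair_span S" for m l
    using that by induction
      (auto intro: S_L complex_vector.subspace_0[OF sub] complex_vector.subspace_add[OF sub]
        complex_vector.subspace_scale[OF sub])
  have bound: "(norm l)\<^sup>2 \<le> Re (cinner m m)" if "(m, l) \<in> pair_span S" for m l
    using *[OF that that] by (simp add: norm_sq_cinner)
  obtain y where y: "clinear y" "\<And>v. y v \<in> L" "\<And>m l. (m, l) \<in> pair_span S \<Longrightarrow> y m = l"
    "\<And>v. (norm (y v))\<^sup>2 \<le> Re (cinner v v)"
    "\<And>v. (\<And>m l. (m, l) \<in> pair_span S \<Longrightarrow> cinner v m = 0) \<Longrightarrow> y v = 0"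
  proof (rule contractive_extension[of cinner "pair_span S" L])
    show "0 \<le> Re (cinner x x)" for x :: 'a
      by (simp add: cinner_self)
  qed (assumption | rule cinner_add_left cinner_scaleC_left cinner_commute complete
      | blast intro: pair_span.intros bound in_L)+
  show ?thesis
  proof (rule that[OF y(1,2)])
    show "y m = l" if "(m, l) \<in> S" for m l
      by (intro y(3) pair_span_base that)
    show "norm (y v) \<le> norm v" for v
      using y(4)[of v] by (simp flip: norm_sq_cinner)
    show "y v = 0" if orth: "\<And>m l. (m, l) \<in> S \<Longrightarrow> cinner v m = 0" for v
    proof (rule y(5))
      show "cinner v m = 0" if "(m, l) \<in> pair_span S" for m l
        using that by induction (auto simp: orth cinner_add_right cinner_scaleC_right)
    qed
  qed
qed

section \<open>Projections and adjoints\<close>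

lemma hilbert_space_csubspace: "hilbert_space H \<Longrightarrow> csubspace H"
  and hilbert_space_complete: "hilbert_space H \<Longrightarrow> complete H"
  by (simp_all add: hilbert_space_def)

lemmas hilbert_space_0 = complex_vector.subspace_0[OF hilbert_space_csubspace]
  and hilbert_space_add = complex_vector.subspace_add[OF hilbert_space_csubspace]
  and hilbert_space_diff = complex_vector.subspace_diff[OF hilbert_space_csubspace]
  and hilbert_space_scaleC = complex_vector.subspace_scale[OF hilbert_space_csubspace]
  and hilbert_space_sum = complex_vector.subspace_sum[OF hilbert_space_csubspace]

text \<open>Extend the identity of \<open>H\<close> to a contraction \<open>P\<close>. An idempotent
  of norm at most one is orthogonal: \<open>P\<close> kills \<open>u = x - P x\<close> and sends
  \<open>u - t h\<close> to \<open>- t h\<close>, so \<open>norm (t h) \<le> norm (u - t h)\<close>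
  for every \<open>t\<close>, which forces \<open>u\<close> to be orthogonal to
  \<open>h\<close>.\<close>

lemma orthogonal_projection_exists:
  assumes H: "hilbert_space (H :: 'a::complex_inner set)"
  shows "\<exists>P. clinear P \<and> (\<forall>x. P x \<in> H) \<and> (\<forall>x\<in>H. P x = x) \<and> (\<forall>x. norm (P x) \<le> norm x) \<and>
    (\<forall>x. \<forall>h\<in>H. cinner (P x) h = cinner x h)"
proof -
  obtain P where P: "clinear P" "\<And>v. P v \<in> H" "\<And>m l. (m, l) \<in> (\<lambda>h. (h, h)) ` H \<Longrightarrow> P m = l"
    "\<And>v. norm (P v) \<le> norm v"
    by (rule isometric_extension[of "(\<lambda>h. (h, h)) ` H" H]) (use H in auto)
  have P_id: "P h = h" if "h \<in> H" for h
    using P(3) that by auto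
  have "cinner (P x) h = cinner x h" if h: "h \<in> H" for x h
  proof -
    define u where "u = x - P x"
    have Pu: "P u = 0"
      by (simp add: u_def clinear_diff P(1) P_id[OF P(2)])
    \<comment> \<open>The quadratic coefficient is \<open>0\<close> because the squared norm of
      \<open>t h\<close> occurs on both sides of the contractivity inequality.\<close>
    have "(cmod (cinner u h))\<^sup>2 \<le> (norm u)\<^sup>2 * 0"
    proof (rule quadratic_nonneg_bound)
      fix s
      define t where "t = complex_of_real s * cinner u h"
      have "(norm (P (u - t *\<^sub>C h)))\<^sup>2 \<le> (norm (u - t *\<^sub>C h))\<^sup>2"
        by (intro power_mono P(4)) simp
      moreover have "P (u - t *\<^sub>C h) = - (t *\<^sub>C h)"
        by (simp add: clinear_diff clinear_scaleC P(1) Pu P_id h)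
      moreover have "(norm (u - t *\<^sub>C h))\<^sup>2 =
          (norm u)\<^sup>2 - 2 * Re (cnj t * cinner u h) + (norm (t *\<^sub>C h))\<^sup>2"
        unfolding norm_sq_cinner
        by (simp add: cinner_diff_left cinner_diff_right cinner_scaleC_left cinner_scaleC_right
            cinner_commute[of h u] algebra_simps)
      moreover have "Re (cnj t * cinner u h) = s * (cmod (cinner u h))\<^sup>2"
        by (simp add: t_def cmod_power2) (simp add: power2_eq_square algebra_simps)
      ultimately show "0 \<le> (norm u)\<^sup>2 - 2 * s * (cmod (cinner u h))\<^sup>2 + s\<^sup>2 * (cmod (cinner u h))\<^sup>2 * 0"
        by simp
    qed auto
    then have "cinner u h = 0" by simp
    then show ?thesis by (simp add: u_def cinner_diff_left)
  qed
  with P P_id show ?thesis by blast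
qed

text \<open>Composition with this projection turns an operator that matters only on \<open>H\<close>
  into a total linear map vanishing on the orthogonal complement.\<close>

definition cproj :: "'a::complex_inner set \<Rightarrow> 'a \<Rightarrow> 'a" where
  "cproj H = (SOME P. clinear P \<and> (\<forall>x. P x \<in> H) \<and> (\<forall>x\<in>H. P x = x) \<and> (\<forall>x. norm (P x) \<le> norm x) \<and>
    (\<forall>x. \<forall>h\<in>H. cinner (P x) h = cinner x h))"

context
  fixes H :: "'a::complex_inner set"
  assumes H: "hilbert_space H"
begin

lemma cproj_props:
  "clinear (cproj H) \<and> (\<forall>x. cproj H x \<in> H) \<and> (\<forall>x\<in>H. cproj H x = x) \<and>
    (\<forall>x. norm (cproj H x) \<le> norm x) \<and> (\<forall>x. \<forall>h\<in>H. cinner (cproj H x) h = cinner x h)"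
  unfolding cproj_def by (rule someI_ex[OF orthogonal_projection_exists[OF H]])

lemma clinear_cproj: "clinear (cproj H)"
  and cproj_in: "cproj H x \<in> H"
  and cproj_id: "x \<in> H \<Longrightarrow> cproj H x = x"
  and norm_cproj_le: "norm (cproj H x) \<le> norm x"
  and cinner_cproj: "h \<in> H \<Longrightarrow> cinner (cproj H x) h = cinner x h"
  using cproj_props by auto

lemma cproj_adjoint: "cinner (cproj H x) y = cinner x (cproj H y)"
  by (metis cinner_commute cinner_cproj cproj_in)

lemma riesz_representation:
  fixes \<phi> :: "'a \<Rightarrow> complex"
  assumes lin: "clinear \<phi>" and bound: "\<And>x. cmod (\<phi> x) \<le> B * norm x"
  shows "\<exists>z\<in>H. \<forall>h\<in>H. \<phi> h = cinner h z"
proof (cases "\<forall>h\<in>H. \<phi> h = 0")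
  case True
  then show ?thesis
    using hilbert_space_0[OF H] by (intro bexI[of _ 0]) auto
next
  case False
  then obtain v where v: "v \<in> H" "\<phi> v \<noteq> 0" by blast
  define N where "N = H \<inter> {x. \<phi> x = 0}"
  have "closed {x. \<phi> x = 0}"
    by (intro closed_Collect_eq linear_continuous_on clinear_bounded_linear[OF lin bound]
        continuous_on_const)
  then have "complete N"
    using hilbert_space_complete[OF H] unfolding N_def Int_commute[of H]
    by (metis Int_commute complete_Int_closed)
  moreover have "csubspace N"
    unfolding N_def complex_vector.subspace_def
    using hilbert_space_0[OF H] hilbert_space_add[OF H] hilbert_space_scaleC[OF H]
    by (auto simp: clinear_add[OF lin] clinear_scaleC[OF lin] clinear_zero[OF lin] scaleC_complex_def)
  ultimately have N: "hilbert_space N" by (simp add: hilbert_space_def)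
  obtain w where w: "w \<in> N" "\<And>n. n \<in> N \<Longrightarrow> cinner (v - w) n = 0"
    using orthogonal_projection_exists[OF N] by (metis cinner_diff_left right_minus_eq)
  define u where "u = v - w"
  have u: "u \<in> H" "\<phi> u \<noteq> 0" "u \<noteq> 0"
    using v w(1) hilbert_space_diff[OF H] by (auto simp: u_def N_def clinear_diff[OF lin])
  define z where "z = (cnj (\<phi> u) / complex_of_real ((norm u)\<^sup>2)) *\<^sub>C u"
  have "\<phi> h = cinner h z" if h: "h \<in> H" for h
  proof -
    have "h - (\<phi> h / \<phi> u) *\<^sub>C u \<in> N"
      using u h unfolding N_def
      by (auto intro!: hilbert_space_diff[OF H] hilbert_space_scaleC[OF H]
          simp: clinear_diff[OF lin] clinear_scaleC[OF lin] scaleC_complex_def)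
    then have "cinner (h - (\<phi> h / \<phi> u) *\<^sub>C u) u = 0"
      using w(2) by (metis cinner_commute complex_cnj_zero u_def)
    then have "cinner h u = \<phi> h / \<phi> u * complex_of_real ((norm u)\<^sup>2)"
      by (simp add: cinner_diff_left cinner_scaleC_left cinner_self)
    then show ?thesis
      using u by (simp add: z_def cinner_scaleC_right)
  qed
  moreover have "z \<in> H"
    using u(1) by (simp add: z_def hilbert_space_scaleC[OF H])
  ultimately show ?thesis by blast
qed

text \<open>Riesz gives for each \<open>y\<close> a representing vector in \<open>H\<close>, valid
  against all \<open>x\<close> in \<open>H\<close>. Since \<open>T\<close> factors through
  \<open>cproj H\<close>, the identity extends to every \<open>x\<close> of the type.\<close>

lemma total_adjoint_exists:
  fixes T :: "'a \<Rightarrow> 'b::complex_inner"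
  assumes lin: "clinear T" and bound: "\<And>x. norm (T x) \<le> B * norm x"
    and proj: "\<And>x. T (cproj H x) = T x"
  obtains A where "\<And>x y. cinner (T x) y = cinner x (A y)" "\<And>y. A y \<in> H"
proof -
  have "\<exists>z\<in>H. \<forall>x\<in>H. cinner (T x) y = cinner x z" for y
  proof (rule riesz_representation[where B = "B * norm y"])
    show "clinear (\<lambda>x. cinner (T x) y)"
      by (auto simp: clinear_def clinear_add[OF lin] clinear_scaleC[OF lin] cinner_add_left
          cinner_scaleC_left scaleC_complex_def)
    show "cmod (cinner (T x) y) \<le> B * norm y * norm x" for x
    proof -
      have "cmod (cinner (T x) y) \<le> norm (T x) * norm y"
        by (rule norm_cinner_le)
      also have "\<dots> \<le> (B * norm x) * norm y"
        by (intro mult_right_mono bound) simp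
      finally show ?thesis by (simp add: algebra_simps)
    qed
  qed
  then obtain A where A: "\<And>y. A y \<in> H" "\<And>x y. x \<in> H \<Longrightarrow> cinner (T x) y = cinner x (A y)"
    by metis
  have "cinner (T x) y = cinner x (A y)" for x y
    using A(2)[OF cproj_in, of x y] by (simp add: proj cinner_cproj A(1))
  then show thesis using A(1) that by blast
qed

lemma bounded_operator_total:
  assumes "bounded_operator H A"
  shows "clinear (\<lambda>x. A (cproj H x))" "\<exists>B. \<forall>x. norm (A (cproj H x)) \<le> B * norm x"
    "A (cproj H (cproj H x)) = A (cproj H x)" "A (cproj H x) \<in> H"
proof -
  show "clinear (\<lambda>x. A (cproj H x))"
    using assms cproj_in clinear_cproj by (auto simp: bounded_operator_def clinear_def)
  obtain B where B: "\<And>x. x \<in> H \<Longrightarrow> norm (A x) \<le> B * norm x"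
    using assms unfolding bounded_operator_def by blast
  \<comment> \<open>\<open>B\<close> may be negative when \<open>H\<close> is trivial, hence the
    absolute value.\<close>
  have "norm (A (cproj H x)) \<le> \<bar>B\<bar> * norm x" for x
  proof -
    have "norm (A (cproj H x)) \<le> B * norm (cproj H x)"
      by (intro B cproj_in)
    also have "\<dots> \<le> \<bar>B\<bar> * norm (cproj H x)"
      by (intro mult_right_mono) auto
    also have "\<dots> \<le> \<bar>B\<bar> * norm x"
      by (intro mult_left_mono norm_cproj_le) auto
    finally show ?thesis .
  qed
  then show "\<exists>B. \<forall>x. norm (A (cproj H x)) \<le> B * norm x" by blast
  show "A (cproj H (cproj H x)) = A (cproj H x)"
    by (simp add: cproj_id cproj_in)
  show "A (cproj H x) \<in> H"
    using assms cproj_in by (auto simp: bounded_operator_def)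
qed

lemma adjoint_opI:
  assumes "z \<in> H" "\<And>x. x \<in> H \<Longrightarrow> cinner (A x) y = cinner x z"
  shows "adjoint_op H A y = z"
  unfolding adjoint_op_def
proof (rule the_equality)
  fix z' assume z': "z' \<in> H \<and> (\<forall>x\<in>H. cinner (A x) y = cinner x z')"
  then have "cinner x z' = cinner x z" if "x \<in> H" for x
    using assms that by metis
  then have "cinner (z' - z) (z' - z) = 0"
    using z' assms(1) by (simp add: cinner_diff_right hilbert_space_diff[OF H])
  then show "z' = z" by (simp add: cinner_self)
qed (use assms in auto)

lemma adjoint_op:
  assumes A: "bounded_operator H A"
  shows adjoint_op_in: "y \<in> H \<Longrightarrow> adjoint_op H A y \<in> H"
    and cinner_adjoint_op: "x \<in> H \<Longrightarrow> y \<in> H \<Longrightarrow> cinner (A x) y = cinner x (adjoint_op H A y)"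
proof -
  obtain B where B: "\<And>x. norm (A (cproj H x)) \<le> B * norm x"
    using bounded_operator_total(2)[OF A] by blast
  obtain A' where A': "\<And>x y. cinner (A (cproj H x)) y = cinner x (A' y)" "\<And>y. A' y \<in> H"
    using total_adjoint_exists[OF bounded_operator_total(1)[OF A] B bounded_operator_total(3)[OF A]] by blast
  have "cinner (A x) y = cinner x (A' y)" if "x \<in> H" for x y
    using A'(1)[of x y] that by (simp add: cproj_id)
  then have "adjoint_op H A y = A' y" for y
    by (intro adjoint_opI A'(2))
  with A'(2) \<open>\<And>x y. x \<in> H \<Longrightarrow> cinner (A x) y = cinner x (A' y)\<close>
  show "y \<in> H \<Longrightarrow> adjoint_op H A y \<in> H"
    "x \<in> H \<Longrightarrow> y \<in> H \<Longrightarrow> cinner (A x) y = cinner x (adjoint_op H A y)"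
    by auto
qed

end

section \<open>Operators on square-summable families\<close>

lemma ell2_nth_zero [simp]: "ell2_nth 0 i = 0"
  and ell2_nth_add [simp]: "ell2_nth (f + g) i = ell2_nth f i + ell2_nth g i"
  and ell2_nth_uminus [simp]: "ell2_nth (- f) i = - ell2_nth f i"
  and ell2_nth_scaleC [simp]: "ell2_nth (c *\<^sub>C f) i = c *\<^sub>C ell2_nth f i"
  by (simp_all add: zero_ell2.rep_eq plus_ell2.rep_eq uminus_ell2.rep_eq scaleC_ell2.rep_eq)

lemma ell2_nth_diff [simp]: "ell2_nth (f - g) i = ell2_nth f i - ell2_nth g i"
  unfolding minus_ell2_def ell2_nth_add ell2_nth_uminus by simp

lemma clinear_ell2_nth: "clinear (\<lambda>f. ell2_nth f i)"
  by (simp add: clinear_def)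

lemma ell2_summable: "(\<lambda>i. (norm (ell2_nth f i))\<^sup>2) summable_on UNIV"
  using ell2_nth[of f] by simp

lemma ell2_cinner: "cinner f g = (\<Sum>\<^sub>\<infinity>i. cinner (ell2_nth f i) (ell2_nth g i))"
  by (rule cinner_ell2_def)

lemma ell2_cinner_summable': "(\<lambda>i. cinner (ell2_nth f i) (ell2_nth g i)) summable_on UNIV"
  by (intro ell2_cinner_summable ell2_summable)

lemma ell2_norm_has_sum: "((\<lambda>i. (norm (ell2_nth f i))\<^sup>2) has_sum (norm f)\<^sup>2) UNIV"
proof -
  have "((\<lambda>i. cinner (ell2_nth f i) (ell2_nth f i)) has_sum cinner f f) UNIV"
    unfolding ell2_cinner by (rule has_sum_infsum[OF ell2_cinner_summable'])
  then have "((\<lambda>i. Re (cinner (ell2_nth f i) (ell2_nth f i))) has_sum Re (cinner f f)) UNIV"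
    by (rule has_sum_Re)
  then show ?thesis by (simp flip: norm_sq_cinner)
qed

lemma ell2_sum_norm_le: "finite F \<Longrightarrow> (\<Sum>i\<in>F. (norm (ell2_nth f i))\<^sup>2) \<le> (norm f)\<^sup>2"
  by (rule finite_sum_le_has_sum[OF ell2_norm_has_sum]) auto

lemma norm_ell2_nth_le: "norm (ell2_nth f i) \<le> norm f"
proof (rule power2_le_imp_le)
  show "(norm (ell2_nth f i))\<^sup>2 \<le> (norm f)\<^sup>2"
    using ell2_sum_norm_le[of "{i}" f] by simp
qed simp

lemma ell2_norm_leI:
  assumes "\<And>F. finite F \<Longrightarrow> (\<Sum>i\<in>F. (norm (ell2_nth f i))\<^sup>2) \<le> B"
  shows "(norm f)\<^sup>2 \<le> B"
  by (rule has_sum_le_finite_sums[OF ell2_norm_has_sum]) (rule assms)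

lemma ell2_nth_Abs:
  assumes "\<And>F. finite F \<Longrightarrow> (\<Sum>i\<in>F. (norm (f i))\<^sup>2) \<le> B"
  shows "ell2_nth (Abs_ell2 f) = f"
proof -
  have "(\<lambda>i. (norm (f i))\<^sup>2) summable_on UNIV"
    by (rule nonneg_bounded_partial_sums_imp_summable_on[where C = B])
      (auto intro: assms eventually_finite_subsets_at_top_weakI)
  then show ?thesis by (simp add: Abs_ell2_inverse)
qed

definition ell2_single :: "'i \<Rightarrow> 'a::complex_inner \<Rightarrow> ('i, 'a) ell2" where
  "ell2_single i x = Abs_ell2 (\<lambda>j. if j = i then x else 0)"

lemma ell2_nth_single [simp]:
  fixes i :: 'i
  shows "ell2_nth (ell2_single i x) j = (if j = i then x else 0)"
  unfolding ell2_single_def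
proof (subst ell2_nth_Abs)
  fix F :: "'i set" assume "finite F"
  then show "(\<Sum>j\<in>F. (norm (if j = i then x else 0))\<^sup>2) \<le> (norm x)\<^sup>2"
    by (simp add: if_distrib[of norm] if_distrib[of "\<lambda>t. t\<^sup>2"] sum.delta' cong: if_cong)
qed simp

lemma clinear_ell2_single: "clinear (ell2_single i)"
  by (auto simp: clinear_def intro!: ell2_eqI)

lemma cinner_ell2_single_left: "cinner (ell2_single i x) f = cinner x (ell2_nth f i)"
proof -
  have "cinner (ell2_single i x) f = (\<Sum>\<^sub>\<infinity>j\<in>{i}. cinner (ell2_nth (ell2_single i x) j) (ell2_nth f j))"
    unfolding ell2_cinner by (rule infsum_cong_neutral) auto
  then show ?thesis by simp
qed

lemma cinner_ell2_single_right: "cinner f (ell2_single i x) = cinner (ell2_nth f i) x"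
  by (metis cinner_commute cinner_ell2_single_left)

lemma norm_ell2_single [simp]: "norm (ell2_single i x) = norm x"
proof -
  have "(norm (ell2_single i x))\<^sup>2 = (norm x)\<^sup>2"
    by (simp add: norm_sq_cinner cinner_ell2_single_left)
  then show ?thesis by simp
qed

text \<open>The squared distance from \<open>f\<close> to its restriction to a finite set is the
  missing part of the norm series.\<close>

lemma ell2_has_sum_single:
  fixes f :: "('i, 'a::complex_inner) ell2"
  shows "((\<lambda>i. ell2_single i (ell2_nth f i)) has_sum f) UNIV"
  unfolding has_sum_def
proof (rule Lim_null[THEN iffD2], rule tendsto_norm_zero_cancel)
  let ?s = "\<lambda>F. \<Sum>i\<in>F. ell2_single i (ell2_nth f i)"
  have eq: "(norm (f - ?s F))\<^sup>2 = (norm f)\<^sup>2 - (\<Sum>i\<in>F. (norm (ell2_nth f i))\<^sup>2)" if "finite F" for F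
  proof -
    have "(norm (?s F))\<^sup>2 = (\<Sum>i\<in>F. (norm (ell2_nth f i))\<^sup>2)"
      using that by (subst norm_sq_sum_orthogonal) (auto simp: cinner_ell2_single_left)
    moreover have "cinner (?s F) f = complex_of_real (\<Sum>i\<in>F. (norm (ell2_nth f i))\<^sup>2)"
      by (simp add: cinner_sum_left cinner_ell2_single_left cinner_self)
    ultimately show ?thesis
      using cinner_commute[of f "?s F"]
      by (simp add: norm_sq_cinner cinner_diff_left cinner_diff_right del: of_real_sum of_real_power)
  qed
  have "((\<lambda>F. sqrt ((norm f)\<^sup>2 - (\<Sum>i\<in>F. (norm (ell2_nth f i))\<^sup>2))) \<longlongrightarrow> sqrt ((norm f)\<^sup>2 - (norm f)\<^sup>2))
      (finite_subsets_at_top UNIV)"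
    using ell2_norm_has_sum[of f] unfolding has_sum_def by (intro tendsto_intros)
  moreover have "\<forall>\<^sub>F F in finite_subsets_at_top UNIV.
      sqrt ((norm f)\<^sup>2 - (\<Sum>i\<in>F. (norm (ell2_nth f i))\<^sup>2)) = norm (?s F - f)"
    by (rule eventually_finite_subsets_at_top_weakI)
      (simp add: norm_minus_commute flip: eq)
  ultimately show "((\<lambda>F. norm (?s F - f)) \<longlongrightarrow> 0) (finite_subsets_at_top UNIV)"
    by (simp add: tendsto_cong)
qed

text \<open>A partial isometry when \<open>g\<close> is injective on \<open>A\<close>. With the
  identity it truncates to \<open>A\<close>, with \<open>Some\<close> it drops the entry
  \<open>None\<close>, and with \<open>tl\<close> it is a shift: the entry at \<open>x # v\<close>
  becomes the old entry at \<open>v\<close>.\<close>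

definition ell2_reindex :: "('j \<Rightarrow> 'i) \<Rightarrow> 'j set \<Rightarrow> ('i, 'a::complex_inner) ell2 \<Rightarrow> ('j, 'a) ell2" where
  "ell2_reindex g A f = Abs_ell2 (\<lambda>j. if j \<in> A then ell2_nth f (g j) else 0)"

lemma ell2_nth_reindex:
  fixes g :: "'j \<Rightarrow> 'i"
  assumes "inj_on g A"
  shows "ell2_nth (ell2_reindex g A f) j = (if j \<in> A then ell2_nth f (g j) else 0)"
  unfolding ell2_reindex_def
proof (subst ell2_nth_Abs[where B = "(norm f)\<^sup>2"])
  fix F :: "'j set" assume F: "finite F"
  have "(\<Sum>j\<in>F. (norm (if j \<in> A then ell2_nth f (g j) else 0))\<^sup>2) =
      (\<Sum>j\<in>F \<inter> A. (norm (ell2_nth f (g j)))\<^sup>2)"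
    using F by (intro sum.mono_neutral_cong_right) auto
  also have "\<dots> = (\<Sum>i\<in>g ` (F \<inter> A). (norm (ell2_nth f i))\<^sup>2)"
    using assms by (subst sum.reindex) (auto intro: inj_on_subset)
  also have "\<dots> \<le> (norm f)\<^sup>2"
    using F by (intro ell2_sum_norm_le) auto
  finally show "(\<Sum>j\<in>F. (norm (if j \<in> A then ell2_nth f (g j) else 0))\<^sup>2) \<le> (norm f)\<^sup>2" .
qed simp

lemma clinear_ell2_reindex: "inj_on g A \<Longrightarrow> clinear (ell2_reindex g A)"
  by (auto simp: clinear_def ell2_nth_reindex intro!: ell2_eqI)

abbreviation ell2_restrict :: "'i set \<Rightarrow> ('i, 'a::complex_inner) ell2 \<Rightarrow> ('i, 'a) ell2" where
  "ell2_restrict \<equiv> ell2_reindex (\<lambda>i. i)"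

lemma ell2_nth_restrict [simp]:
  "ell2_nth (ell2_restrict A f) j = (if j \<in> A then ell2_nth f j else 0)"
  by (simp add: ell2_nth_reindex)

lemma cinner_ell2_disjoint:
  assumes "\<And>i. cinner (ell2_nth f i) (ell2_nth g i) = 0"
  shows "cinner f g = 0"
  unfolding ell2_cinner using assms by simp

lemma cinner_ell2_reindex:
  assumes "inj_on g A"
  shows "cinner (ell2_reindex g A f) (ell2_reindex g A f') = cinner (ell2_restrict (g ` A) f) f'"
proof -
  have "cinner (ell2_reindex g A f) (ell2_reindex g A f') =
      (\<Sum>\<^sub>\<infinity>j\<in>A. cinner (ell2_nth f (g j)) (ell2_nth f' (g j)))"
    unfolding ell2_cinner by (rule infsum_cong_neutral) (auto simp: ell2_nth_reindex assms)
  also have "\<dots> = (\<Sum>\<^sub>\<infinity>i\<in>g ` A. cinner (ell2_nth f i) (ell2_nth f' i))"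
    using infsum_reindex[OF assms, of "\<lambda>i. cinner (ell2_nth f i) (ell2_nth f' i)"]
    by (simp add: o_def)
  also have "\<dots> = cinner (ell2_restrict (g ` A) f) f'"
    unfolding ell2_cinner by (rule infsum_cong_neutral) auto
  finally show ?thesis .
qed

lemma cinner_ell2_restrict_left: "cinner (ell2_restrict A f) g = cinner f (ell2_restrict A g)"
  unfolding ell2_cinner by (rule infsum_cong) auto

lemma hilbert_space_ell2:
  fixes S :: "'i \<Rightarrow> 'a::complex_inner set"
  assumes S: "\<And>i. hilbert_space (S i)"
  shows "hilbert_space {f. \<forall>i. ell2_nth f i \<in> S i}"
  unfolding hilbert_space_def
proof
  show "csubspace {f. \<forall>i. ell2_nth f i \<in> S i}"
    unfolding complex_vector.subspace_def
    by (auto intro: hilbert_space_0[OF S] hilbert_space_add[OF S] hilbert_space_scaleC[OF S])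
  show "complete {f. \<forall>i. ell2_nth f i \<in> S i}"
    unfolding complete_def
  proof (intro allI impI)
    fix X :: "nat \<Rightarrow> ('i, 'a) ell2"
    assume X: "(\<forall>n. X n \<in> {f. \<forall>i. ell2_nth f i \<in> S i}) \<and> Cauchy X"
    have "\<exists>l\<in>S i. (\<lambda>n. ell2_nth (X n) i) \<longlonglongrightarrow> l" for i
    proof -
      have "Cauchy (\<lambda>n. ell2_nth (X n) i)"
      proof (rule metric_CauchyI)
        fix e :: real assume "0 < e"
        then obtain N where N: "\<And>m n. N \<le> m \<Longrightarrow> N \<le> n \<Longrightarrow> dist (X m) (X n) < e"
          using X metric_CauchyD by blast
        have "dist (ell2_nth (X m) i) (ell2_nth (X n) i) < e" if "N \<le> m" "N \<le> n" for m n
          using N[OF that] norm_ell2_nth_le[of "X m - X n" i] by (simp add: dist_norm)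
        then show "\<exists>N. \<forall>m\<ge>N. \<forall>n\<ge>N. dist (ell2_nth (X m) i) (ell2_nth (X n) i) < e" by blast
      qed
      then show ?thesis
        using X hilbert_space_complete[OF S, of i]
        unfolding complete_def mem_Collect_eq by meson
    qed
    then obtain l where l: "\<And>i. l i \<in> S i" "\<And>i. (\<lambda>n. ell2_nth (X n) i) \<longlonglongrightarrow> l i"
      by metis
    have lim: "(\<lambda>n. \<Sum>i\<in>F. (norm (ell2_nth (X n) i - ell2_nth (X m) i))\<^sup>2) \<longlonglongrightarrow>
        (\<Sum>i\<in>F. (norm (l i - ell2_nth (X m) i))\<^sup>2)" for F m
      by (intro tendsto_intros l(2))
    have close: "\<exists>N. \<forall>m\<ge>N. \<forall>F. finite F \<longrightarrow> (\<Sum>i\<in>F. (norm (l i - ell2_nth (X m) i))\<^sup>2) \<le> e\<^sup>2"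
      if e: "0 < e" for e
    proof -
      obtain N where N: "\<And>m n. N \<le> m \<Longrightarrow> N \<le> n \<Longrightarrow> dist (X m) (X n) < e"
        using X metric_CauchyD e by blast
      have "(\<Sum>i\<in>F. (norm (l i - ell2_nth (X m) i))\<^sup>2) \<le> e\<^sup>2" if "N \<le> m" "finite F" for m F
      proof (rule LIMSEQ_le_const2[OF lim])
        have "(\<Sum>i\<in>F. (norm (ell2_nth (X n) i - ell2_nth (X m) i))\<^sup>2) \<le> e\<^sup>2" if "N \<le> n" for n
        proof -
          have "(\<Sum>i\<in>F. (norm (ell2_nth (X n - X m) i))\<^sup>2) \<le> (norm (X n - X m))\<^sup>2"
            by (rule ell2_sum_norm_le[OF \<open>finite F\<close>])
          also have "\<dots> \<le> e\<^sup>2"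
            using N[OF that \<open>N \<le> m\<close>] by (intro power_mono) (auto simp: dist_norm)
          finally show ?thesis by simp
        qed
        then show "\<exists>N. \<forall>n\<ge>N. (\<Sum>i\<in>F. (norm (ell2_nth (X n) i - ell2_nth (X m) i))\<^sup>2) \<le> e\<^sup>2"
          by blast
      qed
      then show ?thesis by blast
    qed
    \<comment> \<open>\<open>X M\<close> serves as a base point: the pointwise limit differs from it
      by a family of square sum at most \<open>1\<close>, so the limit is square-summable.\<close>
    obtain M where M: "\<And>F. finite F \<Longrightarrow> (\<Sum>i\<in>F. (norm (l i - ell2_nth (X M) i))\<^sup>2) \<le> 1\<^sup>2"
      using close[of 1] by force
    define d where "d = Abs_ell2 (\<lambda>i. l i - ell2_nth (X M) i)"
    have d: "ell2_nth d i = l i - ell2_nth (X M) i" for i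
      unfolding d_def by (subst ell2_nth_Abs[OF M]) auto
    define L where "L = X M + d"
    have L: "ell2_nth L i = l i" for i
      by (simp add: L_def d)
    have "X \<longlonglongrightarrow> L"
    proof (rule metric_LIMSEQ_I)
      fix r :: real assume "0 < r"
      then obtain N where N: "\<And>m F. N \<le> m \<Longrightarrow> finite F \<Longrightarrow>
          (\<Sum>i\<in>F. (norm (l i - ell2_nth (X m) i))\<^sup>2) \<le> (r / 2)\<^sup>2"
        using close[of "r / 2"] by auto
      have "dist (X m) L < r" if "N \<le> m" for m
      proof -
        have "(norm (L - X m))\<^sup>2 \<le> (r / 2)\<^sup>2"
          by (rule ell2_norm_leI) (simp add: L N that)
        then have "norm (L - X m) \<le> r / 2"
          by (rule power2_le_imp_le) (use \<open>0 < r\<close> in simp)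
        then show ?thesis
          using \<open>0 < r\<close> by (simp add: dist_norm norm_minus_commute)
      qed
      then show "\<exists>N. \<forall>n\<ge>N. dist (X n) L < r" by blast
    qed
    then show "\<exists>l\<in>{f. \<forall>i. ell2_nth f i \<in> S i}. X \<longlonglongrightarrow> l"
      using l(1) L by (intro bexI[of _ L]) auto
  qed
qed

lemma norm_cinner_preserving:
  assumes "\<And>x y. cinner (\<phi> x) (\<phi> y) = cinner x y"
  shows "norm (\<phi> x) = norm x"
proof -
  have "(norm (\<phi> x))\<^sup>2 = (norm x)\<^sup>2"
    unfolding norm_sq_cinner assms ..
  then show ?thesis by simp
qed

text \<open>A family of families is one family over pairs, and \<open>\<iota>\<close> moves the
  pairs into \<open>'j\<close>. In this way nested direct sums return to one fixed index
  type.\<close>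

lemma ell2_flatten:
  fixes \<phi> :: "'x::complex_inner \<Rightarrow> ('j, 'h::complex_inner) ell2"
  assumes \<phi>: "clinear \<phi>" "\<And>x y. cinner (\<phi> x) (\<phi> y) = cinner x y"
    and \<iota>: "inj (\<iota> :: 'i \<times> 'j \<Rightarrow> 'j)"
  obtains \<Phi> :: "('i, 'x) ell2 \<Rightarrow> ('j, 'h) ell2"
  where "clinear \<Phi>" "\<And>f g. cinner (\<Phi> f) (\<Phi> g) = cinner f g"
proof -
  define U where "U f = Abs_ell2 (\<lambda>(i, j). ell2_nth (\<phi> (ell2_nth f i)) j)" for f :: "('i, 'x) ell2"
  have norm_\<phi>: "(norm (\<phi> x))\<^sup>2 = (norm x)\<^sup>2" for x
    by (simp add: norm_cinner_preserving[of \<phi>, OF \<phi>(2)])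
  have U: "ell2_nth (U f) (i, j) = ell2_nth (\<phi> (ell2_nth f i)) j" for f i j
    unfolding U_def
  proof (subst ell2_nth_Abs[where B = "(norm f)\<^sup>2"])
    fix F :: "('i \<times> 'j) set" assume F: "finite F"
    have "(\<Sum>p\<in>F. (norm (case p of (i, j) \<Rightarrow> ell2_nth (\<phi> (ell2_nth f i)) j))\<^sup>2) \<le>
        (\<Sum>p\<in>fst ` F \<times> snd ` F. (norm (case p of (i, j) \<Rightarrow> ell2_nth (\<phi> (ell2_nth f i)) j))\<^sup>2)"
      using F by (intro sum_mono2) (force intro: rev_image_eqI)+
    also have "\<dots> = (\<Sum>i\<in>fst ` F. \<Sum>j\<in>snd ` F. (norm (ell2_nth (\<phi> (ell2_nth f i)) j))\<^sup>2)"
      by (simp add: sum.cartesian_product case_prod_unfold)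
    also have "\<dots> \<le> (\<Sum>i\<in>fst ` F. (norm (ell2_nth f i))\<^sup>2)"
    proof (rule sum_mono)
      fix i
      show "(\<Sum>j\<in>snd ` F. (norm (ell2_nth (\<phi> (ell2_nth f i)) j))\<^sup>2) \<le> (norm (ell2_nth f i))\<^sup>2"
        using ell2_sum_norm_le[of "snd ` F" "\<phi> (ell2_nth f i)"] F by (simp add: norm_\<phi>)
    qed
    also have "\<dots> \<le> (norm f)\<^sup>2"
      using F by (intro ell2_sum_norm_le) auto
    finally show "(\<Sum>p\<in>F. (norm (case p of (i, j) \<Rightarrow> ell2_nth (\<phi> (ell2_nth f i)) j))\<^sup>2) \<le> (norm f)\<^sup>2" .
  qed simp
  have U_lin: "clinear U"
    by (rule clinearI; rule ell2_eqI)
      (auto simp: U clinear_add[OF \<phi>(1)] clinear_scaleC[OF \<phi>(1)] split: prod.splits)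
  have U_cinner: "cinner (U f) (U g) = cinner f g" for f g
  proof -
    have "(\<Sum>\<^sub>\<infinity>i. \<Sum>\<^sub>\<infinity>j. cinner (ell2_nth (U f) (i, j)) (ell2_nth (U g) (i, j))) =
        (\<Sum>\<^sub>\<infinity>p\<in>UNIV \<times> UNIV. cinner (ell2_nth (U f) p) (ell2_nth (U g) p))"
      using infsum_Sigma'_banach[of "\<lambda>i j. cinner (ell2_nth (U f) (i, j)) (ell2_nth (U g) (i, j))" UNIV "\<lambda>_. UNIV"]
        ell2_cinner_summable'[of "U f" "U g"]
      by (simp add: case_prod_unfold)
    moreover have "(\<Sum>\<^sub>\<infinity>j. cinner (ell2_nth (U f) (i, j)) (ell2_nth (U g) (i, j))) =
        cinner (ell2_nth f i) (ell2_nth g i)" for i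
      by (simp add: U \<phi>(2) flip: ell2_cinner)
    ultimately show ?thesis
      by (simp add: ell2_cinner[of "U f"] ell2_cinner[of f])
  qed
  define \<Phi> where "\<Phi> f = ell2_reindex (inv \<iota>) (range \<iota>) (U f)" for f
  have inj: "inj_on (inv \<iota>) (range \<iota>)"
    by (simp add: inj_on_inv_into)
  show thesis
  proof (rule that[of \<Phi>])
    show "clinear \<Phi>"
      unfolding \<Phi>_def by (intro clinear_comp[OF clinear_ell2_reindex[OF inj] U_lin])
    have "inv \<iota> ` range \<iota> = UNIV"
      using \<iota> by (simp add: image_image)
    moreover have "ell2_restrict UNIV (U f) = U f" for f
      by (rule ell2_eqI) simp
    ultimately show "cinner (\<Phi> f) (\<Phi> g) = cinner f g" for f g
      by (simp add: \<Phi>_def cinner_ell2_reindex[OF inj] U_cinner)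
  qed
qed

text \<open>The set of lists over any type is infinite, hence equipotent with its own
  square.\<close>

lemma inj_pair_list:
  assumes "\<exists>f :: 'i \<Rightarrow> 'l list. inj f"
  shows "\<exists>\<iota> :: 'i \<times> 'l list \<Rightarrow> 'l list. inj \<iota>"
proof -
  obtain f :: "'i \<Rightarrow> 'l list" where f: "inj f" using assms by blast
  have "\<exists>g. bij_betw g ((UNIV :: 'l list set) \<times> (UNIV :: 'l list set)) (UNIV :: 'l list set)"
    unfolding card_of_ordIso by (rule card_of_Times_same_infinite[OF infinite_UNIV_listI])
  then obtain g where "bij_betw g ((UNIV :: 'l list set) \<times> (UNIV :: 'l list set)) (UNIV :: 'l list set)" ..
  then have g: "inj g" by (simp add: bij_betw_def)
  have "inj (\<lambda>(i, u). g (f i, u))"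
  proof (rule injI)
    fix p q assume "(case p of (i, u) \<Rightarrow> g (f i, u)) = (case q of (i, u) \<Rightarrow> g (f i, u))"
    then have "(f (fst p), snd p) = (f (fst q), snd q)"
      by (intro injD[OF g]) (simp add: case_prod_unfold)
    then show "p = q"
      using injD[OF f] by (simp add: prod_eq_iff)
  qed
  then show ?thesis by blast
qed

section \<open>Row contractions and their defect operators\<close>

lemma norm_sq_le_imp_norm_le: "(norm x)\<^sup>2 \<le> (norm y)\<^sup>2 \<Longrightarrow> norm x \<le> norm y"
  by (rule power2_le_imp_le) auto

lemma norm_le_of_norm_sq_le_mult:
  fixes a b :: real
  assumes "a\<^sup>2 \<le> b * a" "0 \<le> a" "0 \<le> b"
  shows "a \<le> b"
proof (cases "a = 0")
  case False
  then show ?thesis using assms by (simp add: power2_eq_square)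
qed (use assms in simp)

text \<open>Cauchy-Schwarz and cancellation of \<open>norm x\<close>. With \<open>z = x\<close> it
  bounds projections; with \<open>z\<close> the image of \<open>x\<close> under a contraction it
  bounds the adjoint of that contraction.\<close>

lemma norm_le_of_Re_cinner_le:
  assumes "(norm x)\<^sup>2 = Re (cinner y z)" "norm z \<le> norm x"
  shows "norm (x::'a::complex_inner) \<le> norm (y::'b::complex_inner)"
proof (rule norm_le_of_norm_sq_le_mult)
  have "(norm x)\<^sup>2 \<le> norm y * norm z"
    using assms(1) norm_cinner_le[of y z] complex_Re_le_cmod[of "cinner y z"] by simp
  also have "\<dots> \<le> norm y * norm x"
    by (intro mult_left_mono assms(2)) simp
  finally show "(norm x)\<^sup>2 \<le> norm y * norm x" .
qed auto

text \<open>\<open>A x\<close> is the adjoint of \<open>V x\<close>; both are defined on the whole ambient type and vanish on the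
  orthogonal complement of \<open>H\<close>.\<close>

definition row_contraction ::
    "'a::complex_inner set \<Rightarrow> 'l set \<Rightarrow> ('l \<Rightarrow> 'a \<Rightarrow> 'a) \<Rightarrow> ('l \<Rightarrow> 'a \<Rightarrow> 'a) \<Rightarrow> bool" where
  "row_contraction H E V A \<longleftrightarrow> hilbert_space H \<and>
    (\<forall>x\<in>E. \<forall>g h. cinner (V x g) h = cinner g (A x h) \<and> V x g \<in> H \<and> A x g \<in> H) \<and>
    (\<forall>F h. finite F \<longrightarrow> F \<subseteq> E \<longrightarrow> (norm (\<Sum>x\<in>F. V x (h x)))\<^sup>2 \<le> (\<Sum>x\<in>F. (norm (h x))\<^sup>2))"

context
  fixes H :: "'a::complex_inner set" and E :: "'l set" and V A :: "'l \<Rightarrow> 'a \<Rightarrow> 'a"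
  assumes row: "row_contraction H E V A"
begin

lemma row_contraction_hilbert: "hilbert_space H"
  and row_contraction_adjoint: "x \<in> E \<Longrightarrow> cinner (V x g) h = cinner g (A x h)"
  and row_contraction_in: "x \<in> E \<Longrightarrow> V x g \<in> H"
  and row_contraction_adjoint_in: "x \<in> E \<Longrightarrow> A x g \<in> H"
  and row_contraction_norm: "finite F \<Longrightarrow> F \<subseteq> E \<Longrightarrow>
    (norm (\<Sum>x\<in>F. V x (k x)))\<^sup>2 \<le> (\<Sum>x\<in>F. (norm (k x))\<^sup>2)"
  using row by (auto simp: row_contraction_def)

lemma row_contraction_adjoint': "x \<in> E \<Longrightarrow> cinner (A x g) h = cinner g (V x h)"
  by (metis cinner_commute row_contraction_adjoint)

lemma row_contraction_clinear: "x \<in> E \<Longrightarrow> clinear (V x)"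
  by (rule clinear_adjointI[of _ "A x"]) (rule row_contraction_adjoint)

lemma row_contraction_adjoint_clinear: "x \<in> E \<Longrightarrow> clinear (A x)"
  by (rule clinear_adjointI[of _ "V x"]) (rule row_contraction_adjoint')

lemma row_contraction_adjoint_cproj: "x \<in> E \<Longrightarrow> A x (cproj H h) = A x h"
  by (rule cinner_eqI)
    (simp add: row_contraction_adjoint' cinner_cproj row_contraction_hilbert row_contraction_in)

text \<open>The adjoint of a row contraction is a column contraction: if \<open>y\<close> sums the
  \<open>V x (A x h)\<close> and \<open>s\<close> is the root of the left side, then
  \<open>norm y \<le> s\<close> and \<open>cinner y h\<close> is the square of \<open>s\<close>, so
  \<open>s \<le> norm h\<close>.\<close>

lemma row_contraction_adjoint_sum:
  assumes F: "finite F" "F \<subseteq> E"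
  shows "(\<Sum>x\<in>F. (norm (A x h))\<^sup>2) \<le> (norm h)\<^sup>2"
proof -
  define s where "s = sqrt (\<Sum>x\<in>F. (norm (A x h))\<^sup>2)"
  have s: "s\<^sup>2 = (\<Sum>x\<in>F. (norm (A x h))\<^sup>2)" "0 \<le> s"
    by (simp_all add: s_def sum_nonneg)
  define y where "y = (\<Sum>x\<in>F. V x (A x h))"
  have "(norm y)\<^sup>2 \<le> s\<^sup>2"
    unfolding y_def s(1) by (rule row_contraction_norm[OF F])
  then have y: "norm y \<le> s"
    using s(2) by (rule power2_le_imp_le)
  have "cinner y h = (\<Sum>x\<in>F. cinner (A x h) (A x h))"
    unfolding y_def cinner_sum_left using F by (intro sum.cong) (auto simp: row_contraction_adjoint)
  then have "s\<^sup>2 = Re (cinner y h)"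
    by (simp add: s(1) cinner_self)
  also have "\<dots> \<le> norm y * norm h"
    using norm_cinner_le[of y h] complex_Re_le_cmod[of "cinner y h"] by simp
  also have "\<dots> \<le> s * norm h"
    using y by (rule mult_right_mono) simp
  finally have "s \<le> norm h"
    using s(2) by (intro norm_le_of_norm_sq_le_mult[of s "norm h"]) (simp_all add: mult.commute)
  then show ?thesis
    unfolding s(1)[symmetric] using s(2) by (rule power_mono)
qed

definition row_adjoint :: "'a \<Rightarrow> ('l, 'a) ell2" where
  "row_adjoint h = Abs_ell2 (\<lambda>x. if x \<in> E then A x h else 0)"

lemma row_adjoint_sum_le:
  assumes "finite F"
  shows "(\<Sum>x\<in>F. (norm (if x \<in> E then A x h else 0))\<^sup>2) \<le> (norm h)\<^sup>2"
proof -
  have "(\<Sum>x\<in>F. (norm (if x \<in> E then A x h else 0))\<^sup>2) = (\<Sum>x\<in>F \<inter> E. (norm (A x h))\<^sup>2)"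
    using assms by (intro sum.mono_neutral_cong_right) auto
  then show ?thesis
    using row_contraction_adjoint_sum[of "F \<inter> E" h] assms by simp
qed

lemma ell2_nth_row_adjoint: "ell2_nth (row_adjoint h) x = (if x \<in> E then A x h else 0)"
  unfolding row_adjoint_def by (subst ell2_nth_Abs[OF row_adjoint_sum_le]) auto

lemma norm_row_adjoint: "norm (row_adjoint h) \<le> norm h"
  by (intro norm_sq_le_imp_norm_le ell2_norm_leI) (simp add: ell2_nth_row_adjoint row_adjoint_sum_le)

text \<open>\<open>T\<close> is taken as the adjoint of the column \<open>row_adjoint\<close>, so
  the possibly infinite sum of the \<open>V x\<close> over the entries of \<open>z\<close> never has
  to be formed.\<close>

lemma row_operator_exists:
  obtains T where "clinear T" "\<And>z. norm (T z) \<le> norm z" "\<And>z. T z \<in> H"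
    "\<And>x h. x \<in> E \<Longrightarrow> T (ell2_single x h) = V x h"
    "\<And>z h. cinner (T z) h = cinner z (row_adjoint h)"
proof -
  have lin: "clinear row_adjoint"
    by (rule clinearI; rule ell2_eqI)
      (auto simp: ell2_nth_row_adjoint row_contraction_adjoint_clinear clinear_add clinear_scaleC)
  have proj: "row_adjoint (cproj H h) = row_adjoint h" for h
    by (rule ell2_eqI) (auto simp: ell2_nth_row_adjoint row_contraction_adjoint_cproj)
  obtain T where T: "\<And>x y. cinner (row_adjoint x) y = cinner x (T y)" "\<And>y. T y \<in> H"
    by (rule total_adjoint_exists[OF row_contraction_hilbert lin, of 1])
      (use norm_row_adjoint proj in auto)
  have T': "cinner (T z) h = cinner z (row_adjoint h)" for z h
    by (metis T(1) cinner_commute)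
  show thesis
  proof (rule that[OF clinear_adjointI[OF T'] _ T(2) _ T'])
    show "norm (T z) \<le> norm z" for z
      by (rule norm_le_of_Re_cinner_le[of _ _ "row_adjoint (T z)"])
        (simp_all add: norm_row_adjoint norm_sq_cinner T')
    show "T (ell2_single x h) = V x h" if "x \<in> E" for x h
      by (rule cinner_eqI)
        (simp add: T' cinner_ell2_single_left ell2_nth_row_adjoint that row_contraction_adjoint)
  qed
qed

text \<open>The sum is the row operator times its adjoint: apply the bounded \<open>T\<close> to the
  expansion of \<open>row_adjoint h\<close> into single entries.\<close>

lemma row_contraction_has_sum:
  obtains S where "clinear S" "\<And>h. norm (S h) \<le> norm h" "\<And>h. S h \<in> H"
    "\<And>h. ((\<lambda>x. V x (A x h)) has_sum S h) E" "\<And>h. cinner (S h) h \<in> {0..complex_of_real ((norm h)\<^sup>2)}"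
proof -
  obtain T where T: "clinear T" "\<And>z. norm (T z) \<le> norm z" "\<And>z. T z \<in> H"
    "\<And>x h. x \<in> E \<Longrightarrow> T (ell2_single x h) = V x h" "\<And>z h. cinner (T z) h = cinner z (row_adjoint h)"
    using row_operator_exists by metis
  have T_bl: "bounded_linear T"
    by (rule clinear_bounded_linear[OF T(1), of 1]) (simp add: T(2))
  have C_lin: "clinear row_adjoint"
    by (rule clinear_adjointI[of _ T]) (metis T(5) cinner_commute)
  show thesis
  proof (rule that[of "\<lambda>h. T (row_adjoint h)"])
    show "clinear (\<lambda>h. T (row_adjoint h))"
      by (rule clinear_comp[OF T(1) C_lin])
    show "norm (T (row_adjoint h)) \<le> norm h" for h
      using T(2)[of "row_adjoint h"] norm_row_adjoint[of h] by linarith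
    have "((\<lambda>x. T (ell2_single x (ell2_nth (row_adjoint h) x))) has_sum T (row_adjoint h)) UNIV" for h
      using has_sum_bounded_linear[OF T_bl ell2_has_sum_single] by (simp add: o_def)
    then show "((\<lambda>x. V x (A x h)) has_sum T (row_adjoint h)) E" for h
      by (rule has_sum_cong_neutral[THEN iffD1, rotated -1])
        (auto simp: ell2_nth_row_adjoint T(4) clinear_zero[OF T(1)] clinear_zero[OF clinear_ell2_single])
    show "cinner (T (row_adjoint h)) h \<in> {0..complex_of_real ((norm h)\<^sup>2)}" for h
      using power_mono[OF norm_row_adjoint[of h], of 2]
      by (simp add: T(5) cinner_self less_eq_complex_def flip: of_real_power)
  qed (rule T(3))
qed

end

section \<open>Defect of a symmetric contraction\<close>

lemma norm_sq_add:
  fixes u v :: "'a::complex_inner"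
  shows "(norm (u + v))\<^sup>2 = (norm u)\<^sup>2 + 2 * Re (cinner u v) + (norm v)\<^sup>2"
  by (simp add: norm_sq_cinner cinner_add_left cinner_add_right cinner_commute[of v u])

lemma cinner_defect_polarization:
  assumes "clinear D" "clinear c" "\<And>z. (norm (D z))\<^sup>2 = (norm z)\<^sup>2 - (norm (c z))\<^sup>2"
  shows "cinner (D x) (D y) = cinner x y - cinner (c x) (c y)"
proof -
  have re: "Re (cinner (D x) (D y)) = Re (cinner x y) - Re (cinner (c x) (c y))" for x y
  proof -
    show ?thesis
      using assms(3)[of "x + y"] assms(3)[of x] assms(3)[of y]
      unfolding clinear_add[OF assms(1)] clinear_add[OF assms(2)] norm_sq_add by simp
  qed
  show ?thesis
    using re[of x y] re[of "\<i> *\<^sub>C x" y]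
    by (intro complex_eqI)
      (simp_all add: clinear_scaleC[OF assms(1)] clinear_scaleC[OF assms(2)] cinner_scaleC_left)
qed

text \<open>For a symmetric contraction \<open>c\<close> this avoids the square root of \<open>1 - c\<^sup>2\<close>: since
  \<open>1 - t = (1 - t)\<^sup>2 (1 + t + t\<^sup>2 + \<dots>)\<close>, the vectors \<open>c\<^sup>n (1 - c\<^sup>2) z\<close> have square sum
  \<open>\<parallel>z\<parallel>\<^sup>2 - \<parallel>c z\<parallel>\<^sup>2\<close>.\<close>

definition defect_sequence :: "('z::complex_inner \<Rightarrow> 'z) \<Rightarrow> 'z \<Rightarrow> (nat, 'z) ell2" where
  "defect_sequence c z = Abs_ell2 (\<lambda>n. (c ^^ n) (z - c (c z)))"

context
  fixes c :: "'z::complex_inner \<Rightarrow> 'z"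
  assumes sym: "\<And>x y. cinner (c x) y = cinner x (c y)"
    and contr: "\<And>x. norm (c x) \<le> norm x"
begin

lemma clinear_symmetric: "clinear c"
  by (rule clinear_adjointI) (rule sym)

lemma clinear_symmetric_funpow: "clinear (c ^^ n)"
proof (induction n)
  case (Suc n)
  then show ?case
    using clinear_comp[OF clinear_symmetric Suc] by (simp add: o_def)
qed (simp add: clinear_def)

text \<open>Each term is a second difference of the squared norms of \<open>(c ^^ n) z\<close>, so
  the partial sums telescope.\<close>

lemma norm_sq_defect_term:
  "(norm ((c ^^ n) (z - c (c z))))\<^sup>2 =
    (norm ((c ^^ n) z))\<^sup>2 - 2 * (norm ((c ^^ Suc n) z))\<^sup>2 + (norm ((c ^^ Suc (Suc n)) z))\<^sup>2"
proof -
  define x where "x = (c ^^ n) z"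
  have "(c ^^ n) (z - c (c z)) = x - c (c x)"
    by (simp add: clinear_diff[OF clinear_symmetric_funpow] x_def funpow_swap1)
  moreover have "(norm (x - c (c x)))\<^sup>2 = (norm x)\<^sup>2 - 2 * (norm (c x))\<^sup>2 + (norm (c (c x)))\<^sup>2"
    using sym[of "c x" x] sym[of x "c x"]
    by (simp add: norm_sq_cinner cinner_diff_left cinner_diff_right)
  ultimately show ?thesis by (simp add: x_def)
qed

lemma defect_partial_sum:
  "(\<Sum>n<N. (norm ((c ^^ n) (z - c (c z))))\<^sup>2) = (norm z)\<^sup>2 - (norm (c z))\<^sup>2 -
    ((norm ((c ^^ N) z))\<^sup>2 - (norm ((c ^^ Suc N) z))\<^sup>2)"
proof (induction N)
  case (Suc N)
  then show ?case by (simp only: sum.lessThan_Suc norm_sq_defect_term)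
qed simp

lemma norm_symmetric_funpow_Suc_le: "(norm ((c ^^ Suc N) z))\<^sup>2 \<le> (norm ((c ^^ N) z))\<^sup>2"
  by (intro power_mono) (simp_all add: contr)

lemma ell2_nth_defect_sequence: "ell2_nth (defect_sequence c z) n = (c ^^ n) (z - c (c z))"
  unfolding defect_sequence_def
proof (subst ell2_nth_Abs[where B = "(norm z)\<^sup>2 - (norm (c z))\<^sup>2"])
  fix F :: "nat set" assume "finite F"
  then obtain N where "F \<subseteq> {..<N}"
    using finite_nat_iff_bounded by blast
  then have "(\<Sum>n\<in>F. (norm ((c ^^ n) (z - c (c z))))\<^sup>2) \<le> (\<Sum>n<N. (norm ((c ^^ n) (z - c (c z))))\<^sup>2)"
    by (intro sum_mono2) auto
  also have "\<dots> \<le> (norm z)\<^sup>2 - (norm (c z))\<^sup>2"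
    unfolding defect_partial_sum using norm_symmetric_funpow_Suc_le[of N z] by linarith
  finally show "(\<Sum>n\<in>F. (norm ((c ^^ n) (z - c (c z))))\<^sup>2) \<le> (norm z)\<^sup>2 - (norm (c z))\<^sup>2" .
qed simp

lemma clinear_defect_sequence: "clinear (defect_sequence c)"
  by (rule clinearI; rule ell2_eqI)
    (simp_all add: ell2_nth_defect_sequence clinear_add[OF clinear_symmetric]
      clinear_scaleC[OF clinear_symmetric] clinear_diff[OF clinear_symmetric_funpow]
      clinear_add[OF clinear_symmetric_funpow] clinear_scaleC[OF clinear_symmetric_funpow]
      scaleC_diff_right)

text \<open>The remainder in \<open>defect_partial_sum\<close> is a difference of consecutive terms
  of a decreasing non-negative sequence. It tends to zero although \<open>(c ^^ n) z\<close> itself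
  may not.\<close>

lemma norm_sq_defect_sequence: "(norm (defect_sequence c z))\<^sup>2 = (norm z)\<^sup>2 - (norm (c z))\<^sup>2"
proof -
  define s where "s n = (norm ((c ^^ n) z))\<^sup>2" for n
  have "decseq s"
    unfolding decseq_Suc_iff s_def by (simp only: norm_symmetric_funpow_Suc_le simp_thms)
  then obtain L where L: "s \<longlonglongrightarrow> L"
    by (metis decseq_convergent s_def zero_le_power2)
  have "(\<lambda>N. (norm z)\<^sup>2 - (norm (c z))\<^sup>2 - (s N - s (Suc N))) \<longlonglongrightarrow> (norm z)\<^sup>2 - (norm (c z))\<^sup>2 - (L - L)"
    by (intro tendsto_intros L LIMSEQ_Suc)
  then have "(\<lambda>n. (norm ((c ^^ n) (z - c (c z))))\<^sup>2) sums ((norm z)\<^sup>2 - (norm (c z))\<^sup>2)"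
    unfolding sums_def defect_partial_sum s_def by simp
  moreover have "(\<lambda>n. (norm ((c ^^ n) (z - c (c z))))\<^sup>2) sums (norm (defect_sequence c z))\<^sup>2"
    using has_sum_imp_sums[OF ell2_norm_has_sum[of "defect_sequence c z"]]
    by (simp add: ell2_nth_defect_sequence)
  ultimately show ?thesis using sums_unique2 by blast
qed

lemma cinner_defect_sequence:
  "cinner (defect_sequence c x) (defect_sequence c y) = cinner x y - cinner (c x) (c y)"
  by (intro cinner_defect_polarization clinear_defect_sequence clinear_symmetric norm_sq_defect_sequence)

end

lemma cinner_ell2_option:
  fixes f g :: "('l option, 'a::complex_inner) ell2"
  shows "cinner f g = cinner (ell2_nth f None) (ell2_nth g None) +
    cinner (ell2_reindex Some UNIV f) (ell2_reindex Some UNIV g)"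
proof -
  have f: "f = ell2_single None (ell2_nth f None) + ell2_restrict (range Some) f"
  proof (rule ell2_eqI)
    show "ell2_nth f i = ell2_nth (ell2_single None (ell2_nth f None) + ell2_restrict (range Some) f) i" for i
      by (cases i) auto
  qed
  have "cinner f g = cinner (ell2_single None (ell2_nth f None)) g + cinner (ell2_restrict (range Some) f) g"
    by (subst f) (rule cinner_add_left)
  then show ?thesis
    by (simp add: cinner_ell2_single_left cinner_ell2_reindex)
qed

text \<open>The row operator \<open>T\<close> is not symmetric, so it is placed with its adjoint in
  an off-diagonal matrix \<open>c\<close> on the sum of \<open>H\<close> (index \<open>None\<close>)
  and the families over edges (indices \<open>Some x\<close>). On the second summand the square of
  \<open>c\<close> is the adjoint of \<open>T\<close> times \<open>T\<close>, so the defect sequence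
  of \<open>c\<close> gives the Gram matrix of the identity minus that product.\<close>

lemma defect_family_exists:
  fixes H :: "'a::complex_inner set" and E :: "'l set"
  assumes row: "row_contraction H E V A"
  obtains \<D> :: "(nat, ('l option, 'a) ell2) ell2 set" and D \<iota> \<pi>
  where "hilbert_space \<D>" "clinear \<iota>" "clinear \<pi>" "\<And>h d. cinner (\<iota> h) d = cinner h (\<pi> d)"
    "\<And>h. \<pi> (\<iota> h) = h" "\<And>h. h \<in> H \<Longrightarrow> \<iota> h \<in> \<D>" "\<And>d. d \<in> \<D> \<Longrightarrow> \<pi> d \<in> H"
    "\<And>x. clinear (D x)" "\<And>x h. h \<in> H \<Longrightarrow> D x h \<in> \<D>"
    "\<And>x y g h. x \<in> E \<Longrightarrow> y \<in> E \<Longrightarrow>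
      cinner (D x g) (D y h) = (if x = y then cinner g h else 0) - cinner (V x g) (V y h)"
proof -
  note H = row_contraction_hilbert[OF row]
  obtain T where T: "clinear T" "\<And>z. norm (T z) \<le> norm z" "\<And>z. T z \<in> H"
    "\<And>x h. x \<in> E \<Longrightarrow> T (ell2_single x h) = V x h"
    "\<And>z h. cinner (T z) h = cinner z (row_adjoint E A h)"
    using row_operator_exists[OF row] by blast
  define S where "S = (ell2_reindex Some UNIV :: ('l option, 'a) ell2 \<Rightarrow> ('l, 'a) ell2)"
  have S: "ell2_nth (S z) x = ell2_nth z (Some x)" for z x
    by (simp add: S_def ell2_nth_reindex)
  have inj_the: "inj_on the (range Some)"
    by (auto simp: inj_on_def)
  define c where "c z = ell2_single None (T (S z)) +
      ell2_reindex the (range Some) (row_adjoint E A (ell2_nth z None))" for z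
  have c_None: "ell2_nth (c z) None = T (S z)" for z
    by (simp add: c_def ell2_nth_reindex[OF inj_the] image_iff)
  have c_Some: "S (c z) = row_adjoint E A (ell2_nth z None)" for z
    by (rule ell2_eqI) (simp add: S c_def ell2_nth_reindex[OF inj_the])
  have c_sym: "cinner (c z) w = cinner z (c w)" for z w
  proof -
    have "cinner (row_adjoint E A h) u = cinner h (T u)" for h u
      by (metis T(5) cinner_commute)
    then show ?thesis
      by (simp add: cinner_ell2_option[of "c z"] cinner_ell2_option[of z] c_None T(5)
          flip: S_def add: c_Some)
  qed
  have option_norm: "(norm z)\<^sup>2 = (norm (ell2_nth z None))\<^sup>2 + (norm (S z))\<^sup>2" for z
    unfolding norm_sq_cinner by (subst cinner_ell2_option) (simp add: S_def)
  have c_contr: "norm (c z) \<le> norm z" for z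
  proof (rule norm_sq_le_imp_norm_le)
    have "(norm (T (S z)))\<^sup>2 \<le> (norm (S z))\<^sup>2"
      by (intro power_mono T(2)) simp
    moreover have "(norm (row_adjoint E A (ell2_nth z None)))\<^sup>2 \<le> (norm (ell2_nth z None))\<^sup>2"
      by (intro power_mono norm_row_adjoint[OF row]) simp
    ultimately show "(norm (c z))\<^sup>2 \<le> (norm z)\<^sup>2"
      unfolding option_norm[of "c z"] option_norm[of z] c_None c_Some by linarith
  qed
  note c = c_sym c_contr
  define Z where "Z = {z :: ('l option, 'a) ell2. \<forall>i. ell2_nth z i \<in> H}"
  have Z: "hilbert_space Z"
    unfolding Z_def by (rule hilbert_space_ell2) (rule H)
  define \<D> where "\<D> = {f :: (nat, ('l option, 'a) ell2) ell2. \<forall>n. ell2_nth f n \<in> Z}"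
  have \<D>: "hilbert_space \<D>"
    unfolding \<D>_def by (rule hilbert_space_ell2) (rule Z)
  have c_Z: "c z \<in> Z" if "z \<in> Z" for z
  proof -
    have "ell2_nth (c z) i \<in> H" for i
    proof (cases i)
      case (Some x)
      then show ?thesis
        using c_Some[of z] row_contraction_adjoint_in[OF row, of x "ell2_nth z None"] hilbert_space_0[OF H]
        by (metis S ell2_nth_row_adjoint[OF row])
    qed (simp add: c_None T(3))
    then show ?thesis by (simp add: Z_def)
  qed
  have single_Z: "ell2_single i h \<in> Z" if "h \<in> H" for i h
    using that hilbert_space_0[OF H] by (simp add: Z_def)
  \<comment> \<open>\<open>H\<close> is put at number \<open>0\<close> and index
    \<open>None\<close>, so that base vectors and defect vectors share one fibre space.\<close>
  define \<iota> where "\<iota> h = ell2_single (0::nat) (ell2_single (None :: 'l option) h)" for h :: 'a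
  define \<pi> where "\<pi> d = ell2_nth (ell2_nth d (0::nat)) (None :: 'l option)" for d :: "(nat, ('l option, 'a) ell2) ell2"
  define D where "D x h = defect_sequence c (ell2_single (Some x) h)" for x h
  have c_single: "c (ell2_single (Some x) h) = ell2_single None (V x h)" if "x \<in> E" for x h
  proof -
    have "S (ell2_single (Some x) h) = ell2_single x h"
      by (rule ell2_eqI) (simp add: S)
    moreover have "row_adjoint E A 0 = 0"
      using norm_row_adjoint[OF row, of 0] by simp
    ultimately show ?thesis
      by (simp add: c_def T(4) that clinear_zero[OF clinear_ell2_reindex[OF inj_the]])
  qed
  show thesis
  proof (rule that[of \<D> \<iota> \<pi> D])
    show "clinear \<iota>" "clinear \<pi>" "cinner (\<iota> h) d = cinner h (\<pi> d)" "\<pi> (\<iota> h) = h" for h d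
      unfolding \<iota>_def \<pi>_def
      by (auto intro: clinear_comp clinear_ell2_single clinear_ell2_nth simp: cinner_ell2_single_left)
    show "\<iota> h \<in> \<D>" if "h \<in> H" for h
      using single_Z[OF that, of None] hilbert_space_0[OF Z] by (simp add: \<D>_def \<iota>_def)
    show "\<pi> d \<in> H" if "d \<in> \<D>" for d
      using that by (simp add: \<D>_def \<pi>_def Z_def)
    show "clinear (D x)" for x
      unfolding D_def by (intro clinear_comp[OF clinear_defect_sequence[OF c]] clinear_ell2_single)
    show "D x h \<in> \<D>" if h: "h \<in> H" for x h
    proof -
      have pow: "(c ^^ n) z \<in> Z" if "z \<in> Z" for z n
        using that by (induction n) (auto intro: c_Z)
      then show ?thesis
        by (auto simp: \<D>_def D_def ell2_nth_defect_sequence[OF c]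
            intro!: pow hilbert_space_diff[OF Z] c_Z single_Z h)
    qed
    show "cinner (D x g) (D y h) = (if x = y then cinner g h else 0) - cinner (V x g) (V y h)"
      if "x \<in> E" "y \<in> E" for x y g h
      using that unfolding D_def cinner_defect_sequence[OF c]
      by (simp add: c_single cinner_ell2_single_left)
  qed (rule \<D>)
qed

section \<open>Isometric dilation in one direction\<close>

text \<open>The identities are required on the whole type, membership only for vectors of
  \<open>H\<close>: on a dilation space these projections cut families by their indices, which
  preserves the subspace but does not map into it.\<close>

definition vertex_projections :: "'l set \<Rightarrow> 'a::complex_inner set \<Rightarrow> ('l \<Rightarrow> 'a \<Rightarrow> 'a) \<Rightarrow> bool" where
  "vertex_projections Vt H Q \<longleftrightarrow> hilbert_space H \<and>
    (\<forall>a\<in>Vt. \<forall>g h. cinner (Q a g) h = cinner g (Q a h)) \<and>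
    (\<forall>a\<in>Vt. \<forall>b\<in>Vt. \<forall>h. Q a (Q b h) = (if a = b then Q a h else 0)) \<and>
    (\<forall>a\<in>Vt. \<forall>h\<in>H. Q a h \<in> H)"

definition edge_maps ::
    "'l set \<Rightarrow> ('l \<Rightarrow> 'l) \<Rightarrow> ('l \<Rightarrow> 'l) \<Rightarrow> 'l set \<Rightarrow> ('l \<Rightarrow> 'a \<Rightarrow> 'a) \<Rightarrow> ('l \<Rightarrow> 'a \<Rightarrow> 'a) \<Rightarrow> bool" where
  "edge_maps Vt r s E Q V \<longleftrightarrow> (\<forall>x\<in>E. r x \<in> Vt \<and> s x \<in> Vt \<and>
    (\<forall>h. Q (r x) (V x h) = V x h \<and> V x (Q (s x) h) = V x h))"

text \<open>The Toeplitz relations for products of an adjoint and an edge operator, written without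
  adjoints: the edges are isometric on their source parts and have orthogonal ranges.\<close>

definition isometric_edges ::
    "('l \<Rightarrow> 'l) \<Rightarrow> 'l set \<Rightarrow> ('l \<Rightarrow> 'a \<Rightarrow> 'a) \<Rightarrow> ('l \<Rightarrow> 'a \<Rightarrow> 'a::complex_inner) \<Rightarrow> bool" where
  "isometric_edges s E R W \<longleftrightarrow> (\<forall>x\<in>E. clinear (W x) \<and>
    (\<forall>y\<in>E. \<forall>k k'. cinner (W x k) (W y k') = (if x = y then cinner (R (s x) k) k' else 0)))"

lemma vertex_projections_hilbert: "vertex_projections Vt H Q \<Longrightarrow> hilbert_space H"
  and vertex_projections_adjoint:
    "vertex_projections Vt H Q \<Longrightarrow> a \<in> Vt \<Longrightarrow> cinner (Q a g) h = cinner g (Q a h)"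
  and vertex_projections_mult: "vertex_projections Vt H Q \<Longrightarrow> a \<in> Vt \<Longrightarrow> b \<in> Vt \<Longrightarrow>
    Q a (Q b h) = (if a = b then Q a h else 0)"
  and vertex_projections_in: "vertex_projections Vt H Q \<Longrightarrow> a \<in> Vt \<Longrightarrow> h \<in> H \<Longrightarrow> Q a h \<in> H"
  by (simp_all add: vertex_projections_def)

lemma vertex_projections_clinear: "vertex_projections Vt H Q \<Longrightarrow> a \<in> Vt \<Longrightarrow> clinear (Q a)"
  by (rule clinear_adjointI) (rule vertex_projections_adjoint)

lemma vertex_projections_norm:
  assumes "vertex_projections Vt H Q" "a \<in> Vt"
  shows "norm (Q a h) \<le> norm h"
proof (rule norm_le_of_Re_cinner_le[of _ _ "Q a h"])
  show "(norm (Q a h))\<^sup>2 = Re (cinner h (Q a h))"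
    using assms by (simp add: norm_sq_cinner vertex_projections_adjoint vertex_projections_mult)
qed simp

lemma edge_mapsD:
  assumes "edge_maps Vt r s E Q V" "x \<in> E"
  shows "r x \<in> Vt" "s x \<in> Vt" "Q (r x) (V x h) = V x h" "V x (Q (s x) h) = V x h"
  using assms by (auto simp: edge_maps_def)

lemma isometric_edgesD:
  assumes "isometric_edges s E R W" "x \<in> E"
  shows "clinear (W x)"
    "y \<in> E \<Longrightarrow> cinner (W x k) (W y k') = (if x = y then cinner (R (s x) k) k' else 0)"
  using assms by (auto simp: isometric_edges_def)

lemma isometric_edges_norm:
  assumes R: "vertex_projections Vt K R" and W: "isometric_edges s E R W" and x: "x \<in> E" "s x \<in> Vt"
  shows "norm (W x k) \<le> norm k"
proof -
  have "(norm (W x k))\<^sup>2 = Re (cinner (R (s x) k) k)"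
    by (simp add: norm_sq_cinner isometric_edgesD[OF W x(1)] x(1))
  also have "\<dots> = (norm (R (s x) k))\<^sup>2"
    by (simp add: norm_sq_cinner vertex_projections_adjoint[OF R x(2)] vertex_projections_mult[OF R x(2) x(2)])
  finally have "norm (W x k) = norm (R (s x) k)" by simp
  then show ?thesis
    using vertex_projections_norm[OF R x(2)] by simp
qed

text \<open>This is why defects may be stored by range vertex: edges with different ranges need no
  correction of their inner product.\<close>

lemma edge_maps_orthogonal:
  assumes Q: "vertex_projections Vt H Q" and V: "edge_maps Vt r s E Q V"
    and xy: "x \<in> E" "y \<in> E" "r x \<noteq> r y"
  shows "cinner (V x g) (V y h) = 0"
proof -
  have "cinner (V x g) (V y h) = cinner (Q (r x) (V x g)) (Q (r y) (V y h))"
    by (simp add: edge_mapsD[OF V] xy)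
  also have "\<dots> = cinner (V x g) (Q (r x) (Q (r y) (V y h)))"
    by (simp only: vertex_projections_adjoint[OF Q edge_mapsD(1)[OF V xy(1)]])
  also have "\<dots> = 0"
    by (subst vertex_projections_mult[OF Q]) (simp_all add: edge_mapsD[OF V] xy)
  finally show ?thesis .
qed

text \<open>\<open>J\<close> embeds \<open>H\<close> into \<open>K\<close> and \<open>P\<close> is its adjoint. The projections \<open>\<tau> n\<close> cut \<open>K\<close> down to what paths
  with at most \<open>n\<close> edges generate from \<open>H\<close>; lifts to \<open>K\<close> are constructed level by level along them.\<close>

locale edge_dilation =
  fixes Vt :: "'l set" and r s :: "'l \<Rightarrow> 'l" and E :: "'l set"
    and H :: "'a::complex_inner set" and Q V :: "'l \<Rightarrow> 'a \<Rightarrow> 'a"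
    and K :: "'k::complex_inner set" and R W :: "'l \<Rightarrow> 'k \<Rightarrow> 'k"
    and J :: "'a \<Rightarrow> 'k" and P :: "'k \<Rightarrow> 'a" and \<tau> :: "nat \<Rightarrow> 'k \<Rightarrow> 'k"
  assumes R: "vertex_projections Vt K R"
    and W_edge: "edge_maps Vt r s E R W"
    and W_iso: "isometric_edges s E R W"
    and W_in: "\<And>x k. x \<in> E \<Longrightarrow> k \<in> K \<Longrightarrow> W x k \<in> K"
    and J_lin: "clinear J"
    and J_P: "\<And>h k. cinner (J h) k = cinner h (P k)"
    and P_J: "\<And>h. P (J h) = h"
    and J_in: "\<And>h. h \<in> H \<Longrightarrow> J h \<in> K"
    and P_R: "\<And>a k. a \<in> Vt \<Longrightarrow> P (R a k) = Q a (P k)"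
    and P_W: "\<And>x k. x \<in> E \<Longrightarrow> P (W x k) = V x (P k)"
    and \<tau>_lin: "\<And>n. clinear (\<tau> n)"
    and \<tau>_adj: "\<And>n k k'. cinner (\<tau> n k) k' = cinner k (\<tau> n k')"
    and \<tau>_min: "\<And>m n k. \<tau> m (\<tau> n k) = \<tau> (min m n) k"
    and \<tau>_in: "\<And>n k. k \<in> K \<Longrightarrow> \<tau> n k \<in> K"
    and \<tau>_0: "\<And>k. \<tau> 0 k = J (P k)"
    and \<tau>_W: "\<And>n x k. x \<in> E \<Longrightarrow> \<tau> (Suc n) (W x k) = W x (\<tau> n k)"

type_synonym ('l, 'a) edge_dilation_space = "('l list, (nat, ('l option, 'a) ell2) ell2) ell2"

text \<open>The dilation space consists of families indexed by lists of edges: the entry at \<open>[]\<close> carries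
  \<open>H\<close>, the entry at \<open>[a]\<close> receives the defects of the edges with range \<open>a\<close>, and an edge \<open>x\<close> shifts the
  entry at \<open>u\<close> to \<open>x # u\<close>.\<close>

lemma edge_dilation_exists:
  fixes H :: "'a::complex_inner set" and E :: "'l set"
  assumes Q: "vertex_projections Vt H Q" and row: "row_contraction H E V A"
    and V: "edge_maps Vt r s E Q V" and r_vertex: "\<And>a. a \<in> Vt \<Longrightarrow> r a = a"
  shows "\<exists>(K :: ('l, 'a) edge_dilation_space set) R W J P \<tau>. edge_dilation Vt r s E H Q V K R W J P \<tau>"
proof -
  note H = row_contraction_hilbert[OF row]
  note V_in = row_contraction_in[OF row] and V_lin = row_contraction_clinear[OF row]
  obtain \<D> :: "(nat, ('l option, 'a) ell2) ell2 set" and D \<iota> \<pi> where \<D>: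
    "hilbert_space \<D>" "clinear \<iota>" "clinear \<pi>" "\<And>h d. cinner (\<iota> h) d = cinner h (\<pi> d)"
    "\<And>h. \<pi> (\<iota> h) = h" "\<And>h. h \<in> H \<Longrightarrow> \<iota> h \<in> \<D>" "\<And>d. d \<in> \<D> \<Longrightarrow> \<pi> d \<in> H"
    "\<And>x. clinear (D x)" "\<And>x h. h \<in> H \<Longrightarrow> D x h \<in> \<D>"
    "\<And>x y g h. x \<in> E \<Longrightarrow> y \<in> E \<Longrightarrow>
      cinner (D x g) (D y h) = (if x = y then cinner g h else 0) - cinner (V x g) (V y h)"
    by (rule defect_family_exists[OF row]) (rule that; assumption)
  define K where "K = {f :: ('l, 'a) edge_dilation_space. \<forall>u. ell2_nth f u \<in> \<D>}"
  have K: "hilbert_space K"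
    unfolding K_def by (rule hilbert_space_ell2) (rule \<D>(1))
  define J where "J h = (ell2_single [] (\<iota> h) :: ('l, 'a) edge_dilation_space)" for h
  define P where "P k = \<pi> (ell2_nth k [])" for k :: "('l, 'a) edge_dilation_space"
  \<comment> \<open>A one-letter list \<open>[a]\<close> is the defect entry of the vertex
    \<open>a\<close>. Since \<open>r a = a\<close>, it lies in \<open>S a\<close> together with the
    lists that begin with an edge of range \<open>a\<close>.\<close>
  define S where "S a = {u. u \<noteq> [] \<and> r (hd u) = a}" for a
  \<comment> \<open>These lists have length at least two, so shifted entries never meet the defect
    entry \<open>[r x]\<close>. The entry \<open>[]\<close> is not shifted; it acts through
    \<open>V x\<close> and \<open>D x\<close>.\<close>
  define SE where "SE x = {u. \<exists>v. u = x # v \<and> v \<in> S (s x)}" for x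
  have tl_SE: "tl ` SE x = S (s x)" "inj_on tl (SE x)" for x
    by (force simp: SE_def image_iff) (auto simp: SE_def inj_on_def)
  have SE_short: "[] \<notin> SE x" "[y] \<notin> SE x" for x y
    by (auto simp: SE_def S_def)
  define R where "R a k = J (Q a (P k)) + ell2_restrict (S a) k" for a k
  \<comment> \<open>\<open>Q (s x)\<close> stands before \<open>D x\<close> because defect vectors
    ignore sources; without it \<open>W x\<close> would not absorb \<open>R (s x)\<close>.\<close>
  define W where "W x k = J (V x (P k)) + (ell2_single [r x] (D x (Q (s x) (P k))) +
      ell2_reindex tl (SE x) k)" for x k
  define \<tau> where "\<tau> n k = J (P k) + ell2_restrict {u. u \<noteq> [] \<and> length u \<le> n} k" for n k
  have J_nth: "ell2_nth (J h) u = (if u = [] then \<iota> h else 0)" for h u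
    by (simp add: J_def)
  have R_nth: "ell2_nth (R a k) u = (if u = [] then \<iota> (Q a (P k)) else if r (hd u) = a then ell2_nth k u else 0)"
    for a k u
    by (simp add: R_def J_nth S_def)
  have W_nth: "ell2_nth (W x k) u = (if u = [] then \<iota> (V x (P k)) else
      if u = [r x] then D x (Q (s x) (P k)) else if u \<in> SE x then ell2_nth k (tl u) else 0)" for x k u
    by (auto simp: W_def J_nth ell2_nth_reindex[OF tl_SE(2)] SE_short)
  have \<tau>_nth: "ell2_nth (\<tau> n k) u = (if u = [] then \<iota> (P k) else if length u \<le> n then ell2_nth k u else 0)" for n k u
    by (simp add: \<tau>_def J_nth)
  have J_lin: "clinear J"
    unfolding J_def by (intro clinear_comp[OF clinear_ell2_single \<D>(2)])
  have J_P: "cinner (J h) k = cinner h (P k)" for h k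
    by (simp add: J_def P_def cinner_ell2_single_left \<D>(4))
  have P_J: "cinner (P k) h = cinner k (J h)" for h k
    by (metis J_P cinner_commute)
  have P_lin: "clinear P"
    by (rule clinear_adjointI) (rule P_J)
  have PJ: "P (J h) = h" for h
    by (simp add: P_def J_nth \<D>(5))
  have J_in: "J h \<in> K" if "h \<in> H" for h
    using that \<D>(6) hilbert_space_0[OF \<D>(1)] by (simp add: K_def J_nth)
  have P_in: "P k \<in> H" if "k \<in> K" for k
    using that \<D>(7) by (simp add: K_def P_def)
  have P_R: "P (R a k) = Q a (P k)" for a k
    by (simp add: P_def[of "R a k"] R_nth \<D>(5))
  have P_W: "P (W x k) = V x (P k)" for x k
    by (simp add: P_def[of "W x k"] W_nth \<D>(5))
  have P_\<tau>: "P (\<tau> n k) = P k" for n k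
    by (simp add: P_def[of "\<tau> n k"] \<tau>_nth \<D>(5))
  have \<iota>0: "\<iota> 0 = 0"
    by (rule clinear_zero[OF \<D>(2)])
  have R_adj: "cinner (R a k) k' = cinner k (R a k')" if "a \<in> Vt" for a k k'
    unfolding R_def
    by (simp add: cinner_add_left cinner_add_right J_P cinner_ell2_restrict_left
        vertex_projections_adjoint[OF Q that] flip: P_J)
  have R_mult: "R a (R b k) = (if a = b then R a k else 0)" if "a \<in> Vt" "b \<in> Vt" for a b k
    by (rule ell2_eqI) (auto simp: R_nth P_R vertex_projections_mult[OF Q that] \<iota>0)
  have R_in: "R a k \<in> K" if "a \<in> Vt" "k \<in> K" for a k
    using that \<D>(6)[OF vertex_projections_in[OF Q that(1) P_in[OF that(2)]]] hilbert_space_0[OF \<D>(1)]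
    by (simp add: K_def R_nth)
  have R: "vertex_projections Vt K R"
    unfolding vertex_projections_def using K R_adj R_mult R_in by blast
  have W_lin: "clinear (W x)" if "x \<in> E" for x
    unfolding W_def
    by (intro clinear_plus clinear_comp[OF J_lin] clinear_comp[OF V_lin[OF that]] P_lin
        clinear_comp[OF clinear_ell2_single] clinear_comp[OF \<D>(8)]
        clinear_comp[OF vertex_projections_clinear[OF Q edge_mapsD(2)[OF V that]]]
        clinear_ell2_reindex[OF tl_SE(2)])
  have W_iso: "cinner (W x k) (W y k') = (if x = y then cinner (R (s x) k) k' else 0)"
    if xy: "x \<in> E" "y \<in> E" for x y k k'
  proof -
    let ?g = "P k" and ?h = "P k'"
    have shift: "cinner (ell2_reindex tl (SE x) k) (W y k') =
        (if x = y then cinner (ell2_restrict (S (s x)) k) k' else 0)"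
    proof -
      have "cinner (ell2_reindex tl (SE x) k) (W y k') =
          cinner (ell2_reindex tl (SE x) k) (ell2_reindex tl (SE y) k')"
        unfolding W_def
        by (simp add: cinner_add_right J_def cinner_ell2_single_right ell2_nth_reindex[OF tl_SE(2)])
          (simp add: SE_def S_def)
      also have "\<dots> = (if x = y then cinner (ell2_restrict (S (s x)) k) k' else 0)"
      proof (cases "x = y")
        case False
        then have "\<not> (u \<in> SE x \<and> u \<in> SE y)" for u
          by (auto simp: SE_def)
        then have "cinner (ell2_nth (ell2_reindex tl (SE x) k) u) (ell2_nth (ell2_reindex tl (SE y) k') u) = 0" for u
          by (auto simp: ell2_nth_reindex[OF tl_SE(2)])
        then show ?thesis
          using False by (simp add: cinner_ell2_disjoint)
      qed (simp add: cinner_ell2_reindex[OF tl_SE(2)] tl_SE)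
      finally show ?thesis .
    qed
    have "cinner (W x k) (W y k') = cinner (V x ?g) (P (W y k')) +
        cinner (D x (Q (s x) ?g)) (ell2_nth (W y k') [r x]) + cinner (ell2_reindex tl (SE x) k) (W y k')"
      by (simp add: W_def[of x] cinner_add_left J_P cinner_ell2_single_left)
    \<comment> \<open>The defect contributes minus the inner product of \<open>V x ?g\<close> and
      \<open>V y ?h\<close>, which cancels the contribution of the entry \<open>[]\<close>. For
      different ranges both are zero.\<close>
    also have "cinner (D x (Q (s x) ?g)) (ell2_nth (W y k') [r x]) =
        (if x = y then cinner (Q (s x) ?g) ?h else 0) - cinner (V x ?g) (V y ?h)"
    proof (cases "r x = r y")
      case True
      then show ?thesis
        using \<D>(10)[OF xy, of "Q (s x) ?g" "Q (s y) ?h"]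
        by (auto simp: W_nth edge_mapsD(4)[OF V] xy
            vertex_projections_adjoint[OF Q] edge_mapsD(2)[OF V] vertex_projections_mult[OF Q])
    next
      case False
      then show ?thesis
        using edge_maps_orthogonal[OF Q V xy False] by (auto simp: W_nth SE_def S_def)
    qed
    finally show ?thesis
      unfolding shift P_W by (auto simp: R_def cinner_add_left J_P)
  qed
  have W_edge: "R (r x) (W x k) = W x k" "W x (R (s x) k) = W x k" if "x \<in> E" for x k
  proof -
    show "R (r x) (W x k) = W x k"
      by (rule ell2_eqI) (auto simp: R_nth P_W edge_mapsD[OF V that] W_nth SE_def r_vertex)
    show "W x (R (s x) k) = W x k"
      using edge_mapsD(2)[OF V that]
      by (intro ell2_eqI) (auto simp: W_nth R_nth P_R edge_mapsD(4)[OF V that]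
          vertex_projections_mult[OF Q] SE_def S_def)
  qed
  have W_in: "W x k \<in> K" if "x \<in> E" "k \<in> K" for x k
  proof -
    have "\<iota> (V x (P k)) \<in> \<D>" "D x (Q (s x) (P k)) \<in> \<D>"
      using that P_in[OF that(2)] V_in edge_mapsD(2)[OF V that(1)]
      by (auto intro!: \<D>(6,9) vertex_projections_in[OF Q])
    then show ?thesis
      using that hilbert_space_0[OF \<D>(1)] by (simp add: K_def W_nth)
  qed
  have "edge_dilation Vt r s E H Q V K R W J P \<tau>"
  proof
    show "edge_maps Vt r s E R W"
      unfolding edge_maps_def using W_edge edge_mapsD(1,2)[OF V] by blast
    show "isometric_edges s E R W"
      unfolding isometric_edges_def using W_lin W_iso by blast
    show "clinear (\<tau> n)" for n
      unfolding \<tau>_def by (intro clinear_plus clinear_comp[OF J_lin P_lin] clinear_ell2_reindex) auto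
    show "cinner (\<tau> n k) k' = cinner k (\<tau> n k')" for n k k'
      unfolding \<tau>_def
      by (simp add: cinner_add_left cinner_add_right J_P cinner_ell2_restrict_left flip: P_J)
    show "\<tau> m (\<tau> n k) = \<tau> (min m n) k" for m n k
      by (rule ell2_eqI) (auto simp: \<tau>_nth P_\<tau>)
    show "\<tau> n k \<in> K" if "k \<in> K" for n k
      using that \<D>(6)[OF P_in[OF that]] hilbert_space_0[OF \<D>(1)] by (simp add: K_def \<tau>_nth)
    show "\<tau> 0 k = J (P k)" for k
      by (rule ell2_eqI) (auto simp: \<tau>_nth J_nth)
    \<comment> \<open>An edge lengthens an index by one: \<open>[]\<close> feeds
      \<open>[r x]\<close>, and \<open>v\<close> feeds \<open>x # v\<close>. The entry
      \<open>[]\<close> survives every truncation.\<close>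
    show "\<tau> (Suc n) (W x k) = W x (\<tau> n k)" if "x \<in> E" for n x k
      by (rule ell2_eqI) (auto simp: \<tau>_nth W_nth P_W P_\<tau> SE_def S_def)
  qed (use R W_in J_lin J_P PJ J_in P_R P_W in auto)
  then show ?thesis by blast
qed

section \<open>Lifting the edges of the other direction\<close>

text \<open>\<open>M\<close> indexes the commuting squares \<open>f p \<cdot> e p = e' p \<cdot> f' p\<close> with \<open>e p, e' p\<close> in \<open>E\<close> and
  \<open>f p, f' p\<close> in \<open>F\<close>.\<close>

locale edge_lift = edge_dilation Vt r s E H Q V K R W J P \<tau>
  for H :: "'a::complex_inner set" and K :: "'k::complex_inner set" and Vt E :: "'l set" and r s Q V R W J P \<tau> +
  fixes F :: "'l set" and A :: "'l \<Rightarrow> 'a \<Rightarrow> 'a" and M :: "'m set" and f e e' f' :: "'m \<Rightarrow> 'l"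
  assumes row: "row_contraction H F V A"
    and V_edge: "edge_maps Vt r s F Q V"
    and sq: "\<And>p. p \<in> M \<Longrightarrow> f p \<in> F \<and> e p \<in> E \<and> e' p \<in> E \<and> f' p \<in> F \<and>
      s (f p) = r (e p) \<and> s (e' p) = r (f' p) \<and> s (e p) = s (f' p) \<and> r (f p) = r (e' p)"
    and sq_inj: "\<And>p q. p \<in> M \<Longrightarrow> q \<in> M \<Longrightarrow> f p = f q \<Longrightarrow> e p = e q \<Longrightarrow> p = q"
    and sq_inj': "\<And>p q. p \<in> M \<Longrightarrow> q \<in> M \<Longrightarrow> e' p = e' q \<Longrightarrow> f' p = f' q \<Longrightarrow> p = q"
    and V_sq: "\<And>p h. p \<in> M \<Longrightarrow> V (f p) (V (e p) h) = V (e' p) (V (f' p) h)"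
begin

section \<open>Lifts truncated at level n\<close>

lemma K: "hilbert_space K"
  using R by (rule vertex_projections_hilbert)

lemma P_lin: "clinear P"
  by (rule clinear_adjointI[of _ J]) (metis J_P cinner_commute)

lemma norm_J: "norm (J h) = norm h"
  by (rule norm_cinner_preserving) (simp add: J_P P_J)

lemma norm_P: "norm (P k) \<le> norm k"
  by (rule norm_le_of_Re_cinner_le[of _ _ "J (P k)"])
    (simp_all add: norm_J norm_sq_cinner J_P, metis J_P cinner_commute)

lemma norm_W: "x \<in> E \<Longrightarrow> norm (W x k) \<le> norm k"
  by (rule isometric_edges_norm[OF R W_iso]) (auto simp: edge_mapsD[OF W_edge])

lemma W_lin: "x \<in> E \<Longrightarrow> clinear (W x)"
  using isometric_edgesD[OF W_iso] by blast

lemma R_lin: "a \<in> Vt \<Longrightarrow> clinear (R a)"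
  by (rule vertex_projections_clinear[OF R])

lemma norm_sq_\<tau>: "(norm k)\<^sup>2 = (norm (k - \<tau> n k))\<^sup>2 + (norm (\<tau> n k))\<^sup>2"
proof -
  have "cinner (k - \<tau> n k) (\<tau> n k) = 0"
    by (simp add: cinner_diff_left \<tau>_adj \<tau>_min)
  then have "(norm ((k - \<tau> n k) + \<tau> n k))\<^sup>2 = (norm (k - \<tau> n k))\<^sup>2 + (norm (\<tau> n k))\<^sup>2"
    by (rule norm_sq_add_orthogonal)
  then show ?thesis by simp
qed

lemma norm_\<tau>: "norm (\<tau> n k) \<le> norm k"
  by (rule norm_sq_le_imp_norm_le) (simp add: norm_sq_\<tau>[of k n])

lemma norm_minus_\<tau>: "norm (k - \<tau> n k) \<le> norm k"
  by (rule norm_sq_le_imp_norm_le) (simp add: norm_sq_\<tau>[of k n])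

text \<open>\<open>Y\<close> stands for the row of lifted edges, cut down to level \<open>n\<close>.
  The square relation holds only after \<open>\<tau> n\<close>, since \<open>W (e' p)\<close> raises
  the level by one; it is asked only where \<open>R (s (e p))\<close> fixes \<open>x\<close>,
  because \<open>W (e p)\<close> is isometric there.\<close>

definition partial_lift :: "nat \<Rightarrow> (('l, 'k) ell2 \<Rightarrow> 'k) \<Rightarrow> bool" where
  "partial_lift n Y \<longleftrightarrow> clinear Y \<and> (\<forall>z. norm (Y z) \<le> norm z) \<and> (\<forall>z. Y z \<in> K) \<and>
    (\<forall>z. \<tau> n (Y z) = Y z) \<and>
    (\<forall>p\<in>M. \<forall>x\<in>K. R (s (e p)) x = x \<longrightarrow>
      Y (ell2_single (f p) (W (e p) x)) = \<tau> n (W (e' p) (Y (ell2_single (f' p) x))))"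

text \<open>The square relation links consecutive levels without any truncation; this is what
  survives in the limit.\<close>

definition lift_step :: "nat \<Rightarrow> (('l, 'k) ell2 \<Rightarrow> 'k) \<Rightarrow> (('l, 'k) ell2 \<Rightarrow> 'k) \<Rightarrow> bool" where
  "lift_step n Y Y' \<longleftrightarrow> (\<forall>z. \<tau> n (Y' z) = Y z) \<and>
    (\<forall>p\<in>M. \<forall>x\<in>K. R (s (e p)) x = x \<longrightarrow>
      Y' (ell2_single (f p) (W (e p) x)) = W (e' p) (Y (ell2_single (f' p) x)))"

text \<open>Level \<open>0\<close> sees only \<open>H\<close>, where the row of \<open>V\<close>
  itself works and the squares of \<open>V\<close> commute.\<close>

lemma partial_lift_0:
  "\<exists>Y. partial_lift 0 Y \<and> (\<forall>g\<in>F. \<forall>x. P (Y (ell2_single g x)) = V g (P x))"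
proof -
  have rc: "row_contraction K F (\<lambda>g k. J (V g (P k))) (\<lambda>g k. J (A g (P k)))"
    unfolding row_contraction_def
  proof (intro conjI ballI allI impI)
    show "cinner (J (V x (P g))) h = cinner g (J (A x (P h)))" if "x \<in> F" for x g h
      by (metis J_P cinner_commute row_contraction_adjoint[OF row that])
    show "J (V x (P g)) \<in> K" "J (A x (P g)) \<in> K" if "x \<in> F" for x g
      using row_contraction_in[OF row that] row_contraction_adjoint_in[OF row that] J_in by auto
    fix G :: "'l set" and k :: "'l \<Rightarrow> 'k"
    assume G: "finite G" "G \<subseteq> F"
    have "(norm (\<Sum>x\<in>G. J (V x (P (k x)))))\<^sup>2 = (norm (\<Sum>x\<in>G. V x (P (k x))))\<^sup>2"
      by (simp add: norm_J flip: clinear_sum[OF J_lin])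
    also have "\<dots> \<le> (\<Sum>x\<in>G. (norm (P (k x)))\<^sup>2)"
      by (rule row_contraction_norm[OF row G])
    also have "\<dots> \<le> (\<Sum>x\<in>G. (norm (k x))\<^sup>2)"
      by (intro sum_mono power_mono norm_P) auto
    finally show "(norm (\<Sum>x\<in>G. J (V x (P (k x)))))\<^sup>2 \<le> (\<Sum>x\<in>G. (norm (k x))\<^sup>2)" .
  qed (rule K)
  obtain T where T: "clinear T" "\<And>z. norm (T z) \<le> norm z" "\<And>z. T z \<in> K"
    "\<And>x k. x \<in> F \<Longrightarrow> T (ell2_single x k) = J (V x (P k))"
    by (rule row_operator_exists[OF rc]) (rule that; assumption)
  define Y where "Y z = \<tau> 0 (T z)" for z
  have Y: "Y (ell2_single g k) = J (V g (P k))" if "g \<in> F" for g k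
    by (simp add: Y_def T(4) that \<tau>_0 P_J)
  have "partial_lift 0 Y"
    unfolding partial_lift_def
  proof (intro conjI allI ballI impI)
    show "clinear Y"
      unfolding Y_def by (intro clinear_comp[OF \<tau>_lin T(1)])
    show "norm (Y z) \<le> norm z" for z
      unfolding Y_def using norm_\<tau>[of 0 "T z"] T(2)[of z] by linarith
    show "Y z \<in> K" "\<tau> 0 (Y z) = Y z" for z
      by (simp_all add: Y_def \<tau>_in T(3) \<tau>_min)
    show "Y (ell2_single (f p) (W (e p) x)) = \<tau> 0 (W (e' p) (Y (ell2_single (f' p) x)))"
      if "p \<in> M" for p x
      using sq[OF that] V_sq[OF that] by (simp add: Y \<tau>_0 P_W P_J)
  qed
  then show ?thesis
    using Y P_J by fastforce
qed

text \<open>The squares prescribe the next level on the span of the vectors \<open>ell2_single (f p) (W (e p) x)\<close>,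
  and there the prescription is contractive; a contractive extension supplies the rest.\<close>

lemma lift_step_exists:
  assumes "partial_lift n Y"
  shows "\<exists>Y'. partial_lift (Suc n) Y' \<and> lift_step n Y Y'"
proof -
  have Y: "clinear Y" "\<And>z. norm (Y z) \<le> norm z" "\<And>z. Y z \<in> K" "\<And>z. \<tau> n (Y z) = Y z"
    and Y_sq: "\<And>p x. p \<in> M \<Longrightarrow> x \<in> K \<Longrightarrow> R (s (e p)) x = x \<Longrightarrow>
      Y (ell2_single (f p) (W (e p) x)) = \<tau> n (W (e' p) (Y (ell2_single (f' p) x)))"
    using assms by (auto simp: partial_lift_def)
  \<comment> \<open>The defect form of \<open>Y\<close>: the room left for a component orthogonal to
    the values of \<open>Y\<close>.\<close>
  define B where "B a b = cinner a b - cinner (Y a) (Y b)" for a b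
  define m where "m G x = (\<Sum>p\<in>G. ell2_single (f p) (W (e p) (x p)))" for G and x :: "'m \<Rightarrow> 'k"
  define Z where "Z G x = (\<Sum>p\<in>G. W (e' p) (Y (ell2_single (f' p) (x p))))" for G and x :: "'m \<Rightarrow> 'k"
  \<comment> \<open>\<open>x\<close> vanishes outside \<open>G\<close>, so enlarging the index set
    changes neither \<open>m\<close> nor \<open>Z\<close>, and two families can be added over the
    union of their index sets.\<close>
  define ok where "ok G x \<longleftrightarrow> finite G \<and> G \<subseteq> M \<and> (\<forall>p\<in>G. x p \<in> K \<and> R (s (e p)) (x p) = x p) \<and>
    (\<forall>p. p \<notin> G \<longrightarrow> x p = 0)" for G and x :: "'m \<Rightarrow> 'k"
  \<comment> \<open>Only the part of the prescribed value \<open>Z G x\<close> orthogonal to level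
    \<open>n\<close> is new; the rest already equals \<open>Y (m G x)\<close>.\<close>
  define S where "S = {(m G x, Z G x - \<tau> n (Z G x)) |G x. ok G x}"
  have s_Vt: "s (e p) \<in> Vt" if "p \<in> M" for p
    using edge_mapsD(2)[OF W_edge, of "e p"] sq[OF that] by simp
  have W_lin': "clinear (W (e p))" "clinear (W (e' p))" if "p \<in> M" for p
    using sq[OF that] W_lin by auto
  have single_zero: "ell2_single g (0::'k) = 0" for g :: 'l
    by (rule clinear_zero[OF clinear_ell2_single])
  have mono: "m G x = m G' x" "Z G x = Z G' x" if "ok G x" "G \<subseteq> G'" "finite G'" "G' \<subseteq> M" for G G' x
    unfolding m_def Z_def using that
    by (auto intro!: sum.mono_neutral_left
        simp: ok_def single_zero clinear_zero[OF W_lin'(1)] clinear_zero[OF W_lin'(2)]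
          clinear_zero[OF Y(1)] subset_iff)
  have ok_add: "ok (G \<union> G') (\<lambda>p. x p + x' p)" if "ok G x" "ok G' x'" for G G' x x'
    unfolding ok_def
  proof (intro conjI ballI allI impI)
    fix p assume p: "p \<in> G \<union> G'"
    then have M: "p \<in> M" using that by (auto simp: ok_def)
    have zero: "R (s (e p)) 0 = 0"
      by (rule clinear_zero[OF R_lin[OF s_Vt[OF M]]])
    have x: "x p \<in> K" "R (s (e p)) (x p) = x p" "x' p \<in> K" "R (s (e p)) (x' p) = x' p"
      using that zero hilbert_space_0[OF K] by (cases "p \<in> G"; cases "p \<in> G'"; simp add: ok_def)+
    then show "x p + x' p \<in> K" "R (s (e p)) (x p + x' p) = x p + x' p"
      by (simp_all add: hilbert_space_add[OF K] clinear_add[OF R_lin[OF s_Vt[OF M]]])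
  qed (use that in \<open>auto simp: ok_def\<close>)
  have m_add: "m G (\<lambda>p. x p + x' p) = m G x + m G x'" "Z G (\<lambda>p. x p + x' p) = Z G x + Z G x'"
    if "G \<subseteq> M" for G x x'
    unfolding m_def Z_def sum.distrib[symmetric] using that
    by (auto intro!: sum.cong simp: clinear_add[OF W_lin'(1)] clinear_add[OF W_lin'(2)]
        clinear_add[OF Y(1)] clinear_add[OF clinear_ell2_single])
  have m_scale: "m G (\<lambda>p. c *\<^sub>C x p) = c *\<^sub>C m G x" "Z G (\<lambda>p. c *\<^sub>C x p) = c *\<^sub>C Z G x"
    if "G \<subseteq> M" for G c x
    unfolding m_def Z_def complex_vector.scale_sum_right using that
    by (auto intro!: sum.cong simp: clinear_scaleC[OF W_lin'(1)] clinear_scaleC[OF W_lin'(2)]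
        clinear_scaleC[OF Y(1)] clinear_scaleC[OF clinear_ell2_single])
  have Z_in: "Z G x \<in> K" if "ok G x" for G x
    unfolding Z_def using that
    by (intro hilbert_space_sum[OF K] W_in Y(3)) (auto simp: ok_def dest: sq)
  have norm_x: "(norm (W (e p) (x p)))\<^sup>2 = (norm (x p))\<^sup>2" if "ok G x" "p \<in> G" for G x p
  proof -
    have p: "p \<in> M" "R (s (e p)) (x p) = x p" using that by (auto simp: ok_def)
    then show ?thesis
      using sq[OF p(1)] by (simp add: norm_sq_cinner isometric_edgesD(2)[OF W_iso])
  qed
  \<comment> \<open>Distinct squares differ in \<open>f\<close> or in \<open>e\<close>, hence give
    orthogonal vectors: different positions, or isometries with orthogonal ranges.\<close>
  have norm_m: "(norm (m G x))\<^sup>2 = (\<Sum>p\<in>G. (norm (x p))\<^sup>2)" if ok: "ok G x" for G x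
  proof -
    have "(norm (m G x))\<^sup>2 = (\<Sum>p\<in>G. (norm (ell2_single (f p) (W (e p) (x p))))\<^sup>2)"
      unfolding m_def
    proof (rule norm_sq_sum_orthogonal)
      fix p q assume pq: "p \<in> G" "q \<in> G" "p \<noteq> q"
      then have M: "p \<in> M" "q \<in> M" using ok by (auto simp: ok_def)
      show "cinner (ell2_single (f p) (W (e p) (x p))) (ell2_single (f q) (W (e q) (x q))) = 0"
        using sq_inj[OF M] pq(3) sq[OF M(1)] sq[OF M(2)]
        by (auto simp: cinner_ell2_single_left isometric_edgesD(2)[OF W_iso])
    qed (use ok in \<open>simp add: ok_def\<close>)
    then show ?thesis
      using norm_x[OF ok] by simp
  qed
  \<comment> \<open>Group the squares by \<open>e'\<close>. Different groups have orthogonal values;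
    inside a group the \<open>f'\<close> are distinct, so the arguments of the contraction
    \<open>Y\<close> are orthogonal.\<close>
  have norm_Z: "(norm (Z G x))\<^sup>2 \<le> (\<Sum>p\<in>G. (norm (x p))\<^sup>2)" if ok: "ok G x" for G x
  proof -
    have G: "finite G" "G \<subseteq> M" using ok by (auto simp: ok_def)
    define b where "b y = (\<Sum>p\<in>{p \<in> G. e' p = y}. ell2_single (f' p) (x p))" for y
    have "Z G x = (\<Sum>y\<in>e' ` G. \<Sum>p\<in>{p \<in> G. e' p = y}. W (e' p) (Y (ell2_single (f' p) (x p))))"
      unfolding Z_def using G(1) by (subst sum.group) auto
    also have "\<dots> = (\<Sum>y\<in>e' ` G. W y (Y (b y)))"
    proof (rule sum.cong)
      fix y assume "y \<in> e' ` G"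
      then have "y \<in> E" using G(2) sq by auto
      then show "(\<Sum>p\<in>{p \<in> G. e' p = y}. W (e' p) (Y (ell2_single (f' p) (x p)))) = W y (Y (b y))"
        by (simp add: b_def clinear_sum[OF W_lin] clinear_sum[OF Y(1)])
    qed simp
    finally have "(norm (Z G x))\<^sup>2 = (\<Sum>y\<in>e' ` G. (norm (W y (Y (b y))))\<^sup>2)"
      using G sq by (auto intro!: norm_sq_sum_orthogonal simp: isometric_edgesD(2)[OF W_iso] subset_iff)
    also have "\<dots> \<le> (\<Sum>y\<in>e' ` G. (norm (b y))\<^sup>2)"
    proof (rule sum_mono)
      fix y assume "y \<in> e' ` G"
      then have "y \<in> E" using G(2) sq by auto
      then have "norm (W y (Y (b y))) \<le> norm (b y)"
        using norm_W[of y "Y (b y)"] Y(2)[of "b y"] by linarith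
      then show "(norm (W y (Y (b y))))\<^sup>2 \<le> (norm (b y))\<^sup>2"
        by (rule power_mono) simp
    qed
    also have "\<dots> = (\<Sum>y\<in>e' ` G. \<Sum>p\<in>{p \<in> G. e' p = y}. (norm (ell2_single (f' p) (x p)))\<^sup>2)"
    proof (rule sum.cong)
      fix y
      show "(norm (b y))\<^sup>2 = (\<Sum>p\<in>{p \<in> G. e' p = y}. (norm (ell2_single (f' p) (x p)))\<^sup>2)"
        unfolding b_def
      proof (rule norm_sq_sum_orthogonal)
        fix p q assume "p \<in> {p \<in> G. e' p = y}" "q \<in> {p \<in> G. e' p = y}" "p \<noteq> q"
        then have "f' p \<noteq> f' q" using sq_inj'[of p q] G(2) by auto
        then show "cinner (ell2_single (f' p) (x p)) (ell2_single (f' q) (x q)) = 0"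
          by (simp add: cinner_ell2_single_left)
      qed (use G in simp)
    qed simp
    also have "\<dots> = (\<Sum>p\<in>G. (norm (x p))\<^sup>2)"
      using G(1) by (subst sum.group) auto
    finally show ?thesis .
  qed
  have Y_m: "Y (m G x) = \<tau> n (Z G x)" if "ok G x" for G x
    unfolding m_def Z_def clinear_sum[OF Y(1)] clinear_sum[OF \<tau>_lin]
    using that by (intro sum.cong Y_sq) (auto simp: ok_def)
  have B_nonneg: "0 \<le> Re (B z z)" for z
    using power_mono[OF Y(2)[of z], of 2] by (simp add: B_def flip: norm_sq_cinner)
  have S_zero: "(0, 0) \<in> S"
  proof -
    have "ok {} (\<lambda>_. 0)" by (simp add: ok_def)
    moreover have "m {} (\<lambda>_. 0) = 0" "Z {} (\<lambda>_. 0) = 0" by (simp_all add: m_def Z_def)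
    ultimately show ?thesis
      unfolding S_def using clinear_zero[OF \<tau>_lin[of n]] by (force intro!: exI[of _ "{}"] exI[of _ "\<lambda>_. 0"])
  qed
  have S_add: "(a + a', l + l') \<in> S" if al: "(a, l) \<in> S" "(a', l') \<in> S" for a l a' l'
  proof -
    obtain G x G' x' where G: "ok G x" "a = m G x" "l = Z G x - \<tau> n (Z G x)"
      "ok G' x'" "a' = m G' x'" "l' = Z G' x' - \<tau> n (Z G' x')"
      using al by (auto simp: S_def)
    have fin: "finite (G \<union> G')" "G \<union> G' \<subseteq> M"
      using G(1,4) by (auto simp: ok_def)
    have "m (G \<union> G') (\<lambda>p. x p + x' p) = a + a'" "Z (G \<union> G') (\<lambda>p. x p + x' p) = Z G x + Z G' x'"
      using G(2,5) mono[OF G(1) _ fin] mono[OF G(4) _ fin] by (simp_all add: m_add[OF fin(2)])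
    then show ?thesis
      unfolding S_def using ok_add[OF G(1,4)] G(3,6)
      by (intro CollectI exI[of _ "G \<union> G'"] exI[of _ "\<lambda>p. x p + x' p"])
        (simp add: clinear_add[OF \<tau>_lin])
  qed
  have S_scale: "(c *\<^sub>C a, c *\<^sub>C l) \<in> S" if al: "(a, l) \<in> S" for c a l
  proof -
    obtain G x where G: "ok G x" "a = m G x" "l = Z G x - \<tau> n (Z G x)"
      using al by (auto simp: S_def)
    have "G \<subseteq> M" using G(1) by (simp add: ok_def)
    moreover have "ok G (\<lambda>p. c *\<^sub>C x p)"
      using G(1) s_Vt by (auto simp: ok_def hilbert_space_scaleC[OF K] clinear_scaleC[OF R_lin] subset_iff)
    ultimately show ?thesis
      unfolding S_def using G(2,3)
      by (intro CollectI exI[of _ G] exI[of _ "\<lambda>p. c *\<^sub>C x p"])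
        (simp add: m_scale clinear_scaleC[OF \<tau>_lin] scaleC_diff_right)
  qed
  have S_bound: "(norm l)\<^sup>2 \<le> Re (B a a)" "l \<in> K" if al: "(a, l) \<in> S" for a l
  proof -
    obtain G x where G: "ok G x" "a = m G x" "l = Z G x - \<tau> n (Z G x)"
      using al by (auto simp: S_def)
    \<comment> \<open>Removing the common part \<open>Y (m G x) = \<tau> n (Z G x)\<close> from
      \<open>norm (Z G x) \<le> norm (m G x)\<close> leaves a bound by the defect form.\<close>
    show "(norm l)\<^sup>2 \<le> Re (B a a)"
      using norm_Z[OF G(1)] norm_m[OF G(1)] norm_sq_\<tau>[of "Z G x" n]
      by (simp add: B_def G(2,3) Y_m[OF G(1)] flip: norm_sq_cinner)
    show "l \<in> K"
      using Z_in[OF G(1)] by (simp add: G(3) hilbert_space_diff[OF K] \<tau>_in)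
  qed
  have B: "B (u + v) w = B u w + B v w" "B (c *\<^sub>C u) w = c * B u w" "B u w = cnj (B w u)" for c u v w
  proof -
    show "B (u + v) w = B u w + B v w" "B (c *\<^sub>C u) w = c * B u w"
      by (simp_all add: B_def cinner_add_left cinner_scaleC_left clinear_add[OF Y(1)]
          clinear_scaleC[OF Y(1)] right_diff_distrib)
    show "B u w = cnj (B w u)"
      by (simp add: B_def flip: cinner_commute)
  qed
  obtain y where y: "clinear y" "\<And>z. y z \<in> K" "\<And>a l. (a, l) \<in> S \<Longrightarrow> y a = l"
      "\<And>z. (norm (y z))\<^sup>2 \<le> Re (B z z)"
    by (rule contractive_extension[OF B B_nonneg S_zero S_add S_scale S_bound hilbert_space_complete[OF K]])
      (assumption | rule that; assumption)+
  \<comment> \<open>The extension \<open>y\<close> may take values of any level. Keeping only what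
    level \<open>Suc n\<close> adds to level \<open>n\<close> does not change the prescribed values,
    which are already of this kind.\<close>
  define y' where "y' z = \<tau> (Suc n) (y z - \<tau> n (y z))" for z
  define Y' where "Y' z = Y z + y' z" for z
  have y'_lin: "clinear y'"
    unfolding y'_def by (intro clinear_comp[OF \<tau>_lin] clinear_minus_fun clinear_comp[OF \<tau>_lin y(1)] y(1))
  have \<tau>_y': "\<tau> n (y' z) = 0" "\<tau> (Suc n) (y' z) = y' z" for z
    by (simp_all add: y'_def \<tau>_min clinear_diff[OF \<tau>_lin] min_def)
  have \<tau>_Y': "\<tau> n (Y' z) = Y z" "\<tau> (Suc n) (Y' z) = Y' z" for z
  proof -
    show "\<tau> n (Y' z) = Y z"
      by (simp add: Y'_def clinear_add[OF \<tau>_lin] Y(4) \<tau>_y')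
    have "\<tau> (Suc n) (Y z) = Y z"
      using \<tau>_min[of "Suc n" n "Y z"] by (simp add: Y(4))
    then show "\<tau> (Suc n) (Y' z) = Y' z"
      by (simp add: Y'_def clinear_add[OF \<tau>_lin] \<tau>_y')
  qed
  have square: "Y' (ell2_single (f p) (W (e p) x)) = W (e' p) (Y (ell2_single (f' p) x))"
    if "p \<in> M" "x \<in> K" "R (s (e p)) x = x" for p x
  proof -
    define k where "k = W (e' p) (Y (ell2_single (f' p) x))"
    define x' where "x' q = (if q = p then x else 0)" for q
    have "ok {p} x'" using that by (simp add: ok_def x'_def)
    moreover have "m {p} x' = ell2_single (f p) (W (e p) x)" "Z {p} x' = k"
      by (simp_all add: m_def Z_def x'_def k_def)
    ultimately have "(ell2_single (f p) (W (e p) x), k - \<tau> n k) \<in> S"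
      unfolding S_def by (intro CollectI exI[of _ "{p}"] exI[of _ x']) simp
    then have "y (ell2_single (f p) (W (e p) x)) = k - \<tau> n k"
      by (rule y(3))
    then have "Y' (ell2_single (f p) (W (e p) x)) = \<tau> n k + \<tau> (Suc n) (k - \<tau> n k - \<tau> n (k - \<tau> n k))"
      using Y_sq[OF that] by (simp add: Y'_def y'_def k_def)
    also have "\<dots> = \<tau> (Suc n) k"
      by (simp add: clinear_diff[OF \<tau>_lin] \<tau>_min min_def)
    also have "\<dots> = k"
      using sq[OF that(1)] by (simp add: k_def \<tau>_W Y(4))
    finally show ?thesis by (simp add: k_def)
  qed
  have "partial_lift (Suc n) Y'"
    unfolding partial_lift_def
  proof (intro conjI allI ballI impI)
    show "clinear Y'"
      unfolding Y'_def by (intro clinear_plus Y(1) y'_lin)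
    show "Y' z \<in> K" for z
      by (simp add: Y'_def y'_def hilbert_space_add[OF K] hilbert_space_diff[OF K] Y(3) y(2) \<tau>_in)
    show "norm (Y' z) \<le> norm z" for z
    proof (rule norm_sq_le_imp_norm_le)
      have "cinner (Y z) (y' z) = cinner (Y z) (\<tau> n (y' z))"
        by (metis Y(4) \<tau>_adj)
      then have "(norm (Y' z))\<^sup>2 = (norm (Y z))\<^sup>2 + (norm (y' z))\<^sup>2"
        unfolding Y'_def by (intro norm_sq_add_orthogonal) (simp add: \<tau>_y')
      moreover have "(norm (y' z))\<^sup>2 \<le> (norm (y z))\<^sup>2"
        unfolding y'_def by (intro power_mono order_trans[OF norm_\<tau> norm_minus_\<tau>]) simp
      ultimately show "(norm (Y' z))\<^sup>2 \<le> (norm z)\<^sup>2"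
        using y(4)[of z] unfolding B_def by (simp only: minus_complex.sel flip: norm_sq_cinner)
    qed
    show "\<tau> (Suc n) (Y' z) = Y' z" for z by (rule \<tau>_Y')
    show "Y' (ell2_single (f p) (W (e p) x)) = \<tau> (Suc n) (W (e' p) (Y' (ell2_single (f' p) x)))"
      if "p \<in> M" "x \<in> K" "R (s (e p)) x = x" for p x
      using square[OF that] sq[OF that(1)] by (simp add: \<tau>_W \<tau>_Y')
  qed
  moreover have "lift_step n Y Y'"
    unfolding lift_step_def using \<tau>_Y' square by blast
  ultimately show ?thesis by blast
qed

text \<open>Each level is the truncation of the next, so squared norms increase boundedly and, by
  Pythagoras, control squared distances. The limit therefore exists in norm at every vector, and the
  relation in \<open>lift_step\<close> passes to it.\<close>

lemma lift_exists:
  "\<exists>Y. clinear Y \<and> (\<forall>z. norm (Y z) \<le> norm z) \<and> (\<forall>z. Y z \<in> K) \<and>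
    (\<forall>g\<in>F. \<forall>x. P (Y (ell2_single g x)) = V g (P x)) \<and>
    (\<forall>p\<in>M. \<forall>x\<in>K. R (s (e p)) x = x \<longrightarrow>
      Y (ell2_single (f p) (W (e p) x)) = W (e' p) (Y (ell2_single (f' p) x)))"
proof -
  define good where "good n Y \<longleftrightarrow> partial_lift n Y \<and>
    (\<forall>g\<in>F. \<forall>x. P (Y (ell2_single g x)) = V g (P x))" for n Y
  have P_\<tau>: "P (\<tau> n k) = P k" for n k
    using \<tau>_min[of 0 n k] by (metis P_J \<tau>_0 min_0L)
  have "\<exists>Y'. good (Suc n) Y' \<and> lift_step n Y Y'" if "good n Y" for n Y
  proof -
    obtain Y' where "partial_lift (Suc n) Y'" "lift_step n Y Y'"
      using lift_step_exists \<open>good n Y\<close> unfolding good_def by blast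
    moreover have "P (Y' z) = P (Y z)" for z
      using \<open>lift_step n Y Y'\<close> P_\<tau> unfolding lift_step_def by metis
    ultimately show ?thesis
      using \<open>good n Y\<close> unfolding good_def by auto
  qed
  moreover have "\<exists>Y. good 0 Y"
    using partial_lift_0 by (simp add: good_def)
  ultimately obtain Y where Y: "\<And>n. good n (Y n)" "\<And>n. lift_step n (Y n) (Y (Suc n))"
    using dependent_nat_choice[of good lift_step] by metis
  have Y_lin: "clinear (Y n)" and Y_norm: "norm (Y n z) \<le> norm z" and Y_in: "Y n z \<in> K"
    and Y_\<tau>: "\<tau> n (Y n z) = Y n z"
    and Y_P: "g \<in> F \<Longrightarrow> P (Y n (ell2_single g x)) = V g (P x)" for n z g x
    using Y(1)[of n] by (auto simp: good_def partial_lift_def)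
  have Y_Suc: "\<tau> n (Y (Suc n) z) = Y n z" for n z
    using Y(2)[of n] by (auto simp: lift_step_def)
  have Y_le: "\<tau> m (Y (m + d) z) = Y m z" for m d z
  proof (induction d)
    case (Suc d)
    have "\<tau> m (Y (m + Suc d) z) = \<tau> m (\<tau> (m + d) (Y (Suc (m + d)) z))"
      by (simp add: \<tau>_min)
    then show ?case using Suc by (simp add: Y_Suc)
  qed (simp add: Y_\<tau>)
  have diff: "(norm (Y n z - Y m z))\<^sup>2 = (norm (Y n z))\<^sup>2 - (norm (Y m z))\<^sup>2" if "m \<le> n" for m n z
    using norm_sq_\<tau>[of "Y n z" m] Y_le[of m "n - m" z] that by simp
  have "\<exists>l\<in>K. (\<lambda>n. Y n z) \<longlonglongrightarrow> l" for z
  proof -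
    have inc: "incseq (\<lambda>n. (norm (Y n z))\<^sup>2)"
    proof (rule incseq_SucI)
      show "(norm (Y n z))\<^sup>2 \<le> (norm (Y (Suc n) z))\<^sup>2" for n
        using diff[of n "Suc n" z] zero_le_power2[of "norm (Y (Suc n) z - Y n z)"] by linarith
    qed
    have "(norm (Y n z))\<^sup>2 \<le> (norm z)\<^sup>2" for n
      by (intro power_mono Y_norm) simp
    then obtain b where "(\<lambda>n. (norm (Y n z))\<^sup>2) \<longlonglongrightarrow> b"
      using incseq_convergent[OF inc] by blast
    then have cauchy: "Cauchy (\<lambda>n. (norm (Y n z))\<^sup>2)"
      by (rule LIMSEQ_imp_Cauchy)
    have "Cauchy (\<lambda>n. Y n z)"
    proof (rule metric_CauchyI)
      fix d :: real assume "0 < d"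
      then obtain N where N: "\<And>m n. N \<le> m \<Longrightarrow> N \<le> n \<Longrightarrow> dist ((norm (Y m z))\<^sup>2) ((norm (Y n z))\<^sup>2) < d\<^sup>2"
        using metric_CauchyD[OF cauchy, of "d\<^sup>2"] by auto
      have "dist (Y m z) (Y n z) < d" if "N \<le> m" "N \<le> n" for m n
      proof -
        have "(norm (Y m z - Y n z))\<^sup>2 < d\<^sup>2"
        proof (cases "m \<le> n")
          case True
          then show ?thesis
            using diff[OF True, of z] N[OF that] by (simp add: norm_minus_commute dist_real_def)
        next
          case False
          then show ?thesis
            using diff[of n m z] N[OF that] by (simp add: dist_real_def)
        qed
        then show ?thesis
          using \<open>0 < d\<close> by (simp add: dist_norm power_less_imp_less_base)
      qed
      then show "\<exists>N. \<forall>m\<ge>N. \<forall>n\<ge>N. dist (Y m z) (Y n z) < d" by blast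
    qed
    then show ?thesis
      using hilbert_space_complete[OF K, unfolded complete_def, rule_format, of "\<lambda>n. Y n z"] Y_in by simp
  qed
  then obtain L where L: "\<And>z. L z \<in> K" "\<And>z. (\<lambda>n. Y n z) \<longlonglongrightarrow> L z"
    by metis
  show ?thesis
  proof (intro exI[of _ L] conjI allI ballI impI)
    show "clinear L"
    proof (rule clinearI)
      show "L (x + y) = L x + L y" for x y
        using LIMSEQ_unique[OF L(2)[of "x + y"]] tendsto_add[OF L(2)[of x] L(2)[of y]]
        by (simp add: clinear_add[OF Y_lin])
      show "L (c *\<^sub>C x) = c *\<^sub>C L x" for c x
        using LIMSEQ_unique[OF L(2)[of "c *\<^sub>C x"]] bounded_linear.tendsto[OF bounded_linear_scaleC L(2)[of x]]
        by (simp add: clinear_scaleC[OF Y_lin])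
    qed
    show "norm (L z) \<le> norm z" for z
      using LIMSEQ_le_const2[OF tendsto_norm[OF L(2)[of z]]] Y_norm by blast
    show "L z \<in> K" for z by (rule L)
    show "P (L (ell2_single g x)) = V g (P x)" if "g \<in> F" for g x
      using bounded_linear.tendsto[OF clinear_bounded_linear[OF P_lin, of 1] L(2)[of "ell2_single g x"]]
        norm_P LIMSEQ_unique[OF _ tendsto_const] by (simp add: Y_P[OF that])
    show "L (ell2_single (f p) (W (e p) x)) = W (e' p) (L (ell2_single (f' p) x))"
      if "p \<in> M" "x \<in> K" "R (s (e p)) x = x" for p x
    proof -
      have e': "e' p \<in> E" using sq[OF that(1)] by simp
      have "Y (Suc n) (ell2_single (f p) (W (e p) x)) = W (e' p) (Y n (ell2_single (f' p) x))" for n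
        using Y(2)[of n] that by (auto simp: lift_step_def)
      moreover have "bounded_linear (W (e' p))"
        by (rule clinear_bounded_linear[where B = 1]) (auto simp: W_lin norm_W e')
      then have "(\<lambda>n. W (e' p) (Y n (ell2_single (f' p) x))) \<longlonglongrightarrow> W (e' p) (L (ell2_single (f' p) x))"
        by (rule bounded_linear.tendsto) (rule L(2))
      ultimately have "(\<lambda>n. Y (Suc n) (ell2_single (f p) (W (e p) x)))
          \<longlonglongrightarrow> W (e' p) (L (ell2_single (f' p) x))"
        by simp
      then show ?thesis
        using LIMSEQ_unique[OF LIMSEQ_Suc[OF L(2)]] by blast
    qed
  qed
qed

text \<open>\<open>Y\<close> knows nothing of vertices. Cutting its components by \<open>R\<close>
  at both ends gives edge maps, and the row stays contractive: components with different ranges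
  become orthogonal, and those of one range come from a single value of \<open>Y\<close>.\<close>

lemma commuting_lift_exists:
  obtains V' A' where "row_contraction K F V' A'" "edge_maps Vt r s F R V'"
    "\<And>g k. g \<in> F \<Longrightarrow> k \<in> K \<Longrightarrow> P (V' g k) = V g (P k)"
    "\<And>p k. p \<in> M \<Longrightarrow> k \<in> K \<Longrightarrow> V' (f p) (W (e p) k) = W (e' p) (V' (f' p) k)"
proof -
  obtain Y where Y: "clinear Y" "\<And>z. norm (Y z) \<le> norm z" "\<And>z. Y z \<in> K"
    "\<And>g x. g \<in> F \<Longrightarrow> P (Y (ell2_single g x)) = V g (P x)"
    and Y_sq: "\<And>p x. p \<in> M \<Longrightarrow> x \<in> K \<Longrightarrow> R (s (e p)) x = x \<Longrightarrow>
      Y (ell2_single (f p) (W (e p) x)) = W (e' p) (Y (ell2_single (f' p) x))"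
  proof -
    obtain Y where "clinear Y \<and> (\<forall>z. norm (Y z) \<le> norm z) \<and> (\<forall>z. Y z \<in> K) \<and>
      (\<forall>g\<in>F. \<forall>x. P (Y (ell2_single g x)) = V g (P x)) \<and>
      (\<forall>p\<in>M. \<forall>x\<in>K. R (s (e p)) x = x \<longrightarrow>
        Y (ell2_single (f p) (W (e p) x)) = W (e' p) (Y (ell2_single (f' p) x)))"
      using lift_exists ..
    then show thesis by (intro that[of Y]) simp_all
  qed
  note FV = edge_mapsD(1,2)[OF V_edge]
  define V' where "V' g k = R (r g) (Y (ell2_single g (R (s g) (cproj K k))))" for g k
  have V'_lin: "clinear (V' g)" if "g \<in> F" for g
    unfolding V'_def using that FV
    by (intro clinear_comp[OF R_lin] clinear_comp[OF Y(1)] clinear_comp[OF clinear_ell2_single]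
        clinear_cproj[OF K]) auto
  have u_norm: "norm (R (s g) (cproj K k)) \<le> norm k" if "g \<in> F" for g k
    using vertex_projections_norm[OF R FV(2)[OF that], of "cproj K k"] norm_cproj_le[OF K, of k]
    by linarith
  have V'_norm: "(norm (\<Sum>g\<in>G. V' g (k g)))\<^sup>2 \<le> (\<Sum>g\<in>G. (norm (k g))\<^sup>2)"
    if G: "finite G" "G \<subseteq> F" for G k
  proof -
    define b where "b a = (\<Sum>g\<in>{g \<in> G. r g = a}. ell2_single g (R (s g) (cproj K (k g))))" for a
    have r_G: "r ` G \<subseteq> Vt" using FV G by auto
    have "(\<Sum>g\<in>G. V' g (k g)) = (\<Sum>a\<in>r ` G. \<Sum>g\<in>{g \<in> G. r g = a}. V' g (k g))"
      using G(1) by (subst sum.group) auto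
    also have "\<dots> = (\<Sum>a\<in>r ` G. R a (Y (b a)))"
    proof (rule sum.cong)
      fix a assume "a \<in> r ` G"
      then have "a \<in> Vt" using r_G by blast
      then show "(\<Sum>g\<in>{g \<in> G. r g = a}. V' g (k g)) = R a (Y (b a))"
        by (simp add: b_def V'_def clinear_sum[OF R_lin] clinear_sum[OF Y(1)])
    qed simp
    finally have "(norm (\<Sum>g\<in>G. V' g (k g)))\<^sup>2 = (\<Sum>a\<in>r ` G. (norm (R a (Y (b a))))\<^sup>2)"
      using G(1) r_G by (auto intro!: norm_sq_sum_orthogonal
          simp: vertex_projections_adjoint[OF R] vertex_projections_mult[OF R] subset_iff)
    also have "\<dots> \<le> (\<Sum>a\<in>r ` G. (norm (b a))\<^sup>2)"
    proof (intro sum_mono power_mono)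
      fix a assume "a \<in> r ` G"
      then have "a \<in> Vt" using r_G by blast
      then show "norm (R a (Y (b a))) \<le> norm (b a)"
        using vertex_projections_norm[OF R, of a "Y (b a)"] Y(2)[of "b a"] by linarith
    qed simp
    also have "\<dots> = (\<Sum>a\<in>r ` G. \<Sum>g\<in>{g \<in> G. r g = a}. (norm (R (s g) (cproj K (k g))))\<^sup>2)"
      unfolding b_def using G(1)
      by (intro sum.cong refl, subst norm_sq_sum_orthogonal) (auto simp: cinner_ell2_single_left)
    also have "\<dots> = (\<Sum>g\<in>G. (norm (R (s g) (cproj K (k g))))\<^sup>2)"
      using G(1) by (subst sum.group) auto
    also have "\<dots> \<le> (\<Sum>g\<in>G. (norm (k g))\<^sup>2)"
      using G(2) u_norm by (intro sum_mono power_mono) auto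
    finally show ?thesis .
  qed
  have V'_in: "V' g k \<in> K" if "g \<in> F" for g k
    unfolding V'_def by (intro vertex_projections_in[OF R FV(1)[OF that]] Y(3))
  have "\<exists>A'. \<forall>k k'. cinner (V' g k) k' = cinner k (A' k') \<and> A' k' \<in> K" if g: "g \<in> F" for g
  proof -
    have "norm (V' g k) \<le> 1 * norm k" for k
      using V'_norm[of "{g}" "\<lambda>_. k"] g by (simp add: norm_sq_le_imp_norm_le)
    moreover have "V' g (cproj K k) = V' g k" for k
      by (simp add: V'_def cproj_id[OF K] cproj_in[OF K])
    ultimately obtain A' where "\<And>k k'. cinner (V' g k) k' = cinner k (A' k')" "\<And>k'. A' k' \<in> K"
      using total_adjoint_exists[OF K V'_lin[OF g]] by metis
    then show ?thesis by blast
  qed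
  then obtain A' where A': "\<And>g k k'. g \<in> F \<Longrightarrow> cinner (V' g k) k' = cinner k (A' g k')"
    "\<And>g k'. g \<in> F \<Longrightarrow> A' g k' \<in> K"
    by metis
  \<comment> \<open>The source relation in \<open>edge_maps\<close> is stated for every vector of
    the type, so \<open>R (s g)\<close> has to be moved past the projection onto
    \<open>K\<close>.\<close>
  have R_cproj: "cproj K (R a k) = R a (cproj K k)" if a: "a \<in> Vt" for a k
  proof (rule cinner_eqI)
    fix z
    have "cinner (cproj K (R a k)) z = cinner k (R a (cproj K z))"
      by (simp add: cproj_adjoint[OF K] vertex_projections_adjoint[OF R a])
    also have "\<dots> = cinner (cproj K k) (R a (cproj K z))"
      by (simp add: cinner_cproj[OF K] vertex_projections_in[OF R a] cproj_in[OF K])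
    also have "\<dots> = cinner (cproj K (R a (cproj K k))) z"
      by (simp add: cproj_adjoint[OF K] vertex_projections_adjoint[OF R a])
    finally show "cinner (cproj K (R a k)) z = cinner (R a (cproj K k)) z"
      by (simp add: cproj_id[OF K] vertex_projections_in[OF R a] cproj_in[OF K])
  qed
  show thesis
  proof (rule that)
    show "row_contraction K F V' A'"
      unfolding row_contraction_def using K A' V'_in V'_norm by blast
    show "edge_maps Vt r s F R V'"
      unfolding edge_maps_def
      using FV by (auto simp: V'_def vertex_projections_mult[OF R] R_cproj)
    show "P (V' g k) = V g (P k)" if "g \<in> F" "k \<in> K" for g k
      using that FV edge_mapsD(3,4)[OF V_edge that(1)] by (simp add: V'_def P_R Y(4) cproj_id[OF K])
    show "V' (f p) (W (e p) k) = W (e' p) (V' (f' p) k)" if p: "p \<in> M" and k: "k \<in> K" for p k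
    proof -
      note sq = sq[OF p]
      note E = edge_mapsD[OF W_edge]
      \<comment> \<open>The lift respects squares only for vectors fixed by
        \<open>R (s (e p))\<close>. Passing to this component of \<open>k\<close> changes neither
        side, since \<open>W (e p)\<close> and \<open>V' (f' p)\<close> have the same
        source.\<close>
      define x where "x = R (s (e p)) k"
      have x: "x \<in> K" "R (s (e p)) x = x" "W (e p) k = W (e p) x"
        using sq k E(2)[of "e p"] E(4)[of "e p" k]
        by (auto simp: x_def vertex_projections_in[OF R] vertex_projections_mult[OF R])
      have "V' (f p) (W (e p) k) = R (r (f p)) (Y (ell2_single (f p) (W (e p) x)))"
        using sq W_in x(1) E(3)[of "e p" x] by (simp add: V'_def x(3) cproj_id[OF K])
      also have "\<dots> = W (e' p) (Y (ell2_single (f' p) x))"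
        using sq E(3)[of "e' p"] by (simp add: Y_sq[OF p x(1,2)])
      also have "\<dots> = W (e' p) (V' (f' p) k)"
        using sq E(4)[of "e' p" "Y (ell2_single (f' p) x)"] by (simp add: V'_def cproj_id[OF K k] x_def)
      finally show ?thesis .
    qed
  qed
qed

end

section \<open>Factorisation in rank-2 graphs\<close>

abbreviation edges :: "('l, 2) rank_graph \<Rightarrow> 2 \<Rightarrow> 'l set" where
  "edges G i \<equiv> paths_of_shape G (axis i 1)"

definition split_edge :: "('l, 2) rank_graph \<Rightarrow> 2 \<Rightarrow> 'l \<Rightarrow> 'l \<times> 'l" where
  "split_edge G i p = (SOME (x, q). x \<in> edges G i \<and> q \<in> paths G \<and> src G x = rng G q \<and> p = cmp G x q)"

text \<open>Paths are not freely generated by edges, so the recursion runs on the number of edges of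
  direction \<open>i\<close>, removed at the range end; \<open>B\<close> acts on what is
  left.\<close>

primrec peel :: "('l, 2) rank_graph \<Rightarrow> 2 \<Rightarrow> ('l \<Rightarrow> 'c \<Rightarrow> 'c) \<Rightarrow> ('l \<Rightarrow> 'b \<Rightarrow> 'c) \<Rightarrow> nat \<Rightarrow> 'l \<Rightarrow> 'b \<Rightarrow> 'c"
  where
  "peel G i U B 0 p h = B p h"
| "peel G i U B (Suc n) p h = U (fst (split_edge G i p)) (peel G i U B n (snd (split_edge G i p)) h)"

definition edge_extension ::
    "('l, 2) rank_graph \<Rightarrow> 2 \<Rightarrow> ('l \<Rightarrow> 'c \<Rightarrow> 'c) \<Rightarrow> ('l \<Rightarrow> 'b \<Rightarrow> 'c) \<Rightarrow> 'l \<Rightarrow> 'b \<Rightarrow> 'c" where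
  "edge_extension G i U B p = peel G i U B (shape G p $ i) p"

locale rank2_graph =
  fixes G :: "('l, 2) rank_graph"
  assumes G: "is_rank_graph G"
begin

lemma
  shows vertex_in_paths: "a \<in> vertices G \<Longrightarrow> a \<in> paths G"
    and rng_vertex: "p \<in> paths G \<Longrightarrow> rng G p \<in> vertices G"
    and src_vertex: "p \<in> paths G \<Longrightarrow> src G p \<in> vertices G"
    and rng_of_vertex: "a \<in> vertices G \<Longrightarrow> rng G a = a"
    and src_of_vertex: "a \<in> vertices G \<Longrightarrow> src G a = a"
    and cmp_in_paths: "p \<in> paths G \<Longrightarrow> q \<in> paths G \<Longrightarrow> src G p = rng G q \<Longrightarrow> cmp G p q \<in> paths G"
    and rng_cmp: "p \<in> paths G \<Longrightarrow> q \<in> paths G \<Longrightarrow> src G p = rng G q \<Longrightarrow> rng G (cmp G p q) = rng G p"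
    and src_cmp: "p \<in> paths G \<Longrightarrow> q \<in> paths G \<Longrightarrow> src G p = rng G q \<Longrightarrow> src G (cmp G p q) = src G q"
    and cmp_rng: "p \<in> paths G \<Longrightarrow> cmp G (rng G p) p = p"
    and cmp_src: "p \<in> paths G \<Longrightarrow> cmp G p (src G p) = p"
    and cmp_assoc: "p \<in> paths G \<Longrightarrow> q \<in> paths G \<Longrightarrow> u \<in> paths G \<Longrightarrow> src G p = rng G q \<Longrightarrow>
      src G q = rng G u \<Longrightarrow> cmp G (cmp G p q) u = cmp G p (cmp G q u)"
    and shape_vertex: "a \<in> vertices G \<Longrightarrow> shape G a = 0"
    and shape_cmp: "p \<in> paths G \<Longrightarrow> q \<in> paths G \<Longrightarrow> src G p = rng G q \<Longrightarrow>
      shape G (cmp G p q) = shape G p + shape G q"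
  using G by (auto simp: is_rank_graph_def small_category_def)

lemma factorisation_unique:
  assumes "p \<in> paths G" "shape G p = m + n"
  shows "\<exists>!(q, u). q \<in> paths G \<and> u \<in> paths G \<and> shape G q = m \<and> shape G u = n \<and>
    src G q = rng G u \<and> p = cmp G q u"
proof -
  have "\<forall>m n. \<forall>p\<in>paths G. shape G p = m + n \<longrightarrow>
      (\<exists>!(q, u). q \<in> paths G \<and> u \<in> paths G \<and> shape G q = m \<and> shape G u = n \<and>
        src G q = rng G u \<and> p = cmp G q u)"
    using G unfolding is_rank_graph_def by (elim conjE)
  then show ?thesis using assms by blast
qed

lemma factorisation_exists:
  assumes "p \<in> paths G" "shape G p = m + n"
  obtains q u where "q \<in> paths G" "u \<in> paths G" "shape G q = m" "shape G u = n"
    "src G q = rng G u" "p = cmp G q u"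
  using ex1_implies_ex[OF factorisation_unique[OF assms]] by auto

lemma cmp_cancel:
  assumes "p \<in> paths G" "q \<in> paths G" "src G p = rng G q"
    and "p' \<in> paths G" "q' \<in> paths G" "src G p' = rng G q'"
    and "shape G p = shape G p'" "cmp G p q = cmp G p' q'"
  shows "p = p'" "q = q'"
proof -
  have "shape G q = shape G q'"
    using shape_cmp[OF assms(1-3)] shape_cmp[OF assms(4-6)] assms(7,8) by simp
  then have "case (p', q') of (a, b) \<Rightarrow> a \<in> paths G \<and> b \<in> paths G \<and> shape G a = shape G p \<and>
      shape G b = shape G q \<and> src G a = rng G b \<and> cmp G p q = cmp G a b"
    using assms by simp
  moreover have "case (p, q) of (a, b) \<Rightarrow> a \<in> paths G \<and> b \<in> paths G \<and> shape G a = shape G p \<and>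
      shape G b = shape G q \<and> src G a = rng G b \<and> cmp G p q = cmp G a b"
    using assms by simp
  moreover have "a = b" if "\<exists>!x. \<Phi> x" "\<Phi> a" "\<Phi> b" for \<Phi> and a b :: "'l \<times> 'l"
    using that by blast
  ultimately have "(p, q) = (p', q')"
    using factorisation_unique[OF cmp_in_paths[OF assms(1-3)] shape_cmp[OF assms(1-3)]] by blast
  then show "p = p'" "q = q'" by auto
qed

text \<open>\<open>p\<close> factors both as \<open>rng G p\<close> times \<open>p\<close> and as
  \<open>p\<close> times \<open>src G p\<close>; in both, the first factor has shape
  \<open>0\<close>.\<close>

lemma vertex_if_shape_0:
  assumes "p \<in> paths G" "shape G p = 0"
  shows "p \<in> vertices G"
proof -
  have "rng G p = p"
    using assms rng_vertex[OF assms(1)] src_vertex[OF assms(1)]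
    by (intro cmp_cancel(1)[of "rng G p" p p "src G p"])
      (simp_all add: vertex_in_paths rng_of_vertex src_of_vertex shape_vertex cmp_rng cmp_src)
  then show ?thesis using rng_vertex[OF assms(1)] by simp
qed

lemma edges_paths: "x \<in> edges G i \<Longrightarrow> x \<in> paths G"
  and edges_shape: "x \<in> edges G i \<Longrightarrow> shape G x = axis i 1"
  by (simp_all add: paths_of_shape_def)

lemma edge_factor_exists:
  assumes p: "p \<in> paths G" "shape G p $ i \<noteq> 0"
  obtains x q where "x \<in> edges G i" "q \<in> paths G" "src G x = rng G q" "p = cmp G x q"
proof -
  define n where "n = (\<chi> j. if j = i then shape G p $ i - 1 else shape G p $ j)"
  have "shape G p = axis i 1 + n"
    using p(2) by (simp add: vec_eq_iff n_def axis_def)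
  then show thesis
    by (rule factorisation_exists[OF p(1)]) (rule that, simp_all add: paths_of_shape_def)
qed

lemma split_edge_cmp:
  assumes "x \<in> edges G i" "q \<in> paths G" "src G x = rng G q"
  shows "split_edge G i (cmp G x q) = (x, q)"
proof -
  have "case split_edge G i (cmp G x q) of (x', q') \<Rightarrow>
      x' \<in> edges G i \<and> q' \<in> paths G \<and> src G x' = rng G q' \<and> cmp G x q = cmp G x' q'"
    unfolding split_edge_def by (rule someI[of _ "(x, q)"]) (use assms in auto)
  moreover have "x = x'" "q = q'"
    if "x' \<in> edges G i" "q' \<in> paths G" "src G x' = rng G q'" "cmp G x q = cmp G x' q'" for x' q'
    using cmp_cancel[of x q x' q'] assms that by (auto simp: edges_paths edges_shape)
  ultimately show ?thesis by (auto split: prod.splits)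
qed

lemma shape_edge_cmp:
  assumes "x \<in> edges G i" "q \<in> paths G" "src G x = rng G q"
  shows "shape G (cmp G x q) $ j = (if j = i then Suc (shape G q $ j) else shape G q $ j)"
  using assms by (simp add: shape_cmp edges_paths edges_shape axis_def)

lemma edge_extension_cmp:
  assumes "x \<in> edges G i" "q \<in> paths G" "src G x = rng G q"
  shows "edge_extension G i U B (cmp G x q) h = U x (edge_extension G i U B q h)"
  using assms by (simp add: edge_extension_def shape_edge_cmp split_edge_cmp)

lemma edge_extension_base: "shape G p $ i = 0 \<Longrightarrow> edge_extension G i U B p h = B p h"
  by (simp add: edge_extension_def)

lemma direction_induct [consumes 1, case_names base step]:
  assumes "p \<in> paths G"
    and "\<And>p. p \<in> paths G \<Longrightarrow> shape G p $ i = 0 \<Longrightarrow> Pr p"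
    and "\<And>x q. x \<in> edges G i \<Longrightarrow> q \<in> paths G \<Longrightarrow> src G x = rng G q \<Longrightarrow> Pr q \<Longrightarrow> Pr (cmp G x q)"
  shows "Pr p"
  using assms(1)
proof (induction "shape G p $ i" arbitrary: p)
  case 0
  then show ?case using assms(2) by simp
next
  case (Suc n)
  then obtain x q where x: "x \<in> edges G i" "q \<in> paths G" "src G x = rng G q" "p = cmp G x q"
    using edge_factor_exists[of p i] by auto
  then have "n = shape G q $ i"
    using Suc.hyps(2) by (simp add: shape_edge_cmp)
  then show ?case
    using Suc.hyps(1) assms(3) x by blast
qed

lemma path_induct [consumes 1, case_names vertex edge]:
  assumes p: "p \<in> paths G"
    and vertex: "\<And>a. a \<in> vertices G \<Longrightarrow> Pr a"
    and edge: "\<And>i x q. x \<in> edges G i \<Longrightarrow> q \<in> paths G \<Longrightarrow> src G x = rng G q \<Longrightarrow> Pr q \<Longrightarrow> Pr (cmp G x q)"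
  shows "Pr p"
proof -
  have "shape G p $ 1 = 0 \<Longrightarrow> Pr p" if "p \<in> paths G" for p
    using that
  proof (induction p rule: direction_induct[where i = 2])
    case (base p)
    then have "shape G p = 0" by (simp add: vec_eq_iff forall_2)
    then show ?case using vertex vertex_if_shape_0 base(1) by blast
  next
    case (step x q)
    then have "shape G q $ 1 = 0" by (simp add: shape_edge_cmp)
    then show ?case using step edge by blast
  qed
  with p show ?thesis
    by (induction p rule: direction_induct[where i = 1]) (use edge in blast)+
qed

text \<open>Shapes add commutatively, so the path \<open>x y\<close> also factors with its two
  shapes in the opposite order.\<close>

lemma square_exists:
  assumes "x \<in> edges G i" "y \<in> edges G j" "src G x = rng G y"
  obtains y' x' where "y' \<in> edges G j" "x' \<in> edges G i" "src G y' = rng G x'" "cmp G x y = cmp G y' x'"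
    "rng G y' = rng G x" "src G x' = src G y"
proof -
  have xy: "x \<in> paths G" "y \<in> paths G" using assms edges_paths by auto
  have "shape G (cmp G x y) = axis j 1 + axis i 1"
    using assms xy by (simp add: shape_cmp edges_shape add.commute)
  then obtain y' x' where *: "y' \<in> paths G" "x' \<in> paths G" "shape G y' = axis j 1" "shape G x' = axis i 1"
    "src G y' = rng G x'" "cmp G x y = cmp G y' x'"
    using factorisation_exists[OF cmp_in_paths[OF xy assms(3)]] by metis
  have "rng G y' = rng G x" "src G x' = src G y"
    using rng_cmp[OF xy assms(3)] rng_cmp[OF *(1,2,5)] src_cmp[OF xy assms(3)] src_cmp[OF *(1,2,5)] *(6)
    by auto
  with * show thesis by (intro that[of y' x']) (auto simp: paths_of_shape_def)
qed

end

section \<open>Operators along paths\<close>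

locale path_operators = rank2_graph G
  for G :: "('l, 2) rank_graph" +
  fixes K :: "'k::complex_inner set" and R W V :: "'l \<Rightarrow> 'k \<Rightarrow> 'k"
  assumes R: "vertex_projections (vertices G) K R"
    and W: "edge_maps (vertices G) (rng G) (src G) (edges G 1) R W"
    and V: "edge_maps (vertices G) (rng G) (src G) (edges G 2) R V"
    and W_in: "\<And>x k. x \<in> edges G 1 \<Longrightarrow> k \<in> K \<Longrightarrow> W x k \<in> K"
    and V_in: "\<And>x k. x \<in> edges G 2 \<Longrightarrow> k \<in> K \<Longrightarrow> V x k \<in> K"
    and square: "\<And>g x g' x' k. g \<in> edges G 2 \<Longrightarrow> x \<in> edges G 1 \<Longrightarrow> src G g = rng G x \<Longrightarrow>
      x' \<in> edges G 1 \<Longrightarrow> g' \<in> edges G 2 \<Longrightarrow> src G x' = rng G g' \<Longrightarrow> cmp G g x = cmp G x' g' \<Longrightarrow>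
      k \<in> K \<Longrightarrow> V g (W x k) = W x' (V g' k)"
begin

text \<open>A normal form: first-direction edges at the range end, then second-direction edges, then
  a vertex.\<close>

definition path_op :: "'l \<Rightarrow> 'k \<Rightarrow> 'k" where
  "path_op = edge_extension G 1 W (edge_extension G 2 V R)"

lemma path_op_vertex: "a \<in> vertices G \<Longrightarrow> path_op a k = R a k"
  by (simp add: path_op_def edge_extension_base shape_vertex)

lemma path_op_cmp1:
  "x \<in> edges G 1 \<Longrightarrow> q \<in> paths G \<Longrightarrow> src G x = rng G q \<Longrightarrow> path_op (cmp G x q) k = W x (path_op q k)"
  by (simp add: path_op_def edge_extension_cmp)

lemma path_op_no1:
  assumes "q \<in> paths G" "shape G q $ 1 = 0"
  shows "path_op q k = edge_extension G 2 V R q k"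
  using assms by (simp add: path_op_def edge_extension_base)

lemma path_op_in: "p \<in> paths G \<Longrightarrow> k \<in> K \<Longrightarrow> path_op p k \<in> K"
proof (induction p rule: direction_induct[where i = 1])
  case (base p)
  have "shape G p $ 1 = 0 \<longrightarrow> edge_extension G 2 V R p k \<in> K"
    using base(1)
  proof (induction p rule: direction_induct[where i = 2])
    case (base p)
    then show ?case
      using vertex_if_shape_0[OF base(1)] base(2) \<open>k \<in> K\<close>
      by (auto simp: edge_extension_base vec_eq_iff forall_2 intro!: vertex_projections_in[OF R])
  next
    case (step x q)
    then show ?case
      by (auto simp: edge_extension_cmp shape_edge_cmp intro: V_in)
  qed
  then show ?case using base by (simp add: path_op_no1)
next
  case (step x q)
  then show ?case by (simp add: path_op_cmp1 W_in)
qed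

text \<open>Here the commuting squares enter. A square carries \<open>g\<close> past the leading
  first-direction edge but replaces both edges, so the induction must let \<open>g\<close>
  vary.\<close>

lemma path_op_cmp2:
  assumes "q \<in> paths G" "k \<in> K" "g \<in> edges G 2" "src G g = rng G q"
  shows "path_op (cmp G g q) k = V g (path_op q k)"
  using assms(1,3,4)
proof (induction q arbitrary: g rule: direction_induct[where i = 1])
  case (base q)
  then have "shape G (cmp G g q) $ 1 = 0" "cmp G g q \<in> paths G"
    by (simp_all add: shape_edge_cmp cmp_in_paths edges_paths)
  then show ?case
    using base by (simp add: path_op_no1 edge_extension_cmp)
next
  case (step x q)
  note x = edges_paths[OF step(1)] and g = edges_paths[OF step(5)]
  have gx: "src G g = rng G x"
    using step by (simp add: rng_cmp[OF x])
  obtain x' g' where *: "x' \<in> edges G 1" "g' \<in> edges G 2" "src G x' = rng G g'"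
      "cmp G g x = cmp G x' g'" "src G g' = src G x"
    using square_exists[OF step(5,1) gx] by metis
  note x' = edges_paths[OF *(1)] and g' = edges_paths[OF *(2)]
  have g'q: "src G g' = rng G q" using * step by simp
  have "cmp G g (cmp G x q) = cmp G (cmp G g x) q"
    using step gx by (simp add: cmp_assoc x g)
  also have "\<dots> = cmp G x' (cmp G g' q)"
    using step * g'q by (simp add: cmp_assoc x' g')
  finally have "path_op (cmp G g (cmp G x q)) k = W x' (path_op (cmp G g' q) k)"
    using step * g'q by (simp add: path_op_cmp1 cmp_in_paths rng_cmp g')
  also have "\<dots> = W x' (V g' (path_op q k))"
    using step.IH[OF *(2) g'q] by simp
  also have "\<dots> = V g (W x (path_op q k))"
    using square[OF step(5,1) gx *(1,2,3,4) path_op_in[OF step(2) assms(2)]] by simp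
  finally show ?case
    using step by (simp add: path_op_cmp1)
qed

lemma path_op_cmp_edge:
  assumes "x \<in> edges G i" "q \<in> paths G" "src G x = rng G q" "k \<in> K"
  shows "path_op (cmp G x q) k = (if i = 1 then W x (path_op q k) else V x (path_op q k))"
proof (cases "i = 1")
  case False
  then have "i = 2" using exhaust_2 by blast
  then show ?thesis using assms by (simp add: path_op_cmp2)
qed (use assms in \<open>simp add: path_op_cmp1\<close>)

lemma path_op_rng:
  assumes "p \<in> paths G" "k \<in> K"
  shows "R (rng G p) (path_op p k) = path_op p k"
  using assms(1)
proof (induction p rule: path_induct)
  case (vertex a)
  then show ?case
    by (simp add: path_op_vertex rng_of_vertex vertex_projections_mult[OF R])
next
  case (edge i x q)
  moreover have "i = 1 \<or> i = 2" by (rule exhaust_2)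
  ultimately show ?case
    using assms(2) edge_mapsD(3)[OF W, of x] edge_mapsD(3)[OF V, of x]
    by (auto simp: path_op_cmp_edge rng_cmp edges_paths)
qed

end

section \<open>Inner products of path vectors in the second dilation space\<close>

locale path_vectors = path_operators G K R W V +
    D: edge_dilation "vertices G" "rng G" "src G" "edges G 2" K R V L R' W' J P \<tau>
  for G :: "('l, 2) rank_graph" and K :: "'k::complex_inner set" and R W V
    and L :: "'c::complex_inner set" and R' W' J P \<tau> +
  assumes W_iso: "isometric_edges (src G) (edges G 1) R W"
begin

text \<open>The normal form opposite to that of \<open>path_op\<close>: second-direction edges stand
  in front and act on \<open>L\<close>, so the operators \<open>W\<close> are needed only on
  \<open>K\<close>.\<close>

definition path_vec :: "'l \<Rightarrow> 'k \<Rightarrow> 'c" where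
  "path_vec = edge_extension G 2 W' (\<lambda>p k. J (path_op p k))"

lemma path_vec_cmp2:
  "x \<in> edges G 2 \<Longrightarrow> q \<in> paths G \<Longrightarrow> src G x = rng G q \<Longrightarrow> path_vec (cmp G x q) k = W' x (path_vec q k)"
  by (simp add: path_vec_def edge_extension_cmp)

lemma path_vec_no2: "shape G p $ 2 = 0 \<Longrightarrow> path_vec p k = J (path_op p k)"
  by (simp add: path_vec_def edge_extension_base)

lemma path_vec_in: "p \<in> paths G \<Longrightarrow> k \<in> K \<Longrightarrow> path_vec p k \<in> L"
proof (induction p rule: direction_induct[where i = 2])
  case (base p)
  then show ?case by (simp add: path_vec_no2 D.J_in path_op_in)
next
  case (step x q)
  then show ?case by (simp add: path_vec_cmp2 D.W_in)
qed

lemma P_path_vec: "p \<in> paths G \<Longrightarrow> k \<in> K \<Longrightarrow> P (path_vec p k) = path_op p k"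
proof (induction p rule: direction_induct[where i = 2])
  case (base p)
  then show ?case by (simp add: path_vec_no2 D.P_J)
next
  case (step x q)
  then show ?case by (simp add: path_vec_cmp2 D.P_W path_op_cmp2)
qed

lemma R'_J: "a \<in> vertices G \<Longrightarrow> R' a (J h) = J (R a h)"
  by (rule cinner_eqI)
    (simp add: vertex_projections_adjoint[OF D.R] vertex_projections_adjoint[OF R] D.J_P D.P_R)

lemma path_vec_rng: "p \<in> paths G \<Longrightarrow> k \<in> K \<Longrightarrow> R' (rng G p) (path_vec p k) = path_vec p k"
proof (induction p rule: direction_induct[where i = 2])
  case (base p)
  then show ?case by (simp add: path_vec_no2 R'_J rng_vertex path_op_rng)
next
  case (step x q)
  then show ?case
    by (simp add: path_vec_cmp2 rng_cmp edges_paths edge_mapsD(3)[OF D.W_edge])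
qed

lemma cinner_path_vec_J: "p \<in> paths G \<Longrightarrow> k \<in> K \<Longrightarrow> cinner (path_vec p k) (J h) = cinner (path_op p k) h"
  by (metis D.J_P P_path_vec cinner_commute)

text \<open>The factor without second-direction edges lies in the range of \<open>J\<close>, and its
  adjoint \<open>P\<close> compresses the other factor to \<open>path_op\<close>.\<close>

lemma cinner_path_vec_no2:
  assumes "p \<in> paths G" "k \<in> K" "q \<in> paths G" "k' \<in> K" "shape G p $ 2 = 0 \<or> shape G q $ 2 = 0"
  shows "cinner (path_vec p k) (path_vec q k') = cinner (path_op p k) (path_op q k')"
  using assms(5)
proof
  assume "shape G p $ 2 = 0"
  then show ?thesis using assms by (simp add: path_vec_no2[of p] D.J_P P_path_vec)
next
  assume "shape G q $ 2 = 0"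
  then show ?thesis using assms by (simp add: path_vec_no2[of q] cinner_path_vec_J)
qed

lemma cinner_path_vec_edge2:
  assumes x: "x \<in> edges G 2" "p \<in> paths G" "src G x = rng G p" "k \<in> K"
    and y: "y \<in> edges G 2" "q \<in> paths G" "src G y = rng G q" "k' \<in> K"
  shows "cinner (path_vec (cmp G x p) k) (path_vec (cmp G y q) k') =
    (if x = y then cinner (path_vec p k) (path_vec q k') else 0)"
proof -
  have "R' (src G x) (path_vec p k) = path_vec p k"
    using x(3) path_vec_rng[OF x(2,4)] by simp
  then show ?thesis
    unfolding path_vec_cmp2[OF x(1-3)] path_vec_cmp2[OF y(1-3)] isometric_edgesD(2)[OF D.W_iso x(1) y(1)]
    by (auto split: if_split)
qed

text \<open>Both factors start with edges of the first direction, which is not the one dilated by \<open>W'\<close>.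
  The squares move them past the edges of the second direction, down to the isometries \<open>W\<close>.\<close>

lemma cinner_path_vec_edge1:
  assumes "p \<in> paths G" "k \<in> K" "k' \<in> K"
    and "x \<in> edges G 1" "src G x = rng G p" "y \<in> edges G 1" "q \<in> paths G" "src G y = rng G q"
  shows "cinner (path_vec (cmp G x p) k) (path_vec (cmp G y q) k') =
    (if x = y then cinner (path_vec p k) (path_vec q k') else 0)"
proof -
  \<comment> \<open>The inner product can then be computed in \<open>K\<close>, where
    first-direction edges are isometric.\<close>
  have no2: "cinner (path_vec (cmp G x p) k) (path_vec (cmp G y q) k') =
      (if x = y then cinner (path_vec p k) (path_vec q k') else 0)"
    if "shape G p $ 2 = 0 \<or> shape G q $ 2 = 0" "p \<in> paths G" "x \<in> edges G 1" "src G x = rng G p"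
      "y \<in> edges G 1" "q \<in> paths G" "src G y = rng G q" for p q x y
  proof -
    have "cinner (path_vec (cmp G x p) k) (path_vec (cmp G y q) k') =
        cinner (path_op (cmp G x p) k) (path_op (cmp G y q) k')"
      using that assms(2,3)
      by (intro cinner_path_vec_no2) (simp_all add: cmp_in_paths edges_paths shape_edge_cmp)
    also have "\<dots> = (if x = y then cinner (path_op p k) (path_op q k') else 0)"
    proof -
      have "R (src G x) (path_op p k) = path_op p k"
        using that(4) path_op_rng[OF that(2) assms(2)] by simp
      then show ?thesis
        unfolding path_op_cmp1[OF that(3,2,4)] path_op_cmp1[OF that(5,6,7)]
          isometric_edgesD(2)[OF W_iso that(3,5)] by (auto split: if_split)
    qed
    finally show ?thesis
      using that assms(2,3) by (simp add: cinner_path_vec_no2)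
  qed
  show ?thesis
    using assms(1,4-)
  proof (induction p arbitrary: x y q rule: direction_induct[where i = 2])
    case (base p)
    then show ?case by (intro no2) auto
  next
    case (step g p)
    note gp = step(1-3) and IH = step(4) and x = step(5,6) and yq = step(7-9)
    show ?case
    proof (cases "shape G q $ 2 = 0")
      case True
      then show ?thesis
        using gp x yq by (intro no2) (simp_all add: cmp_in_paths edges_paths)
    next
      case False
      then obtain g2 q2 where q: "g2 \<in> edges G 2" "q2 \<in> paths G" "src G g2 = rng G q2" "q = cmp G g2 q2"
        using edge_factor_exists[OF yq(2)] by blast
      have move: "\<exists>h z. h \<in> edges G 2 \<and> z \<in> edges G 1 \<and> src G h = rng G z \<and> src G z = rng G p' \<and>
          cmp G x g = cmp G h z \<and> cmp G x (cmp G g p') = cmp G h (cmp G z p')"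
        if prem: "x \<in> edges G 1" "g \<in> edges G 2" "p' \<in> paths G" "src G g = rng G p'"
          "src G x = rng G (cmp G g p')" for x g p'
      proof -
        have xg: "src G x = rng G g"
          using prem by (simp add: rng_cmp edges_paths)
        obtain h z where hz: "h \<in> edges G 2" "z \<in> edges G 1" "src G h = rng G z" "cmp G x g = cmp G h z"
            "src G z = src G g"
          using square_exists[OF prem(1,2) xg] by metis
        have "cmp G x (cmp G g p') = cmp G (cmp G x g) p'"
          using prem xg by (simp add: cmp_assoc edges_paths)
        also have "\<dots> = cmp G h (cmp G z p')"
          using prem hz by (simp add: cmp_assoc edges_paths)
        finally show ?thesis using hz prem by metis
      qed
      obtain h z where hz: "h \<in> edges G 2" "z \<in> edges G 1" "src G h = rng G z" "src G z = rng G p"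
          "cmp G x g = cmp G h z" "cmp G x (cmp G g p) = cmp G h (cmp G z p)"
        using move[OF x(1) gp(1,2,3) x(2)] by blast
      obtain h2 z2 where hz2: "h2 \<in> edges G 2" "z2 \<in> edges G 1" "src G h2 = rng G z2" "src G z2 = rng G q2"
          "cmp G y g2 = cmp G h2 z2" "cmp G y (cmp G g2 q2) = cmp G h2 (cmp G z2 q2)"
        using move[OF yq(1) q(1-3)] yq(3) q(4) by blast
      have "cinner (path_vec (cmp G x (cmp G g p)) k) (path_vec (cmp G y q) k') =
          (if h = h2 then cinner (path_vec (cmp G z p) k) (path_vec (cmp G z2 q2) k') else 0)"
        unfolding q(4) hz(6) hz2(6) using hz hz2 gp q assms(2,3)
        by (intro cinner_path_vec_edge2) (simp_all add: cmp_in_paths rng_cmp edges_paths)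
      also have "\<dots> = (if h = h2 \<and> z = z2 then cinner (path_vec p k) (path_vec q2 k') else 0)"
        using IH[OF hz(2,4) hz2(2) q(2) hz2(4)] by auto
      \<comment> \<open>Both conditions say that the paths \<open>x g\<close> and
        \<open>y g2\<close> coincide, by uniqueness of each of their two factorisations.\<close>
      also have "(h = h2 \<and> z = z2) \<longleftrightarrow> (x = y \<and> g = g2)"
      proof -
        have xg: "src G x = rng G g" "src G y = rng G g2"
          using x(2) yq(3) gp q by (simp_all add: rng_cmp edges_paths)
        show ?thesis
          using cmp_cancel[OF _ _ hz(3) _ _ hz2(3)] cmp_cancel[OF _ _ xg(1) _ _ xg(2)] hz hz2 x(1) yq(1) gp(1) q(1)
          by (auto simp: edges_paths edges_shape)
      qed
      finally show ?thesis
        using gp q assms(2,3) by (simp add: q(4) cinner_path_vec_edge2)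
    qed
  qed
qed

lemma cinner_path_vec_edge:
  assumes "x \<in> edges G i" "p \<in> paths G" "src G x = rng G p" "k \<in> K"
    and "y \<in> edges G i" "q \<in> paths G" "src G y = rng G q" "k' \<in> K"
  shows "cinner (path_vec (cmp G x p) k) (path_vec (cmp G y q) k') =
    (if x = y then cinner (path_vec p k) (path_vec q k') else 0)"
proof (cases "i = 1")
  case False
  then have "i = 2" using exhaust_2 by blast
  then show ?thesis using assms by (intro cinner_path_vec_edge2) auto
qed (use assms cinner_path_vec_edge1[of p k k' x y q] in simp)

text \<open>Strip \<open>u\<close> edge by edge. Since \<open>v\<close> has the same shape, it can
  be written with a leading edge of the same direction. At the end two vertices remain, and distinct
  ones have orthogonal projections.\<close>

lemma cinner_path_vec_cmp:
  assumes "u \<in> paths G" and k: "k \<in> K" "k' \<in> K" and pq: "p \<in> paths G" "q \<in> paths G"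
    and "v \<in> paths G" "shape G v = shape G u" "src G u = rng G p" "src G v = rng G q"
  shows "cinner (path_vec (cmp G u p) k) (path_vec (cmp G v q) k') =
    (if u = v then cinner (path_vec p k) (path_vec q k') else 0)"
  using assms(1,6-)
proof (induction u arbitrary: v rule: path_induct)
  case (vertex a)
  then have v: "v \<in> vertices G" using vertex_if_shape_0 shape_vertex by simp
  have a: "rng G p = a" "rng G q = v"
    using vertex v by (simp_all add: src_of_vertex)
  have "cinner (path_vec p k) (path_vec q k') = 0" if "a \<noteq> v"
  proof -
    have "cinner (path_vec p k) (path_vec q k') = cinner (path_vec p k) (R' a (R' v (path_vec q k')))"
      using path_vec_rng[OF pq(1) k(1)] path_vec_rng[OF pq(2) k(2)] vertex(1) a
      by (metis vertex_projections_adjoint[OF D.R])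
    then show ?thesis
      using that by (simp add: vertex_projections_mult[OF D.R vertex(1) v])
  qed
  then show ?case
    using cmp_rng[OF pq(1)] cmp_rng[OF pq(2)] a by simp
next
  case (edge i x u)
  note x = edges_paths[OF edge(1)]
  have "shape G v $ i \<noteq> 0"
    using edge by (simp add: shape_edge_cmp)
  then obtain y w where v: "y \<in> edges G i" "w \<in> paths G" "src G y = rng G w" "v = cmp G y w"
    using edge_factor_exists[OF edge(5)] by blast
  note y = edges_paths[OF v(1)]
  have shape: "shape G w = shape G u"
    using edge(1,2,3,6) v by (simp add: shape_cmp x y edges_shape)
  have src: "src G u = rng G p" "src G w = rng G q"
    using edge v by (simp_all add: src_cmp x y)
  have "cmp G (cmp G x u) p = cmp G x (cmp G u p)" "cmp G v q = cmp G y (cmp G w q)"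
    using edge(2,3) v src pq by (simp_all add: cmp_assoc x y)
  then have "cinner (path_vec (cmp G (cmp G x u) p) k) (path_vec (cmp G v q) k') =
      (if x = y then cinner (path_vec (cmp G u p) k) (path_vec (cmp G w q) k') else 0)"
    using edge(1,2,3) v src pq k
    by (simp add: cinner_path_vec_edge cmp_in_paths rng_cmp)
  also have "\<dots> = (if x = y \<and> u = w then cinner (path_vec p k) (path_vec q k') else 0)"
    using edge.IH[OF v(2) shape src] by auto
  also have "(x = y \<and> u = w) \<longleftrightarrow> cmp G x u = v"
    using cmp_cancel[OF x edge(2,3) y v(2,3)] edge(1) v(1,4) by (auto simp: edges_shape)
  finally show ?case .
qed

end

section \<open>The vectors that span the dilation\<close>

text \<open>The vectors \<open>j h\<close> and \<open>w p h\<close> play the roles of \<open>J h\<close> and \<open>W p (J h)\<close>. Their inner products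
  determine the dilation.\<close>

locale dilation_vectors = rank2_graph G for G :: "('l, 2) rank_graph" +
  fixes H :: "'a::complex_inner set" and V A :: "'l \<Rightarrow> 'a \<Rightarrow> 'a"
    and L :: "'k::complex_inner set" and j :: "'a \<Rightarrow> 'k" and w :: "'l \<Rightarrow> 'a \<Rightarrow> 'k"
  assumes H: "hilbert_space H"
    and V_A: "\<And>p g h. p \<in> paths G \<Longrightarrow> cinner (V p g) h = cinner g (A p h)"
    and A_in: "\<And>p h. p \<in> paths G \<Longrightarrow> A p h \<in> H"
    and V_in: "\<And>p h. p \<in> paths G \<Longrightarrow> V p h \<in> H"
    and V_cmp: "\<And>p q h. p \<in> paths G \<Longrightarrow> q \<in> paths G \<Longrightarrow> src G p = rng G q \<Longrightarrow> V (cmp G p q) h = V p (V q h)"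
    and V_zero: "\<And>p q h. p \<in> paths G \<Longrightarrow> q \<in> paths G \<Longrightarrow> src G p \<noteq> rng G q \<Longrightarrow> V p (V q h) = 0"
    and L: "hilbert_space L" and j_lin: "clinear j" and j_in: "\<And>h. h \<in> H \<Longrightarrow> j h \<in> L"
    and j_iso: "\<And>g h. cinner (j g) (j h) = cinner g h"
    and w_in: "\<And>p h. p \<in> paths G \<Longrightarrow> h \<in> H \<Longrightarrow> w p h \<in> L"
    and w_j: "\<And>p g h. p \<in> paths G \<Longrightarrow> g \<in> H \<Longrightarrow> cinner (w p g) (j h) = cinner (V p g) h"
    and w_rng: "\<And>p g h. p \<in> paths G \<Longrightarrow> g \<in> H \<Longrightarrow> h \<in> H \<Longrightarrow> cinner (w (rng G p) g) (w p h) = cinner g (V p h)"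
    and w_cmp: "\<And>u v p q g h. u \<in> paths G \<Longrightarrow> v \<in> paths G \<Longrightarrow> p \<in> paths G \<Longrightarrow> q \<in> paths G \<Longrightarrow>
      shape G u = shape G v \<Longrightarrow> src G u = rng G p \<Longrightarrow> src G v = rng G q \<Longrightarrow> g \<in> H \<Longrightarrow> h \<in> H \<Longrightarrow>
      cinner (w (cmp G u p) g) (w (cmp G v q) h) = (if u = v then cinner (w p g) (w q h) else 0)"

lemma dilation_vectors_exist:
  fixes G :: "('l, 2) rank_graph" and H :: "'a::complex_inner set" and V A :: "'l \<Rightarrow> 'a \<Rightarrow> 'a"
  assumes G: "is_rank_graph G"
    and Q: "vertex_projections (vertices G) H V"
    and V_A: "\<And>p g h. p \<in> paths G \<Longrightarrow> cinner (V p g) h = cinner g (A p h)"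
    and V_in: "\<And>p h. p \<in> paths G \<Longrightarrow> V p h \<in> H" and A_in: "\<And>p h. p \<in> paths G \<Longrightarrow> A p h \<in> H"
    and row: "\<And>i. row_contraction H (edges G i) V A"
    and V_edge: "\<And>i. edge_maps (vertices G) (rng G) (src G) (edges G i) V V"
    and V_cmp: "\<And>p q h. p \<in> paths G \<Longrightarrow> q \<in> paths G \<Longrightarrow> src G p = rng G q \<Longrightarrow> V (cmp G p q) h = V p (V q h)"
    and V_zero: "\<And>p q h. p \<in> paths G \<Longrightarrow> q \<in> paths G \<Longrightarrow> src G p \<noteq> rng G q \<Longrightarrow> V p (V q h) = 0"
  shows "\<exists>(L :: ('l, ('l, 'a) edge_dilation_space) edge_dilation_space set) j w. dilation_vectors G H V A L j w"
proof -
  interpret rank2_graph G by standard (rule G)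
  \<comment> \<open>A commuting square is the same thing as a path with one edge in each direction;
    its two factorisations give the four sides.\<close>
  define M where "M = paths_of_shape G (axis 1 1 + axis 2 1 :: nat ^ 2)"
  have sq: "\<exists>x q. split_edge G i p = (x, q) \<and> x \<in> edges G i \<and> q \<in> edges G i' \<and> src G x = rng G q \<and>
      p = cmp G x q \<and> rng G p = rng G x \<and> src G p = src G q"
    if "p \<in> M" "i = 1 \<and> i' = 2 \<or> i = 2 \<and> i' = 1" for p i i'
  proof -
    have p: "p \<in> paths G" "shape G p = axis i 1 + axis i' 1"
      using that by (auto simp: M_def paths_of_shape_def add.commute)
    obtain x q where xq: "x \<in> paths G" "q \<in> paths G" "shape G x = axis i 1" "shape G q = axis i' 1"
        "src G x = rng G q" "p = cmp G x q"
      using factorisation_exists[OF p] by metis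
    then have "x \<in> edges G i" "q \<in> edges G i'" by (simp_all add: paths_of_shape_def)
    then show ?thesis
      using xq split_edge_cmp[OF _ xq(2)] rng_cmp src_cmp by auto
  qed
  define f where "f p = fst (split_edge G 2 p)" for p
  define e where "e p = snd (split_edge G 2 p)" for p
  define e' where "e' p = fst (split_edge G 1 p)" for p
  define f' where "f' p = snd (split_edge G 1 p)" for p
  have fe: "f p \<in> edges G 2 \<and> e p \<in> edges G 1 \<and> src G (f p) = rng G (e p) \<and> p = cmp G (f p) (e p) \<and>
      rng G p = rng G (f p) \<and> src G p = src G (e p)" if "p \<in> M" for p
    using sq[OF that, of 2 1] by (auto simp: f_def e_def)
  have ef: "e' p \<in> edges G 1 \<and> f' p \<in> edges G 2 \<and> src G (e' p) = rng G (f' p) \<and> p = cmp G (e' p) (f' p) \<and>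
      rng G p = rng G (e' p) \<and> src G p = src G (f' p)" if "p \<in> M" for p
    using sq[OF that, of 1 2] by (auto simp: e'_def f'_def)
  have V_sq: "V (f p) (V (e p) h) = V (e' p) (V (f' p) h)" if "p \<in> M" for p h
    using V_cmp[of "f p" "e p" h] V_cmp[of "e' p" "f' p" h] fe[OF that] ef[OF that]
    by (auto simp: edges_paths)
  obtain K :: "('l, 'a) edge_dilation_space set" and R W J P \<tau> where
    "edge_dilation (vertices G) (rng G) (src G) (edges G 1) H V V K R W J P \<tau>"
    using edge_dilation_exists[OF Q row[of 1] V_edge[of 1] rng_of_vertex] by blast
  then interpret K: edge_dilation "vertices G" "rng G" "src G" "edges G 1" H V V K R W J P \<tau> .
  interpret lift: edge_lift H K "vertices G" "edges G 1" "rng G" "src G" V V R W J P \<tau> "edges G 2" A M f e e' f'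
  proof
    show "f p \<in> edges G 2 \<and> e p \<in> edges G 1 \<and> e' p \<in> edges G 1 \<and> f' p \<in> edges G 2 \<and>
        src G (f p) = rng G (e p) \<and> src G (e' p) = rng G (f' p) \<and> src G (e p) = src G (f' p) \<and>
        rng G (f p) = rng G (e' p)" if "p \<in> M" for p
      using fe[OF that] ef[OF that] by simp
    show "p = q" if "p \<in> M" "q \<in> M" "f p = f q" "e p = e q" for p q
      using fe[OF that(1)] fe[OF that(2)] that(3,4) by metis
    show "p = q" if "p \<in> M" "q \<in> M" "e' p = e' q" "f' p = f' q" for p q
      using ef[OF that(1)] ef[OF that(2)] that(3,4) by metis
  qed (use row V_edge V_sq in auto)
  obtain V' A' where V': "row_contraction K (edges G 2) V' A'"
    "edge_maps (vertices G) (rng G) (src G) (edges G 2) R V'"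
    "\<And>g k. g \<in> edges G 2 \<Longrightarrow> k \<in> K \<Longrightarrow> P (V' g k) = V g (P k)"
    "\<And>p k. p \<in> M \<Longrightarrow> k \<in> K \<Longrightarrow> V' (f p) (W (e p) k) = W (e' p) (V' (f' p) k)"
    by (rule lift.commuting_lift_exists) (rule that; assumption)
  have square: "V' g (W x k) = W x' (V' g' k)"
    if gx: "g \<in> edges G 2" "x \<in> edges G 1" "src G g = rng G x"
      "x' \<in> edges G 1" "g' \<in> edges G 2" "src G x' = rng G g'" "cmp G g x = cmp G x' g'" "k \<in> K" for g x g' x' k
  proof -
    define p where "p = cmp G g x"
    have p: "p \<in> M"
      using gx by (simp add: p_def M_def paths_of_shape_def cmp_in_paths shape_cmp add.commute)
    have "f p = g" "e p = x"
      using split_edge_cmp[OF gx(1) edges_paths[OF gx(2)] gx(3)] by (simp_all add: f_def e_def p_def)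
    moreover have "e' p = x'" "f' p = g'"
      using split_edge_cmp[OF gx(4) edges_paths[OF gx(5)] gx(6)] by (simp_all add: f'_def e'_def p_def gx(7))
    ultimately show ?thesis using V'(4)[OF p gx(8)] by simp
  qed
  \<comment> \<open>Only the lifted row \<open>V'\<close> is dilated here; the isometries
    \<open>W\<close> of the first direction remain on \<open>K\<close>.\<close>
  obtain L :: "('l, ('l, 'a) edge_dilation_space) edge_dilation_space set" and R2 W2 J2 P2 \<tau>2 where
    "edge_dilation (vertices G) (rng G) (src G) (edges G 2) K R V' L R2 W2 J2 P2 \<tau>2"
    using edge_dilation_exists[OF K.R V'(1,2) rng_of_vertex] by blast
  then interpret L: edge_dilation "vertices G" "rng G" "src G" "edges G 2" K R V' L R2 W2 J2 P2 \<tau>2 .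
  interpret v: path_vectors G K R W V' L R2 W2 J2 P2 \<tau>2
    by unfold_locales
      (use K.R K.W_edge K.W_in K.W_iso V'(2) row_contraction_in[OF V'(1)] square in auto)
  have P_U: "P (v.path_op p k) = V p (P k)" if "p \<in> paths G" "k \<in> K" for p k
    using that(1)
  proof (induction p rule: path_induct)
    case (vertex a)
    then show ?case by (simp add: v.path_op_vertex K.P_R)
  next
    case (edge i x q)
    moreover have "i = 1 \<or> i = 2" by (rule exhaust_2)
    ultimately show ?case
      using that(2) by (auto simp: v.path_op_cmp_edge K.P_W V'(3) v.path_op_in V_cmp edges_paths)
  qed
  define j where "j h = J2 (J h)" for h
  define w where "w p h = v.path_vec p (J h)" for p h
  have PJ_adj: "cinner (P k) h = cinner k (J h)" for k h
    by (metis K.J_P cinner_commute)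
  have "dilation_vectors G H V A L j w"
  proof
    show "hilbert_space H" "hilbert_space L"
      using Q L.R by (auto intro: vertex_projections_hilbert)
    show "clinear j" unfolding j_def by (intro clinear_comp[OF L.J_lin K.J_lin])
    show "j h \<in> L" if "h \<in> H" for h by (simp add: j_def L.J_in K.J_in that)
    show "cinner (j g) (j h) = cinner g h" for g h by (simp add: j_def L.J_P L.P_J K.J_P K.P_J)
    show "w p h \<in> L" if "p \<in> paths G" "h \<in> H" for p h
      unfolding w_def by (rule v.path_vec_in[OF that(1) K.J_in[OF that(2)]])
    show "cinner (w p g) (j h) = cinner (V p g) h" if "p \<in> paths G" "g \<in> H" for p g h
      using that by (simp add: w_def j_def v.cinner_path_vec_J K.J_in P_U K.P_J flip: PJ_adj)
    show "cinner (w (rng G p) g) (w p h) = cinner g (V p h)" if "p \<in> paths G" "g \<in> H" "h \<in> H" for p g h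
    proof -
      note r = rng_vertex[OF that(1)]
      have shape: "shape G (rng G p) $ 2 = 0"
        using shape_vertex[OF r] by simp
      have "cinner (w (rng G p) g) (w p h) = cinner (v.path_op (rng G p) (J g)) (v.path_op p (J h))"
        unfolding w_def
        by (rule v.cinner_path_vec_no2[OF vertex_in_paths[OF r] K.J_in[OF that(2)] that(1) K.J_in[OF that(3)]
              disjI1[OF shape]])
      also have "\<dots> = cinner (J g) (v.path_op p (J h))"
        using r that by (simp add: v.path_op_vertex vertex_projections_adjoint[OF K.R] v.path_op_rng K.J_in)
      finally show ?thesis
        using that by (simp add: K.J_P P_U K.J_in K.P_J)
    qed
    show "cinner (w (cmp G u p) g) (w (cmp G v q) h) = (if u = v then cinner (w p g) (w q h) else 0)"
      if "u \<in> paths G" "v \<in> paths G" "p \<in> paths G" "q \<in> paths G" "shape G u = shape G v"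
        "src G u = rng G p" "src G v = rng G q" "g \<in> H" "h \<in> H" for u v p q g h
      unfolding w_def
      by (rule v.cinner_path_vec_cmp[OF that(1) K.J_in[OF that(8)] K.J_in[OF that(9)] that(3,4,2) that(5)[symmetric] that(6,7)])
  qed (use V_A V_in A_in V_cmp V_zero in auto)
  then show ?thesis by blast
qed

text \<open>An \<open>edge_dilation_space\<close> nests sums indexed by \<open>'l list\<close>,
  \<open>nat\<close> and \<open>'l option\<close>. All three embed into \<open>'l list\<close>, a
  number as a constant list of that length, so three flattenings lead back to
  \<open>'l list\<close>.\<close>

lemma edge_dilation_flatten:
  fixes \<phi> :: "'x::complex_inner \<Rightarrow> ('l list, 'h::complex_inner) ell2"
  assumes "clinear \<phi>" "\<And>x y. cinner (\<phi> x) (\<phi> y) = cinner x y"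
  obtains \<Phi> :: "('l, 'x) edge_dilation_space \<Rightarrow> ('l list, 'h) ell2"
  where "clinear \<Phi>" "\<And>x y. cinner (\<Phi> x) (\<Phi> y) = cinner x y"
proof -
  have "inj (\<lambda>n. replicate n (undefined :: 'l))"
    by (metis injI length_replicate)
  then obtain \<iota>1 :: "nat \<times> 'l list \<Rightarrow> 'l list" where 1: "inj \<iota>1"
    using inj_pair_list by metis
  have "inj (case_option [] (\<lambda>x. [x :: 'l]))"
    by (auto simp: inj_def split: option.splits)
  then obtain \<iota>2 :: "'l option \<times> 'l list \<Rightarrow> 'l list" where 2: "inj \<iota>2"
    using inj_pair_list by metis
  obtain \<iota>3 :: "'l list \<times> 'l list \<Rightarrow> 'l list" where 3: "inj \<iota>3"
    using inj_pair_list[of] by (metis inj_on_id)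
  obtain \<Phi>1 :: "('l option, 'x) ell2 \<Rightarrow> ('l list, 'h) ell2"
    where \<Phi>1: "clinear \<Phi>1" "\<And>x y. cinner (\<Phi>1 x) (\<Phi>1 y) = cinner x y"
    using ell2_flatten[OF assms 2] by metis
  obtain \<Phi>2 :: "(nat, ('l option, 'x) ell2) ell2 \<Rightarrow> ('l list, 'h) ell2"
    where \<Phi>2: "clinear \<Phi>2" "\<And>x y. cinner (\<Phi>2 x) (\<Phi>2 y) = cinner x y"
    using ell2_flatten[OF \<Phi>1 1] by metis
  show thesis
    using ell2_flatten[OF \<Phi>2 3] that by metis
qed

lemma hilbert_space_isometric_image:
  assumes L: "hilbert_space L" and \<Phi>: "clinear \<Phi>" "\<And>x y. cinner (\<Phi> x) (\<Phi> y) = cinner x y"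
  shows "hilbert_space (\<Phi> ` L)"
  unfolding hilbert_space_def
proof
  have norm: "norm (\<Phi> x) = norm x" for x
    by (rule norm_cinner_preserving) (rule \<Phi>(2))
  show "complete (\<Phi> ` L)"
  proof (rule complete_isometric_image[of 1])
    show "subspace L"
      unfolding subspace_def
      using hilbert_space_0[OF L] hilbert_space_add[OF L] hilbert_space_scaleC[OF L] by (auto simp: scaleR_scaleC)
    show "bounded_linear \<Phi>"
      by (rule clinear_bounded_linear[OF \<Phi>(1), of 1]) (simp add: norm)
  qed (use norm hilbert_space_complete[OF L] in auto)
  show "csubspace (\<Phi> ` L)"
    unfolding complex_vector.subspace_def
  proof (intro conjI ballI allI)
    show "0 \<in> \<Phi> ` L"
      using hilbert_space_0[OF L] clinear_zero[OF \<Phi>(1)] by (metis imageI)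
    show "x + y \<in> \<Phi> ` L" if "x \<in> \<Phi> ` L" "y \<in> \<Phi> ` L" for x y
      using that hilbert_space_add[OF L] by (auto simp flip: clinear_add[OF \<Phi>(1)])
    show "c *\<^sub>C x \<in> \<Phi> ` L" if "x \<in> \<Phi> ` L" for c x
      using that hilbert_space_scaleC[OF L] by (auto simp flip: clinear_scaleC[OF \<Phi>(1)])
  qed
qed

section \<open>Sums of vertex projections\<close>

lemma has_sum_in_closed:
  fixes f :: "'i \<Rightarrow> 'a::real_normed_vector"
  assumes "(f has_sum s) I" "closed C" "\<And>F. finite F \<Longrightarrow> F \<subseteq> I \<Longrightarrow> sum f F \<in> C"
  shows "s \<in> C"
proof (rule Lim_in_closed_set[OF assms(2)])
  show "\<forall>\<^sub>F F in finite_subsets_at_top I. sum f F \<in> C"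
    using assms(3) by (intro eventually_finite_subsets_at_top_weakI)
  show "(sum f \<longlongrightarrow> s) (finite_subsets_at_top I)"
    using assms(1) by (simp add: has_sum_def)
qed simp

text \<open>Orthogonal projections form a row contraction, so their strong sum exists and is
  contractive. It fixes every vector of \<open>S\<close>, hence the closed span.\<close>

lemma vertex_projections_has_sum:
  fixes S :: "'a::complex_inner set"
  assumes Q: "vertex_projections Vt K Q" and Q_in: "\<And>a x. a \<in> Vt \<Longrightarrow> Q a x \<in> K"
    and S: "\<And>g. g \<in> S \<Longrightarrow> \<exists>a\<in>Vt. Q a g = g" and x: "x \<in> closure (cspan S)"
  shows "((\<lambda>a. Q a x) has_sum x) Vt"
proof -
  have "row_contraction K Vt Q Q"
    unfolding row_contraction_def
  proof (intro conjI ballI allI impI)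
    fix F k assume F: "finite F" "F \<subseteq> Vt"
    have "(norm (\<Sum>a\<in>F. Q a (k a)))\<^sup>2 = (\<Sum>a\<in>F. (norm (Q a (k a)))\<^sup>2)"
      using F by (intro norm_sq_sum_orthogonal)
        (auto simp: vertex_projections_adjoint[OF Q] vertex_projections_mult[OF Q] subset_iff)
    also have "\<dots> \<le> (\<Sum>a\<in>F. (norm (k a))\<^sup>2)"
      using F by (intro sum_mono power_mono vertex_projections_norm[OF Q]) auto
    finally show "(norm (\<Sum>a\<in>F. Q a (k a)))\<^sup>2 \<le> (\<Sum>a\<in>F. (norm (k a))\<^sup>2)" .
  qed (use Q Q_in in \<open>auto simp: vertex_projections_def\<close>)
  then obtain T where T: "clinear T" "\<And>h. norm (T h) \<le> norm h" "\<And>h. ((\<lambda>a. Q a (Q a h)) has_sum T h) Vt"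
    using row_contraction_has_sum by metis
  have T_sum: "((\<lambda>a. Q a h) has_sum T h) Vt" for h
    using T(3)[of h] by (rule has_sum_cong[THEN iffD1, rotated]) (simp add: vertex_projections_mult[OF Q])
  have "T g = g" if g: "g \<in> S" for g
  proof -
    obtain a where a: "a \<in> Vt" "Q a g = g" using S[OF g] by blast
    have "Q b g = (if b = a then g else 0)" if "b \<in> Vt" for b
      using vertex_projections_mult[OF Q that a(1), of g] a(2) by auto
    then have "((\<lambda>b. Q b g) has_sum g) Vt \<longleftrightarrow> ((\<lambda>b. g) has_sum g) {a}"
      using a(1) by (intro has_sum_cong_neutral) auto
    then have "((\<lambda>b. Q b g) has_sum g) Vt"
      using has_sum_finite[of "{a}" "\<lambda>_. g"] by simp
    then show ?thesis using T_sum has_sum_unique by blast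
  qed
  then have "T x = x"
    by (intro clinear_eq_on_closure_cspan[of T "\<lambda>x. x" 1 1 S, OF T(1) _ _ _ _ x])
      (simp_all add: clinear_def T(2))
  then show ?thesis using T_sum[of x] by simp
qed

lemma vertex_projections_of_orthogonal:
  assumes H: "hilbert_space H" and proj: "\<And>a. a \<in> Vt \<Longrightarrow> orthogonal_projection H (V a)"
    and orth: "\<And>a b x. a \<in> Vt \<Longrightarrow> b \<in> Vt \<Longrightarrow> a \<noteq> b \<Longrightarrow> x \<in> H \<Longrightarrow> V a (V b x) = 0"
  shows "vertex_projections Vt H (\<lambda>a x. V a (cproj H x))"
  unfolding vertex_projections_def
proof (intro conjI ballI allI)
  note b = proj[unfolded orthogonal_projection_def, THEN conjunct1]
  have V_in: "V a (cproj H x) \<in> H" if "a \<in> Vt" for a x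
    using bounded_operator_total(4)[OF H b[OF that]] .
  show "cinner (V a (cproj H g)) h = cinner g (V a (cproj H h))" if a: "a \<in> Vt" for a g h
  proof -
    have "cinner (V a (cproj H g)) h = cinner (V a (cproj H g)) (cproj H h)"
      using cproj_adjoint[OF H, of "V a (cproj H g)" h] by (simp add: cproj_id[OF H V_in[OF a]])
    also have "\<dots> = cinner (cproj H g) (adjoint_op H (V a) (cproj H h))"
      by (rule cinner_adjoint_op[OF H b[OF a]]) (rule cproj_in[OF H])+
    also have "\<dots> = cinner (cproj H g) (V a (cproj H h))"
      using proj[OF a] cproj_in[OF H, of h] by (simp add: orthogonal_projection_def)
    finally show ?thesis
      by (simp add: cinner_cproj[OF H V_in[OF a]])
  qed
  show "V a (cproj H (V b (cproj H h))) = (if a = b then V a (cproj H h) else 0)"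
    if "a \<in> Vt" "b \<in> Vt" for a b h
    using that orth[OF that] proj[OF that(1)] cproj_in[OF H, of h]
    by (cases "a = b") (simp_all add: cproj_id[OF H V_in] orthogonal_projection_def)
qed (use H bounded_operator_total(4)[OF H] proj in \<open>auto simp: orthogonal_projection_def\<close>)

section \<open>The dilation\<close>

context dilation_vectors
begin

definition gens :: "'k set" where
  "gens = j ` H \<union> (\<Union>p\<in>paths G. w p ` H)"

definition K :: "'k set" where
  "K = closure (cspan gens)"

lemma gens_cases:
  assumes "x \<in> gens"
  obtains h where "h \<in> H" "x = j h" | q h where "q \<in> paths G" "h \<in> H" "x = w q h"
  using assms by (auto simp: gens_def)

lemma gens_in_K: "gens \<subseteq> K"
  unfolding K_def using complex_vector.span_superset closure_subset by blast

lemma j_in_K: "h \<in> H \<Longrightarrow> j h \<in> K" and w_in_K: "p \<in> paths G \<Longrightarrow> h \<in> H \<Longrightarrow> w p h \<in> K"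
  using gens_in_K by (auto simp: gens_def)

lemma K: "hilbert_space K"
proof -
  have "gens \<subseteq> L"
    using j_in w_in by (auto simp: gens_def)
  then have "cspan gens \<subseteq> L"
    by (rule complex_vector.span_minimal) (rule hilbert_space_csubspace[OF L])
  then have "K \<subseteq> L"
    unfolding K_def by (rule closure_minimal) (rule complete_imp_closed[OF hilbert_space_complete[OF L]])
  then have "complete K"
    using complete_Int_closed[OF hilbert_space_complete[OF L], of K]
    by (simp add: K_def Int_absorb1)
  then show ?thesis
    unfolding hilbert_space_def using csubspace_closure[OF complex_vector.subspace_span] by (simp add: K_def)
qed

text \<open>Prescribed on composable \<open>w q h\<close> and zero on the complement of their span.
  The second condition fixes the value at \<open>j h\<close>, which is not prescribed.\<close>

definition W :: "'l \<Rightarrow> 'k \<Rightarrow> 'k" where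
  "W p = (SOME y. clinear y \<and> (\<forall>v. y v \<in> K) \<and>
    (\<forall>q\<in>paths G. \<forall>h\<in>H. src G p = rng G q \<longrightarrow> y (w q h) = w (cmp G p q) h) \<and>
    (\<forall>v. norm (y v) \<le> norm v) \<and>
    (\<forall>v. (\<forall>q\<in>paths G. \<forall>h\<in>H. src G p = rng G q \<longrightarrow> cinner v (w q h) = 0) \<longrightarrow> y v = 0))"

context
  fixes p assumes p: "p \<in> paths G"
begin

lemma W_props:
  "clinear (W p) \<and> (\<forall>v. W p v \<in> K) \<and>
    (\<forall>q\<in>paths G. \<forall>h\<in>H. src G p = rng G q \<longrightarrow> W p (w q h) = w (cmp G p q) h) \<and>
    (\<forall>v. norm (W p v) \<le> norm v) \<and>
    (\<forall>v. (\<forall>q\<in>paths G. \<forall>h\<in>H. src G p = rng G q \<longrightarrow> cinner v (w q h) = 0) \<longrightarrow> W p v = 0)"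
proof -
  define S where "S = {(w q h, w (cmp G p q) h) |q h. q \<in> paths G \<and> h \<in> H \<and> src G p = rng G q}"
  have iso: "cinner l l' = cinner m m'" if "(m, l) \<in> S" "(m', l') \<in> S" for m l m' l'
    using that w_cmp p by (auto simp: S_def)
  have S_in: "l \<in> K" if "(m, l) \<in> S" for m l
    using that w_in_K p by (auto simp: S_def cmp_in_paths)
  obtain y where y: "clinear y" "\<And>v. y v \<in> K" "\<And>m l. (m, l) \<in> S \<Longrightarrow> y m = l"
    "\<And>v. norm (y v) \<le> norm v" "\<And>v. (\<And>m l. (m, l) \<in> S \<Longrightarrow> cinner v m = 0) \<Longrightarrow> y v = 0"
  proof (rule isometric_extension[OF iso S_in K])
    fix y :: "'k \<Rightarrow> 'k"
    assume y: "clinear y" "\<And>v. y v \<in> K" "\<And>m l. (m, l) \<in> S \<Longrightarrow> y m = l"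
      "\<And>v. norm (y v) \<le> norm v" "\<And>v. (\<And>m l. (m, l) \<in> S \<Longrightarrow> cinner v m = 0) \<Longrightarrow> y v = 0"
    show thesis by (rule that[OF y])
  qed
  have "\<exists>y. clinear y \<and> (\<forall>v. y v \<in> K) \<and>
    (\<forall>q\<in>paths G. \<forall>h\<in>H. src G p = rng G q \<longrightarrow> y (w q h) = w (cmp G p q) h) \<and>
    (\<forall>v. norm (y v) \<le> norm v) \<and>
    (\<forall>v. (\<forall>q\<in>paths G. \<forall>h\<in>H. src G p = rng G q \<longrightarrow> cinner v (w q h) = 0) \<longrightarrow> y v = 0)"
  proof (intro exI[of _ y] conjI allI ballI impI)
    show "y (w q h) = w (cmp G p q) h" if "q \<in> paths G" "h \<in> H" "src G p = rng G q" for q h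
      using that by (intro y(3)) (auto simp: S_def)
    show "y v = 0" if "\<forall>q\<in>paths G. \<forall>h\<in>H. src G p = rng G q \<longrightarrow> cinner v (w q h) = 0" for v
      using that by (intro y(5)) (auto simp: S_def)
  qed (use y(1,2,4) in auto)
  then show ?thesis
    unfolding W_def by (rule someI_ex)
qed

lemma W_lin: "clinear (W p)"
  and W_in: "W p v \<in> K"
  and W_w: "q \<in> paths G \<Longrightarrow> h \<in> H \<Longrightarrow> src G p = rng G q \<Longrightarrow> W p (w q h) = w (cmp G p q) h"
  and W_norm: "norm (W p v) \<le> norm v"
  and W_complement:
    "(\<And>q h. q \<in> paths G \<Longrightarrow> h \<in> H \<Longrightarrow> src G p = rng G q \<Longrightarrow> cinner v (w q h) = 0) \<Longrightarrow> W p v = 0"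
  using W_props by auto

end

text \<open>Insert the range vertices in front of both paths; they have the same shape, so
  \<open>w_cmp\<close> applies.\<close>

lemma w_orthogonal:
  assumes "p \<in> paths G" "q \<in> paths G" "rng G p \<noteq> rng G q" "g \<in> H" "h \<in> H"
  shows "cinner (w p g) (w q h) = 0"
  using w_cmp[of "rng G p" "rng G q" p q g h] assms rng_vertex vertex_in_paths
  by (simp add: shape_vertex src_of_vertex cmp_rng)

lemma W_w_zero:
  assumes "p \<in> paths G" "q \<in> paths G" "h \<in> H" "src G p \<noteq> rng G q"
  shows "W p (w q h) = 0"
  by (rule W_complement[OF assms(1)]) (use assms in \<open>auto intro!: w_orthogonal\<close>)

text \<open>\<open>j h\<close> and \<open>w (src G p) h\<close> have the same inner product
  \<open>cinner h (V q g)\<close> with every composable \<open>w q g\<close>, so \<open>W p\<close>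
  kills their difference.\<close>

lemma W_j:
  assumes "p \<in> paths G" "h \<in> H"
  shows "W p (j h) = w p h"
proof -
  note a = src_vertex[OF assms(1)]
  note a' = vertex_in_paths[OF a]
  have "W p (j h - w (src G p) h) = 0"
  proof (rule W_complement[OF assms(1)])
    fix q g assume q: "q \<in> paths G" "g \<in> H" "src G p = rng G q"
    have "cinner (j h) (w q g) = cinner h (V q g)"
      using w_j[OF q(1,2), of h] by (metis cinner_commute)
    then show "cinner (j h - w (src G p) h) (w q g) = 0"
      using w_rng[OF q(1) assms(2) q(2)] by (simp add: cinner_diff_left q(3))
  qed
  then have "W p (j h) = W p (w (src G p) h)"
    by (simp add: clinear_diff[OF W_lin[OF assms(1)]])
  also have "\<dots> = w p h"
    using assms a a' by (simp add: W_w rng_of_vertex cmp_src)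
  finally show ?thesis .
qed

lemma eq_on_K:
  assumes "clinear S" "clinear T" "\<And>x. norm (S x) \<le> norm x" "\<And>x. norm (T x) \<le> norm x"
    and "\<And>h. h \<in> H \<Longrightarrow> S (j h) = T (j h)" "\<And>q h. q \<in> paths G \<Longrightarrow> h \<in> H \<Longrightarrow> S (w q h) = T (w q h)"
    and "x \<in> K"
  shows "S x = T x"
  using assms(7) unfolding K_def
  by (rule clinear_eq_on_closure_cspan[OF assms(1,2), of 1 1, rotated -1])
    (use assms(3-6) in \<open>auto elim!: gens_cases\<close>)

lemma W_cmp:
  assumes p: "p \<in> paths G" and q: "q \<in> paths G" and pq: "src G p = rng G q" and x: "x \<in> K"
  shows "W p (W q x) = W (cmp G p q) x"
proof (rule eq_on_K[OF _ _ _ _ _ _ x])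
  note c = cmp_in_paths[OF p q pq]
  show "clinear (\<lambda>x. W p (W q x))" "clinear (W (cmp G p q))"
    using clinear_comp[OF W_lin[OF p] W_lin[OF q]] W_lin[OF c] by auto
  show "norm (W p (W q x)) \<le> norm x" "norm (W (cmp G p q) x) \<le> norm x" for x
    using W_norm[OF p, of "W q x"] W_norm[OF q, of x] W_norm[OF c, of x] by auto
  show "W p (W q (j h)) = W (cmp G p q) (j h)" if "h \<in> H" for h
    using that p q pq by (simp add: W_j c W_w)
  show "W p (W q (w u h)) = W (cmp G p q) (w u h)" if u: "u \<in> paths G" "h \<in> H" for u h
  proof (cases "src G q = rng G u")
    case True
    then show ?thesis
      using u p q pq c by (simp add: W_w cmp_in_paths rng_cmp src_cmp cmp_assoc)
  next
    case False
    then show ?thesis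
      using u p q pq c by (simp add: W_w_zero src_cmp clinear_zero[OF W_lin])
  qed
qed

lemma W_zero:
  assumes p: "p \<in> paths G" and q: "q \<in> paths G" and pq: "src G p \<noteq> rng G q" and x: "x \<in> K"
  shows "W p (W q x) = 0"
proof -
  have "(\<lambda>x. W p (W q x)) x = (\<lambda>x. 0) x"
  proof (rule eq_on_K[OF _ _ _ _ _ _ x])
    show "clinear (\<lambda>x. W p (W q x))" "clinear (\<lambda>x. 0 :: 'k)"
      using clinear_comp[OF W_lin[OF p] W_lin[OF q]] by (auto simp: clinear_def)
    show "norm (W p (W q x)) \<le> norm x" "norm (0::'k) \<le> norm x" for x :: 'k
      using W_norm[OF p, of "W q x"] W_norm[OF q, of x] by auto
    show "W p (W q (j h)) = 0" if "h \<in> H" for h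
      using that p q pq by (simp add: W_j W_w_zero)
    show "W p (W q (w u h)) = 0" if u: "u \<in> paths G" "h \<in> H" for u h
      using u p q pq
      by (cases "src G q = rng G u")
        (simp_all add: W_w W_w_zero cmp_in_paths rng_cmp clinear_zero[OF W_lin])
  qed
  then show ?thesis by simp
qed

lemma cinner_eq_on_K:
  assumes S: "clinear S" "clinear S'" "clinear T" "clinear T'"
    and norms: "\<And>x. norm (S x) \<le> norm x" "\<And>x. norm (S' x) \<le> norm x"
      "\<And>x. norm (T x) \<le> norm x" "\<And>x. norm (T' x) \<le> norm x"
    and eq: "\<And>x y. x \<in> gens \<Longrightarrow> y \<in> gens \<Longrightarrow> cinner (S x) (S' y) = c * cinner (T x) (T' y)"
    and x: "x \<in> K" and y: "y \<in> K"
  shows "cinner (S x) (S' y) = c * cinner (T x) (T' y)"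
proof -
  note bl = clinear_bounded_linear[where B = 1, simplified]
  have cont: "continuous_on UNIV S" "continuous_on UNIV S'" "continuous_on UNIV T" "continuous_on UNIV T'"
    using S norms by (auto intro!: linear_continuous_on bl)
  have *: "cinner (S x) (S' y) = c * cinner (T x) (T' y)" if y: "y \<in> gens" for y
    using x unfolding K_def
  proof (rule closure_cspan_induct)
    show "closed {x. cinner (S x) (S' y) = c * cinner (T x) (T' y)}"
      by (intro closed_Collect_eq continuous_intros cont)
  qed (use eq y in \<open>auto simp: clinear_zero S clinear_add clinear_scaleC cinner_add_left
      cinner_scaleC_left distrib_left\<close>)
  show ?thesis
    using y unfolding K_def
  proof (rule closure_cspan_induct)
    show "closed {y. cinner (S x) (S' y) = c * cinner (T x) (T' y)}"
      by (intro closed_Collect_eq continuous_intros cont)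
  qed (use * in \<open>auto simp: clinear_zero S clinear_add clinear_scaleC cinner_add_right
      cinner_scaleC_right distrib_left\<close>)
qed

lemma clinear_id: "clinear (\<lambda>x. x)"
  by (simp add: clinear_def)

lemma W_vertex_adjoint:
  assumes a: "a \<in> vertices G" and xy: "x \<in> K" "y \<in> K"
  shows "cinner (W a x) y = cinner x (W a y)"
proof -
  note a' = vertex_in_paths[OF a]
  have jw: "cinner (j g) (w q h) = cinner g (V q h)" if "q \<in> paths G" "h \<in> H" for q g h
    using w_j[OF that, of g] by (metis cinner_commute)
  have aw: "cinner (w a g) (w q h) = (if a = rng G q then cinner g (V q h) else 0)"
    if "q \<in> paths G" "g \<in> H" "h \<in> H" for q g h
    using w_rng[OF that(1,2,3)] w_orthogonal[of a q g h] that a' by (auto simp: rng_of_vertex[OF a])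
  have wa: "cinner (w q h) (w a g) = (if a = rng G q then cinner (V q h) g else 0)"
    if "q \<in> paths G" "g \<in> H" "h \<in> H" for q g h
    using aw[OF that] by (metis cinner_commute complex_cnj_zero)
  have Wa: "W a (w q h) = (if a = rng G q then w q h else 0)" if "q \<in> paths G" "h \<in> H" for q h
    using that a a' by (auto simp: W_w W_w_zero src_of_vertex cmp_rng)
  have Va: "cinner (V a g) h = cinner g (V a h)" if "g \<in> H" "h \<in> H" for g h
    using aw[OF a' that] wa[OF a' that(2,1)] by (simp add: rng_of_vertex[OF a])
  have "cinner (W a x) ((\<lambda>y. y) y) = 1 * cinner ((\<lambda>x. x) x) (W a y)"
  proof (rule cinner_eq_on_K[OF _ _ _ _ _ _ _ _ _ xy])
    fix x y assume "x \<in> gens" "y \<in> gens"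
    then show "cinner (W a x) y = 1 * cinner x (W a y)"
      by (elim gens_cases)
        (auto simp: W_j[OF a'] w_j[OF a'] jw[OF a'] Va Wa wa aw w_j jw clinear_zero w_orthogonal)
  qed (use W_lin[OF a'] W_norm[OF a'] clinear_id in auto)
  then show ?thesis by simp
qed

text \<open>Reduces both kinds of generators to one form: for \<open>j h\<close> the path
  \<open>q\<close> is the vertex \<open>src G p\<close>.\<close>

lemma gens_W_cases:
  assumes "x \<in> gens" "p \<in> paths G"
  obtains "W p x = 0" "W (src G p) x = 0"
  | q h where "q \<in> paths G" "h \<in> H" "src G p = rng G q" "W p x = w (cmp G p q) h" "W (src G p) x = w q h"
proof -
  note a = src_vertex[OF assms(2)]
  note a' = vertex_in_paths[OF a]
  from assms(1) show thesis
  proof (cases rule: gens_cases)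
    case (1 h)
    then show thesis
      using that(2)[of "src G p" h] assms(2) a a' by (simp add: W_j rng_of_vertex cmp_src)
  next
    case (2 q h)
    show thesis
    proof (cases "src G p = rng G q")
      case True
      then have "W (src G p) x = w q h"
        using 2 a a' by (simp add: W_w src_of_vertex cmp_rng rng_vertex vertex_in_paths)
      with True show thesis
        using that(2)[of q h] 2 assms(2) by (simp add: W_w)
    next
      case False
      then show thesis
        using that(1) 2 assms(2) a a' by (simp add: W_w_zero src_of_vertex)
    qed
  qed
qed

text \<open>On generators this is \<open>w_cmp\<close>. It holds both the isometry relation
  (\<open>p = q\<close>) and the orthogonality of ranges for different paths of one shape.\<close>

lemma cinner_W:
  assumes p: "p \<in> paths G" and q: "q \<in> paths G" "shape G p = shape G q" and xy: "x \<in> K" "y \<in> K"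
  shows "cinner (W p x) (W q y) = (if p = q then cinner (W (src G p) x) y else 0)"
proof -
  note a = src_vertex[OF p] src_vertex[OF q(1)]
  note a' = vertex_in_paths[OF a(1)] vertex_in_paths[OF a(2)]
  have "cinner (W p x) (W q y) = (if p = q then 1 else 0) * cinner (W (src G p) x) (W (src G q) y)"
  proof (rule cinner_eq_on_K[OF _ _ _ _ _ _ _ _ _ xy])
    fix x y assume "x \<in> gens" "y \<in> gens"
    then show "cinner (W p x) (W q y) = (if p = q then 1 else 0) * cinner (W (src G p) x) (W (src G q) y)"
      by (elim gens_W_cases[OF _ p] gens_W_cases[OF _ q(1)]) (use p q in \<open>simp_all add: w_cmp\<close>)
  qed (use W_lin W_norm p q a' in auto)
  also have "\<dots> = (if p = q then cinner (W (src G p) x) y else 0)"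
    using W_vertex_adjoint[OF a(1) W_in[OF a'(1)] xy(2), of x] W_cmp[OF a'(1) a'(1) _ xy(1)] a a'
      W_vertex_adjoint[OF a(1) xy(1) W_in[OF a'(1)]] W_vertex_adjoint[OF a(1) xy] W_cmp[OF a'(1) a'(1) _ xy(2)]
      cmp_rng[OF a'(1)]
    by (auto simp: src_of_vertex rng_of_vertex)
  finally show ?thesis .
qed

section \<open>Adjoints and range projections of the path operators\<close>

lemma W_cproj: "p \<in> paths G \<Longrightarrow> W p (cproj K x) = W p x"
proof -
  assume p: "p \<in> paths G"
  have "W p (x - cproj K x) = 0"
    by (rule W_complement[OF p]) (simp add: cinner_diff_left cinner_cproj[OF K w_in_K])
  then show ?thesis by (simp add: clinear_diff[OF W_lin[OF p]])
qed

definition Ad :: "'l \<Rightarrow> 'k \<Rightarrow> 'k" where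
  "Ad p = (SOME A. (\<forall>x y. cinner (W p x) y = cinner x (A y)) \<and> (\<forall>y. A y \<in> K))"

lemma
  assumes p: "p \<in> paths G"
  shows cinner_Ad: "cinner (W p x) y = cinner x (Ad p y)" and Ad_in: "Ad p y \<in> K"
proof -
  have "norm (W p x) \<le> 1 * norm x" for x
    using W_norm[OF p] by simp
  then obtain A where "\<And>x y. cinner (W p x) y = cinner x (A y)" "\<And>y. A y \<in> K"
    using total_adjoint_exists[OF K W_lin[OF p] _ W_cproj[OF p]] by metis
  then have "\<exists>A. (\<forall>x y. cinner (W p x) y = cinner x (A y)) \<and> (\<forall>y. A y \<in> K)"
    by blast
  then have "(\<forall>x y. cinner (W p x) y = cinner x (Ad p y)) \<and> (\<forall>y. Ad p y \<in> K)"
    unfolding Ad_def by (rule someI_ex)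
  then show "cinner (W p x) y = cinner x (Ad p y)" "Ad p y \<in> K" by auto
qed

lemma adjoint_op_W: "p \<in> paths G \<Longrightarrow> adjoint_op K (W p) y = Ad p y"
  by (rule adjoint_opI[OF K Ad_in]) (simp_all add: cinner_Ad)

lemma Ad_lin: "p \<in> paths G \<Longrightarrow> clinear (Ad p)"
  by (rule clinear_adjointI[of _ "W p"]) (metis cinner_Ad cinner_commute)

lemma bounded_operator_W: "p \<in> paths G \<Longrightarrow> bounded_operator K (W p)"
  unfolding bounded_operator_def
  using W_in W_norm W_lin by (auto simp: clinear_add clinear_scaleC intro!: exI[of _ 1])

lemma Ad_W: "p \<in> paths G \<Longrightarrow> x \<in> K \<Longrightarrow> Ad p (W p x) = W (src G p) x"
proof -
  assume p: "p \<in> paths G" and x: "x \<in> K"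
  note a = src_vertex[OF p] vertex_in_paths[OF src_vertex[OF p]]
  have "adjoint_op K (W p) (W p x) = W (src G p) x"
    by (rule adjoint_opI[OF K W_in[OF a(2)]])
      (simp add: cinner_W[OF p p] x W_vertex_adjoint[OF a(1)])
  then show ?thesis by (simp add: adjoint_op_W[OF p])
qed

text \<open>On generators the claim reduces to \<open>w_j\<close>: composable paths use
  multiplicativity of \<open>V\<close>, and for the others both sides vanish.\<close>

lemma Ad_j:
  assumes p: "p \<in> paths G" and h: "h \<in> H"
  shows "Ad p (j h) = j (A p h)"
proof -
  have "cinner (W p x) (j h) = cinner x (j (A p h))" if x: "x \<in> K" for x
    using x unfolding K_def
  proof (rule closure_cspan_induct)
    show "cinner (W p g) (j h) = cinner g (j (A p h))" if "g \<in> gens" for g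
      using that
    proof (cases rule: gens_cases)
      case (1 g')
      then show ?thesis using p by (simp add: W_j w_j V_A j_iso)
    next
      case (2 q g')
      then show ?thesis
      proof (cases "src G p = rng G q")
        case True
        then show ?thesis using 2 p by (simp add: W_w w_j cmp_in_paths V_cmp V_A)
      next
        case False
        have "cinner (V q g') (A p h) = 0"
          using V_A[OF p, of "V q g'" h] V_zero[OF p 2(1) False] by simp
        then show ?thesis using 2 p False by (simp add: W_w_zero w_j)
      qed
    qed
    show "closed {x. cinner (W p x) (j h) = cinner x (j (A p h))}"
      using clinear_bounded_linear[OF W_lin[OF p], of 1] W_norm[OF p]
      by (intro closed_Collect_eq continuous_intros linear_continuous_on) auto
  qed (simp_all add: clinear_zero W_lin p clinear_add clinear_scaleC cinner_add_left cinner_scaleC_left)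
  then have "adjoint_op K (W p) (j h) = j (A p h)"
    by (intro adjoint_opI[OF K j_in_K[OF A_in[OF p]]])
  then show ?thesis by (simp add: adjoint_op_W[OF p])
qed

lemma W_Ad_cinner: "p \<in> paths G \<Longrightarrow> cinner (W p (Ad p y)) y = complex_of_real ((norm (Ad p y))\<^sup>2)"
  by (simp add: cinner_Ad cinner_self)

lemma cinner_W_Ad:
  assumes p: "p \<in> paths G" "q \<in> paths G" "shape G p = shape G q"
  shows "cinner (W p (Ad p x)) (W q (Ad q y)) = (if p = q then cinner (Ad p x) (Ad p y) else 0)"
proof -
  note a = src_vertex[OF p(1)] vertex_in_paths[OF src_vertex[OF p(1)]]
  have "cinner (W (src G p) (Ad p x)) (Ad p y) = cinner (Ad p x) (Ad p y)"
  proof -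
    have "cinner (W (src G p) (Ad p x)) (Ad p y) = cinner (Ad p x) (W (src G p) (Ad p y))"
      by (rule W_vertex_adjoint[OF a(1) Ad_in[OF p(1)] Ad_in[OF p(1)]])
    also have "\<dots> = cinner (W p (W (src G p) (Ad p x))) y"
      using W_vertex_adjoint[OF a(1) Ad_in[OF p(1)] Ad_in[OF p(1)], of x y] by (simp add: cinner_Ad[OF p(1)])
    also have "\<dots> = cinner (W p (Ad p x)) y"
      using W_cmp[OF p(1) a(2) _ Ad_in[OF p(1)]] a by (simp add: rng_of_vertex cmp_src[OF p(1)])
    finally show ?thesis by (simp add: cinner_Ad[OF p(1)])
  qed
  then show ?thesis
    using cinner_W[OF p Ad_in[OF p(1)] Ad_in[OF p(2)]] by auto
qed

lemma norm_W_Ad: "p \<in> paths G \<Longrightarrow> norm (W p (Ad p x)) = norm (Ad p x)"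
  using cinner_W_Ad[of p p x x] by (simp add: cinner_self del: of_real_power)

lemma range_sum:
  assumes F: "finite F" "F \<subseteq> paths_of_shape G n"
  shows "cinner (\<Sum>p\<in>F. W p (Ad p x)) x = complex_of_real (\<Sum>p\<in>F. (norm (Ad p x))\<^sup>2)"
    and "(norm (\<Sum>p\<in>F. W p (Ad p x)))\<^sup>2 = (\<Sum>p\<in>F. (norm (Ad p x))\<^sup>2)"
proof -
  have F': "p \<in> paths G" "shape G p = n" if "p \<in> F" for p
    using F that by (auto simp: paths_of_shape_def)
  show "cinner (\<Sum>p\<in>F. W p (Ad p x)) x = complex_of_real (\<Sum>p\<in>F. (norm (Ad p x))\<^sup>2)"
    unfolding cinner_sum_left of_real_sum by (intro sum.cong refl W_Ad_cinner F')
  show "(norm (\<Sum>p\<in>F. W p (Ad p x)))\<^sup>2 = (\<Sum>p\<in>F. (norm (Ad p x))\<^sup>2)"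
    using F(1) F' by (subst norm_sq_sum_orthogonal) (auto simp: cinner_W_Ad norm_W_Ad)
qed

text \<open>The sum of the \<open>W p (Ad p x)\<close> is a vector whose squared norm equals its
  inner product with \<open>x\<close>, hence no longer than \<open>x\<close>; by orthogonality that
  squared norm is the left side.\<close>

lemma range_sum_le:
  assumes F: "finite F" "F \<subseteq> paths_of_shape G n"
  shows "(\<Sum>p\<in>F. (norm (Ad p x))\<^sup>2) \<le> (norm x)\<^sup>2"
proof -
  have "norm (\<Sum>p\<in>F. W p (Ad p x)) \<le> norm x"
  proof (rule norm_le_of_Re_cinner_le[of _ _ "\<Sum>p\<in>F. W p (Ad p x)"])
    have "cinner x (\<Sum>p\<in>F. W p (Ad p x)) = cnj (cinner (\<Sum>p\<in>F. W p (Ad p x)) x)"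
      by (rule cinner_commute)
    then show "(norm (\<Sum>p\<in>F. W p (Ad p x)))\<^sup>2 = Re (cinner x (\<Sum>p\<in>F. W p (Ad p x)))"
      by (simp add: range_sum[OF F] del: of_real_sum)
  qed simp
  then have "(norm (\<Sum>p\<in>F. W p (Ad p x)))\<^sup>2 \<le> (norm x)\<^sup>2"
    by (rule power_mono) simp
  then show ?thesis by (simp add: range_sum[OF F])
qed

end

text \<open>Converse of \<open>row_contraction_adjoint_sum\<close>. With \<open>y\<close> the sum,
  the squared norm of \<open>y\<close> is at most half of the right side plus half of itself, by the
  arithmetic-geometric inequality.\<close>

lemma row_bound_of_adjoint_bound:
  assumes adj: "\<And>x g h. x \<in> F \<Longrightarrow> cinner (V x g) h = cinner g (A x h)"
    and bound: "\<And>h. (\<Sum>x\<in>F. (norm (A x h))\<^sup>2) \<le> (norm h)\<^sup>2" and F: "finite F"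
  shows "(norm (\<Sum>x\<in>F. V x (k x)))\<^sup>2 \<le> (\<Sum>x\<in>F. (norm (k x))\<^sup>2)"
proof -
  define y where "y = (\<Sum>x\<in>F. V x (k x))"
  have "cinner y y = (\<Sum>x\<in>F. cinner (k x) (A x y))"
    by (subst y_def) (simp add: cinner_sum_left adj)
  then have "(norm y)\<^sup>2 = (\<Sum>x\<in>F. Re (cinner (k x) (A x y)))"
    by (simp add: norm_sq_cinner)
  also have "\<dots> \<le> (\<Sum>x\<in>F. (norm (k x))\<^sup>2 / 2 + (norm (A x y))\<^sup>2 / 2)"
  proof (rule sum_mono)
    fix x
    have "Re (cinner (k x) (A x y)) \<le> norm (k x) * norm (A x y)"
      using norm_cinner_le complex_Re_le_cmod order_trans by blast
    also have "\<dots> \<le> (norm (k x))\<^sup>2 / 2 + (norm (A x y))\<^sup>2 / 2"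
      using sum_squares_bound[of "norm (k x)" "norm (A x y)"] by simp
    finally show "Re (cinner (k x) (A x y)) \<le> (norm (k x))\<^sup>2 / 2 + (norm (A x y))\<^sup>2 / 2" .
  qed
  also have "\<dots> = (\<Sum>x\<in>F. (norm (k x))\<^sup>2) / 2 + (\<Sum>x\<in>F. (norm (A x y))\<^sup>2) / 2"
    by (simp add: sum.distrib sum_divide_distrib)
  finally show ?thesis
    using bound[of y] unfolding y_def by linarith
qed

context dilation_vectors
begin

section \<open>Toeplitz and contraction conditions\<close>

lemma W_rng: "p \<in> paths G \<Longrightarrow> x \<in> K \<Longrightarrow> W (rng G p) (W p x) = W p x"
  using W_cmp[of "rng G p" p x] rng_vertex[of p]
  by (simp add: vertex_in_paths src_of_vertex cmp_rng)

lemma W_src: "p \<in> paths G \<Longrightarrow> x \<in> K \<Longrightarrow> W p (W (src G p) x) = W p x"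
  using W_cmp[of p "src G p" x] src_vertex[of p]
  by (simp add: vertex_in_paths rng_of_vertex cmp_src)

lemma W_idem: "a \<in> vertices G \<Longrightarrow> x \<in> K \<Longrightarrow> W a (W a x) = W a x"
  using W_rng[of a x] by (simp add: vertex_in_paths rng_of_vertex)

lemma orthogonal_projection_W: "a \<in> vertices G \<Longrightarrow> orthogonal_projection K (W a)"
  unfolding orthogonal_projection_def
  by (auto simp: bounded_operator_W vertex_in_paths W_idem W_vertex_adjoint
      intro!: adjoint_opI[OF K W_in])

text \<open>The initial space is the range of \<open>W (src G p)\<close>: a vector \<open>x\<close>
  orthogonal to the kernel is orthogonal to \<open>x - W (src G p) x\<close>, which
  \<open>W p\<close> kills.\<close>

lemma partial_isometry_W:
  assumes p: "p \<in> paths G"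
  shows "partial_isometry K (W p)"
  unfolding partial_isometry_def
proof (intro conjI ballI impI)
  show "bounded_operator K (W p)" by (rule bounded_operator_W[OF p])
  fix x assume x: "x \<in> K" and orth: "\<forall>y\<in>K. W p y = 0 \<longrightarrow> cinner x y = 0"
  note a = src_vertex[OF p] vertex_in_paths[OF src_vertex[OF p]]
  have "W p (x - W (src G p) x) = 0"
    by (simp add: clinear_diff[OF W_lin[OF p]] W_src[OF p x])
  then have "cinner x (x - W (src G p) x) = 0"
    using orth hilbert_space_diff[OF K x W_in[OF a(2)]] by blast
  then have "cinner x x = cinner (W (src G p) x) x"
    by (simp add: cinner_diff_right W_vertex_adjoint[OF a(1) x x])
  also have "\<dots> = cinner (W p x) (W p x)"
    by (simp add: cinner_W[OF p p] x)
  finally have "(norm x)\<^sup>2 = (norm (W p x))\<^sup>2"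
    by (simp add: norm_sq_cinner del: of_real_power)
  then show "norm (W p x) = norm x" by simp
qed

lemma toeplitz_family_W: "toeplitz_family G K W"
  unfolding toeplitz_family_def
proof (intro conjI ballI allI impI)
  show "partial_isometry K (W p)" if "p \<in> paths G" for p
    by (rule partial_isometry_W[OF that])
  show "orthogonal_projection K (W a)" if "a \<in> vertices G" for a
    by (rule orthogonal_projection_W[OF that])
  show "W a (W b x) = 0" if "a \<in> vertices G" "b \<in> vertices G" "a \<noteq> b" "x \<in> K" for a b x
    using that by (intro W_zero) (auto simp: vertex_in_paths src_of_vertex rng_of_vertex)
  show "W p (W q x) = W (cmp G p q) x" if "p \<in> paths G" "q \<in> paths G" "src G p = rng G q" "x \<in> K" for p q x
    by (rule W_cmp[OF that])
  show "adjoint_op K (W p) (W p x) = W (src G p) x" if "p \<in> paths G" "x \<in> K" for p x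
    using that by (simp add: adjoint_op_W Ad_W)
  fix n :: "nat ^ 2" and a F
  assume a: "a \<in> vertices G" and F: "finite F" "F \<subseteq> {p \<in> paths_of_shape G n. rng G p = a}"
  then have F': "F \<subseteq> paths_of_shape G n" "\<And>p. p \<in> F \<Longrightarrow> p \<in> paths G \<and> rng G p = a"
    by (auto simp: paths_of_shape_def)
  note a' = vertex_in_paths[OF a]
  show "op_le K (\<lambda>x. \<Sum>p\<in>F. W p (adjoint_op K (W p) x)) (W a)"
    unfolding op_le_def
  proof
    fix x assume x: "x \<in> K"
    define s where "s = (\<Sum>p\<in>F. W p (Ad p x))"
    have s_K: "s \<in> K"
      unfolding s_def using F' by (intro hilbert_space_sum[OF K] W_in) auto
    \<comment> \<open>All summands have range \<open>a\<close>, so \<open>s\<close> sees only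
      \<open>W a x\<close>; thus \<open>norm s \<le> norm (W a x)\<close>, and both squared norms
      are the quadratic forms to be compared.\<close>
    have "W a s = s"
      unfolding s_def clinear_sum[OF W_lin[OF a']]
      using F' W_rng Ad_in by (intro sum.cong) fastforce+
    then have "cinner s x = cinner s (W a x)"
      using W_vertex_adjoint[OF a s_K x] by simp
    moreover have s: "cinner s x = complex_of_real ((norm s)\<^sup>2)"
      unfolding s_def using range_sum[OF F(1) F'(1), of x] by simp
    ultimately have "complex_of_real ((norm s)\<^sup>2) = cinner s (W a x)" by simp
    then have "(norm s)\<^sup>2 = Re (cinner s (W a x))"
      by (metis Re_complex_of_real)
    then have "norm s \<le> norm (W a x)"
      using cinner_commute[of s "W a x"] by (intro norm_le_of_Re_cinner_le[of s "W a x" s]) auto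
    moreover have "cinner (W a x) x = complex_of_real ((norm (W a x))\<^sup>2)"
      using W_vertex_adjoint[OF a W_in[OF a'] x, of x] W_idem[OF a x] by (simp add: cinner_self)
    ultimately have "cinner (W a x - s) x \<in> \<real>\<^sub>\<ge>\<^sub>0"
      by (simp add: cinner_diff_left s power_mono flip: of_real_diff of_real_power)
    moreover have "(\<Sum>p\<in>F. W p (adjoint_op K (W p) x)) = s"
      unfolding s_def using F' by (intro sum.cong) (auto simp: adjoint_op_W)
    ultimately show "cinner (W a x - (\<Sum>p\<in>F. W p (adjoint_op K (W p) x))) x \<in> \<real>\<^sub>\<ge>\<^sub>0"
      by simp
  qed
qed

lemma row_contraction_W: "row_contraction K (paths_of_shape G n) W Ad"
  unfolding row_contraction_def
proof (intro conjI ballI allI impI K)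
  fix F and k :: "'l \<Rightarrow> 'k"
  assume F: "finite F" "F \<subseteq> paths_of_shape G n"
  then show "(norm (\<Sum>p\<in>F. W p (k p)))\<^sup>2 \<le> (\<Sum>p\<in>F. (norm (k p))\<^sup>2)"
    by (intro row_bound_of_adjoint_bound[where A = Ad] range_sum_le[OF F])
      (auto simp: cinner_Ad paths_of_shape_def subset_iff)
qed (auto simp: cinner_Ad Ad_in W_in paths_of_shape_def)

lemma range_projection_sum:
  "\<exists>S. bounded_operator K S \<and>
    has_strong_sum K (\<lambda>p x. W p (adjoint_op K (W p) x)) S (paths_of_shape G n) \<and> op_le K S (\<lambda>x. x)"
proof -
  let ?I = "paths_of_shape G n"
  obtain S where S: "clinear S" "\<And>x. norm (S x) \<le> norm x" "\<And>x. S x \<in> K"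
    "\<And>x. ((\<lambda>p. W p (Ad p x)) has_sum S x) ?I" "\<And>x. cinner (S x) x \<in> {0..complex_of_real ((norm x)\<^sup>2)}"
    by (rule row_contraction_has_sum[OF row_contraction_W[of n]]) (rule that; assumption)
  have "((\<lambda>p. W p (adjoint_op K (W p) x)) has_sum S x) ?I" for x
    using S(4)[of x] by (rule has_sum_cong[THEN iffD1, rotated]) (simp add: adjoint_op_W paths_of_shape_def)
  then have "has_strong_sum K (\<lambda>p x. W p (adjoint_op K (W p) x)) S ?I"
    by (simp add: has_strong_sum_def)
  moreover have "bounded_operator K S"
    unfolding bounded_operator_def
    using S(2,3) by (auto simp: clinear_add[OF S(1)] clinear_scaleC[OF S(1)] intro!: exI[of _ 1])
  moreover have "op_le K S (\<lambda>x. x)"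
    using S(5) by (auto simp: op_le_def cinner_diff_left cinner_self less_eq_complex_def complex_nonneg_Reals_iff)
  ultimately show ?thesis by blast
qed

lemma graph_contraction_W: "graph_contraction G K W"
  unfolding graph_contraction_def
  using bounded_operator_W W_zero W_cmp range_projection_sum orthogonal_projection_W by blast

lemma toeplitz_dilation_W:
  assumes V': "\<And>p h. p \<in> paths G \<Longrightarrow> h \<in> H \<Longrightarrow> adjoint_op H (V' p) h = A p h"
  shows "toeplitz_dilation G H V' K j W"
  unfolding toeplitz_dilation_def isometric_embedding_def
  using K j_in_K j_iso graph_contraction_W toeplitz_family_W
  by (auto simp: clinear_add[OF j_lin] clinear_scaleC[OF j_lin] adjoint_op_W Ad_j V')

lemma W_j_image: "p \<in> paths G \<Longrightarrow> W p ` j ` H = w p ` H"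
  by (auto simp: W_j image_image intro!: image_cong)

lemma K_eq: "K = closure (cspan (j ` H \<union> (\<Union>p\<in>paths G. W p ` j ` H)))"
  unfolding K_def gens_def by (simp add: W_j_image)

text \<open>The four inner products among \<open>w a h\<close> and \<open>j (V a h)\<close> all
  equal the squared norm of \<open>V a h\<close>, so the difference has norm zero.\<close>

lemma w_vertex:
  assumes a: "a \<in> vertices G" and h: "h \<in> H"
  shows "w a h = j (V a h)"
proof -
  note a' = vertex_in_paths[OF a]
  have 1: "cinner (w a h) (w a h) = cinner h (V a h)"
    using w_rng[OF a' h h] by (simp add: rng_of_vertex[OF a])
  have VV: "V a (V a h) = V a h"
    using V_cmp[OF a' a', of h] cmp_rng[OF a'] by (simp add: rng_of_vertex[OF a] src_of_vertex[OF a])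
  have 2: "cinner (w a h) (j (V a h)) = cinner (V a h) (V a h)"
    by (rule w_j[OF a' h])
  have 3: "cinner (j (V a h)) (w a h) = cinner (V a h) (V a h)"
    using 2 by (metis cinner_commute)
  have adj: "cinner g (V a g') = cinner (V a g) g'" if "g \<in> H" "g' \<in> H" for g g'
  proof -
    have "cinner g (V a g') = cinner (w a g) (w a g')"
      using w_rng[OF a' that] by (simp add: rng_of_vertex[OF a])
    also have "\<dots> = cnj (cinner g' (V a g))"
      using w_rng[OF a' that(2,1)] cinner_commute[of "w a g" "w a g'"] by (simp add: rng_of_vertex[OF a])
    finally show ?thesis by (simp flip: cinner_commute)
  qed
  have "cinner (V a h) (V a h) = cinner h (V a h)"
    using adj[OF h V_in[OF a', of h]] VV by simp
  then have "cinner (w a h - j (V a h)) (w a h - j (V a h)) = 0"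
    by (simp add: cinner_diff_left cinner_diff_right 1 2 3 j_iso)
  then show ?thesis by (simp add: cinner_self)
qed

text \<open>When the vertex projections sum to the identity, \<open>j h\<close> is the sum of the
  vectors \<open>w a h\<close>, so the generators \<open>j h\<close> already lie in the closed span
  of the rest.\<close>

lemma K_eq_minimal:
  assumes sum: "\<And>h. h \<in> H \<Longrightarrow> ((\<lambda>a. V a h) has_sum h) (vertices G)"
  shows "K = closure (cspan (\<Union>p\<in>paths G. W p ` j ` H))"
proof -
  let ?M = "closure (cspan (\<Union>p\<in>paths G. w p ` H))"
  have sub: "csubspace ?M"
    by (intro csubspace_closure complex_vector.subspace_span)
  have w_M: "w p h \<in> ?M" if "p \<in> paths G" "h \<in> H" for p h
    using that complex_vector.span_superset closure_subset by fastforce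
  have "j h \<in> ?M" if h: "h \<in> H" for h
  proof -
    have "norm (j x) \<le> 1 * norm x" for x
      using norm_cinner_preserving[of j, OF j_iso] by simp
    then have "((\<lambda>a. j (V a h)) has_sum j h) (vertices G)"
      using has_sum_bounded_linear[OF clinear_bounded_linear[OF j_lin] sum[OF h], unfolded o_def] by blast
    then show ?thesis
    proof (rule has_sum_in_closed)
      show "(\<Sum>a\<in>F. j (V a h)) \<in> ?M" if "finite F" "F \<subseteq> vertices G" for F
        using that h w_M vertex_in_paths
        by (intro complex_vector.subspace_sum[OF sub]) (auto simp: subset_iff simp flip: w_vertex)
    qed simp
  qed
  then have "gens \<subseteq> ?M"
    using w_M by (auto simp: gens_def)
  then have "K \<subseteq> ?M"
    unfolding K_def by (intro closure_minimal complex_vector.span_minimal sub) simp_all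
  moreover have "?M \<subseteq> K"
    unfolding K_def gens_def by (intro closure_mono complex_vector.span_mono) auto
  ultimately show ?thesis by (simp add: W_j_image)
qed

end

text \<open>The terms are the non-negative summands of the quadratic form of \<open>S\<close>, so
  any finite part is bounded by the whole, which lies below the identity.\<close>

lemma graph_contraction_row_bound:
  assumes H: "hilbert_space H" and V: "graph_contraction G H V"
    and F: "finite F" "F \<subseteq> paths_of_shape G n" and x: "x \<in> H"
  shows "(\<Sum>p\<in>F. (norm (adjoint_op H (V p) x))\<^sup>2) \<le> (norm x)\<^sup>2"
proof -
  have bd: "bounded_operator H (V p)" if "p \<in> paths G" for p
    using V that by (simp add: graph_contraction_def)
  obtain S where S: "has_strong_sum H (\<lambda>p x. V p (adjoint_op H (V p) x)) S (paths_of_shape G n)"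
    "op_le H S (\<lambda>x. x)"
    using V unfolding graph_contraction_def by blast
  have "((\<lambda>p. V p (adjoint_op H (V p) x)) has_sum S x) (paths_of_shape G n)"
    using S(1) x by (simp add: has_strong_sum_def)
  then have "((\<lambda>p. Re (cinner (V p (adjoint_op H (V p) x)) x)) has_sum Re (cinner (S x) x)) (paths_of_shape G n)"
    using has_sum_bounded_linear[OF bounded_linear_cinner_left, unfolded o_def] by (intro has_sum_Re) blast
  then have sum: "((\<lambda>p. (norm (adjoint_op H (V p) x))\<^sup>2) has_sum Re (cinner (S x) x)) (paths_of_shape G n)"
    by (rule has_sum_cong[THEN iffD1, rotated])
      (simp add: paths_of_shape_def cinner_adjoint_op[OF H bd] adjoint_op_in[OF H bd] x cinner_self)
  have "(\<Sum>p\<in>F. (norm (adjoint_op H (V p) x))\<^sup>2) \<le> Re (cinner (S x) x)"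
    by (rule finite_sum_le_has_sum[OF sum F]) simp
  also have "\<dots> \<le> (norm x)\<^sup>2"
    using S(2) x by (simp add: op_le_def complex_nonneg_Reals_iff cinner_diff_left norm_sq_cinner)
  finally show ?thesis .
qed

lemma minimal_dilation_exists:
  fixes G :: "('l, 2) rank_graph" and H :: "'h::complex_inner set" and V :: "'l \<Rightarrow> 'h \<Rightarrow> 'h"
  assumes G: "is_rank_graph G" and H: "hilbert_space H" and V: "graph_contraction G H V"
  shows "\<exists>(K :: ('l list, 'h) ell2 set) J W.
        toeplitz_dilation G H V K J W \<and>
        K = closure (cspan (J ` H \<union> (\<Union>p\<in>paths G. W p ` J ` H))) \<and>
        (has_strong_sum H V (\<lambda>x. x) (vertices G) \<longrightarrow>
           K = closure (cspan (\<Union>p\<in>paths G. W p ` J ` H)))"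
proof -
  interpret rank2_graph G by standard (rule G)
  have bd: "bounded_operator H (V p)" if "p \<in> paths G" for p
    using V that by (simp add: graph_contraction_def)
  define U where "U p x = V p (cproj H x)" for p x
  have U_in: "U p x \<in> H" if "p \<in> paths G" for p x
    unfolding U_def by (rule bounded_operator_total(4)[OF H bd[OF that]])
  have "\<exists>B. (\<forall>x y. cinner (U p x) y = cinner x (B y)) \<and> (\<forall>y. B y \<in> H)" if p: "p \<in> paths G" for p
  proof -
    obtain b where "\<And>x. norm (V p (cproj H x)) \<le> b * norm x"
      using bounded_operator_total(2)[OF H bd[OF p]] by blast
    then obtain B where "\<And>x y. cinner (V p (cproj H x)) y = cinner x (B y)" "\<And>y. B y \<in> H"
      using total_adjoint_exists[OF H bounded_operator_total(1)[OF H bd[OF p]] _ bounded_operator_total(3)[OF H bd[OF p]]]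
      by metis
    then show ?thesis unfolding U_def by blast
  qed
  then obtain A where A: "\<And>p x y. p \<in> paths G \<Longrightarrow> cinner (U p x) y = cinner x (A p y)"
    "\<And>p y. p \<in> paths G \<Longrightarrow> A p y \<in> H"
    by metis
  have A_adj: "adjoint_op H (V p) y = A p y" if "p \<in> paths G" for p y
    by (rule adjoint_opI[OF H A(2)[OF that]]) (simp add: U_def cproj_id[OF H] flip: A(1)[OF that])
  have U_cmp: "U (cmp G p q) h = U p (U q h)" if "p \<in> paths G" "q \<in> paths G" "src G p = rng G q" for p q h
    using V that cproj_in[OF H, of h] U_in[OF that(2), of h]
    by (simp add: U_def cproj_id[OF H] graph_contraction_def)
  have U_zero: "U p (U q h) = 0" if "p \<in> paths G" "q \<in> paths G" "src G p \<noteq> rng G q" for p q h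
    using V that cproj_in[OF H, of h] U_in[OF that(2), of h]
    by (simp add: U_def cproj_id[OF H] graph_contraction_def)
  have Q: "vertex_projections (vertices G) H U"
    unfolding U_def
  proof (rule vertex_projections_of_orthogonal[OF H])
    show "orthogonal_projection H (V a)" if "a \<in> vertices G" for a
      using V that by (simp add: graph_contraction_def)
    show "V a (V b x) = 0" if "a \<in> vertices G" "b \<in> vertices G" "a \<noteq> b" "x \<in> H" for a b x
      using V that
      by (simp add: graph_contraction_def vertex_in_paths src_of_vertex rng_of_vertex)
  qed
  have row: "row_contraction H (edges G i) U A" for i
    unfolding row_contraction_def
  proof (intro conjI ballI allI impI H)
    show "cinner (U x g) h = cinner g (A x h)" "U x g \<in> H" "A x g \<in> H" if "x \<in> edges G i" for x g h
      using A U_in edges_paths[OF that] by auto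
    fix F and k :: "'l \<Rightarrow> 'h" assume F: "finite F" "F \<subseteq> edges G i"
    have F': "x \<in> paths G" if "x \<in> F" for x
      using F(2) that edges_paths by blast
    show "(norm (\<Sum>x\<in>F. U x (k x)))\<^sup>2 \<le> (\<Sum>x\<in>F. (norm (k x))\<^sup>2)"
    proof (rule row_bound_of_adjoint_bound[OF _ _ F(1)])
      show "cinner (U x g) h = cinner g (A x h)" if "x \<in> F" for x g h
        by (rule A(1)[OF F'[OF that]])
      show "(\<Sum>x\<in>F. (norm (A x h))\<^sup>2) \<le> (norm h)\<^sup>2" for h
      proof -
        have "A x h = A x (cproj H h)" if "x \<in> F" for x
          by (rule cinner_eqI) (metis A(1) F' cinner_commute cinner_cproj[OF H] U_in that)
        then have "(\<Sum>x\<in>F. (norm (A x h))\<^sup>2) = (\<Sum>x\<in>F. (norm (adjoint_op H (V x) (cproj H h)))\<^sup>2)"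
          using F' by (intro sum.cong) (auto simp: A_adj)
        also have "\<dots> \<le> (norm (cproj H h))\<^sup>2"
          by (rule graph_contraction_row_bound[OF H V F cproj_in[OF H]])
        also have "\<dots> \<le> (norm h)\<^sup>2"
          by (intro power_mono norm_cproj_le[OF H]) simp
        finally show ?thesis .
      qed
    qed
  qed
  have U_edge: "edge_maps (vertices G) (rng G) (src G) (edges G i) U U" for i
    unfolding edge_maps_def
  proof (intro ballI conjI allI)
    fix x h assume "x \<in> edges G i"
    then have x: "x \<in> paths G" by (rule edges_paths)
    show v: "rng G x \<in> vertices G" "src G x \<in> vertices G"
      using x rng_vertex src_vertex by auto
    show "U (rng G x) (U x h) = U x h" "U x (U (src G x) h) = U x h"
      using U_cmp[of "rng G x" x h] U_cmp[of x "src G x" h] x v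
      by (simp_all add: vertex_in_paths rng_of_vertex src_of_vertex cmp_rng cmp_src)
  qed
  obtain L :: "('l, ('l, 'h) edge_dilation_space) edge_dilation_space set" and j w
    where "dilation_vectors G H U A L j w"
    using dilation_vectors_exist[OF G Q A(1) U_in A(2) row U_edge U_cmp U_zero] by blast
  then interpret L: dilation_vectors G H U A L j w .
  obtain \<phi> :: "('l, 'h) edge_dilation_space \<Rightarrow> ('l list, 'h) ell2"
    where \<phi>: "clinear \<phi>" "\<And>x y. cinner (\<phi> x) (\<phi> y) = cinner x y"
    by (rule edge_dilation_flatten[of "ell2_single []"])
      (auto simp: clinear_ell2_single cinner_ell2_single_left intro: that)
  obtain \<Phi> :: "('l, ('l, 'h) edge_dilation_space) edge_dilation_space \<Rightarrow> ('l list, 'h) ell2"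
    where \<Phi>: "clinear \<Phi>" "\<And>x y. cinner (\<Phi> x) (\<Phi> y) = cinner x y"
    by (rule edge_dilation_flatten[OF \<phi>]) (auto intro: that)
  \<comment> \<open>The vectors are moved to the required type before the operators are built: the
    locale refers only to their inner products, so the construction is repeated there instead of
    being transported.\<close>
  interpret D: dilation_vectors G H U A "\<Phi> ` L" "\<lambda>h. \<Phi> (j h)" "\<lambda>p h. \<Phi> (w p h)"
  proof
    show "hilbert_space (\<Phi> ` L)"
      by (rule hilbert_space_isometric_image[OF L.L \<Phi>])
    show "clinear (\<lambda>h. \<Phi> (j h))"
      by (rule clinear_comp[OF \<Phi>(1) L.j_lin])
  qed (use H A U_in U_cmp U_zero L.j_in L.j_iso L.w_in L.w_j L.w_rng L.w_cmp in \<open>auto simp: \<Phi>(2)\<close>)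
  show ?thesis
  proof (intro exI conjI impI)
    show "toeplitz_dilation G H V D.K (\<lambda>h. \<Phi> (j h)) D.W"
      by (rule D.toeplitz_dilation_W) (rule A_adj)
    show "D.K = closure (cspan ((\<lambda>h. \<Phi> (j h)) ` H \<union> (\<Union>p\<in>paths G. D.W p ` (\<lambda>h. \<Phi> (j h)) ` H)))"
      by (rule D.K_eq)
    assume "has_strong_sum H V (\<lambda>x. x) (vertices G)"
    then show "D.K = closure (cspan (\<Union>p\<in>paths G. D.W p ` (\<lambda>h. \<Phi> (j h)) ` H))"
      by (intro D.K_eq_minimal) (simp add: has_strong_sum_def U_def cproj_id[OF H])
  qed
qed

text \<open>Each generator \<open>W p (J h)\<close> is fixed by the projection at
  \<open>rng G p\<close>, so the sum of the projections is the identity on the closed span.\<close>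

lemma minimal_dilation_vertex_sum:
  fixes G :: "('l, 'r::finite) rank_graph" and K :: "'k::complex_inner set"
  assumes G: "small_category G" and H: "toeplitz_dilation G H V K J W"
    and K_eq: "K = closure (cspan (\<Union>p\<in>paths G. W p ` J ` H))"
  shows "has_strong_sum K W (\<lambda>x. x) (vertices G)"
proof -
  have K: "hilbert_space K" and J: "\<And>h. h \<in> H \<Longrightarrow> J h \<in> K" and T: "toeplitz_family G K W"
    using H by (auto simp: toeplitz_dilation_def isometric_embedding_def)
  have Q: "vertex_projections (vertices G) K (\<lambda>a x. W a (cproj K x))"
    by (rule vertex_projections_of_orthogonal[OF K]) (use T in \<open>auto simp: toeplitz_family_def\<close>)
  have Q_in: "W a (cproj K x) \<in> K" if "a \<in> vertices G" for a x
    using T that bounded_operator_total(4)[OF K] by (simp add: toeplitz_family_def orthogonal_projection_def)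
  have gen: "\<exists>a\<in>vertices G. W a (cproj K g) = g" if g: "g \<in> (\<Union>p\<in>paths G. W p ` J ` H)" for g
  proof -
    obtain p h where p: "p \<in> paths G" "h \<in> H" "g = W p (J h)" using g by auto
    have a: "rng G p \<in> vertices G" "rng G p \<in> paths G" "src G (rng G p) = rng G p" "cmp G (rng G p) p = p"
      using G p(1) by (auto simp: small_category_def)
    have "bounded_operator K (W p)"
      using T p(1) by (simp add: toeplitz_family_def partial_isometry_def)
    then have "g \<in> K"
      using J[OF p(2)] by (simp add: bounded_operator_def p(3))
    moreover have "W (rng G p) g = g"
      using T p a J[OF p(2)] unfolding toeplitz_family_def by metis
    ultimately show ?thesis
      using a(1) by (auto simp: cproj_id[OF K])
  qed
  show ?thesis
    unfolding has_strong_sum_def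
  proof
    fix x assume x: "x \<in> K"
    then have "x \<in> closure (cspan (\<Union>p\<in>paths G. W p ` J ` H))"
      by (subst (asm) K_eq)
    then have "((\<lambda>a. W a (cproj K x)) has_sum x) (vertices G)"
      by (intro vertex_projections_has_sum[OF Q Q_in gen])
    then show "((\<lambda>a. W a x) has_sum x) (vertices G)"
      by (simp add: cproj_id[OF K x])
  qed
qed

theorem theorem5p1:
  fixes G :: "('l, 2) rank_graph"
    and H :: "'h::complex_inner set"
    and V :: "'l \<Rightarrow> 'h \<Rightarrow> 'h"
  assumes "is_rank_graph G"
    and "hilbert_space H"
    and "graph_contraction G H V"
  shows
    "(\<exists>(K :: ('l list, 'h) ell2 set) J W.
        toeplitz_dilation G H V K J W \<and>
        K = closure (cspan (J ` H \<union> (\<Union>p\<in>paths G. W p ` J ` H))) \<and>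
        (has_strong_sum H V (\<lambda>x. x) (vertices G) \<longrightarrow>
           K = closure (cspan (\<Union>p\<in>paths G. W p ` J ` H)))) \<and>
     (\<forall>(K :: 'k::complex_inner set) J W.
        toeplitz_dilation G H V K J W \<longrightarrow>
        K = closure (cspan (\<Union>p\<in>paths G. W p ` J ` H)) \<longrightarrow>
        has_strong_sum H V (\<lambda>x. x) (vertices G) \<longrightarrow>
        has_strong_sum K W (\<lambda>x. x) (vertices G))"
proof (intro conjI allI impI)
  show "has_strong_sum K W (\<lambda>x. x) (vertices G)"
    if "toeplitz_dilation G H V K J W" "K = closure (cspan (\<Union>p\<in>paths G. W p ` J ` H))"
    for K :: "'k set" and J W
    using assms(1) that by (intro minimal_dilation_vertex_sum) (simp_all add: is_rank_graph_def)
qed (rule minimal_dilation_exists[OF assms])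

end
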